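(* Let $T>0$, $N\ge2$, let $\{\boldsymbol{q}_0^{(n)}\}_{n=1}^N$ be i.i.d. with density $f_0$, and let the setting and finite constants be as in the context. For a fixed $\boldsymbol{\alpha}\in\mathcal{A}$ and a fixed feature index $k\in\{1,\dots,K\}$, write $\boldsymbol{q}_T^{(n)}:=\Phi_T(\boldsymbol{q}_0^{(n)};\boldsymbol{\alpha})$, $\mu_k^{(n)}:=\varphi_k(\Pi_{\boldsymbol{X}}\boldsymbol{q}_T^{(n)})$, $G^{(n)}:=G(\boldsymbol{q}_T^{(n)},T;\boldsymbol{\alpha})$, $$\Delta_k:=\mu_k(\boldsymbol{\alpha})-\tilde\mu_k,\qquad b_k:=\mathbb{E}\bigl[\mu_k^{(n)}G^{(n)}\bigr]=\partial_{\boldsymbol{\alpha}}\mu_k(\boldsymbol{\alpha}),$$ together with the per-sample spreads $$\sigma_k^2:=\mathrm{Var}\bigl(\mu_k^{(n)}\bigr),\qquad v_k^2:=\mathbb{E}\bigl\|\mu_k^{(n)}G^{(n)}-b_k\bigr\|^2 .$$ Then the per-feature crossed U-statistic estimator $$\widehat g_k:=\frac{1}{N(N-1)}\sum_{1\le i\ne j\le N}\bigl(\mu_k^{(i)}-\tilde\mu_k\bigr)\,\mu_k^{(j)}\,G^{(j)}\in\mathbb{R}^p$$ satisfies, for every $N\ge2$, $$\Bigl(\mathbb{E}\bigl\|\widehat g_k-\mathbb{E}[\widehat g_k]\bigr\|^2\Bigr)^{1/2}\le\frac{\sigma_k\|b_k\|+|\Delta_k|\,v_k}{\sqrt N}+\frac{2M_\varphi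 v_k}{\sqrt N-1},$$ and in particular, for $N\ge4$, $$\mathbb{E}\bigl\|\widehat g_k-\mathbb{E}[\widehat g_k]\bigr\|^2\le\frac{49\,M_\varphi^4\,\Gamma_T^2}{N}.$$ The variance is therefore $O(1/N)$ with a constant that grows as $e^{2L_RT}$ through $\Sigma_T$. The first contribution carries the data misfit $\Delta_k$ as a factor and vanishes as the fit becomes exact, so near $\boldsymbol{\alpha}^\star$ the gradient noise is governed by $\sigma_k\|b_k\|$ and by the higher-order term.
   Context: Setting. $\mathcal{A}\subset\mathbb{R}^p$ is open. The vector field $\boldsymbol{R}:\mathbb{R}^d\times[0,T]\times\mathcal{A}\to\mathbb{R}^d$, written $\boldsymbol{R}(\boldsymbol{q},t;\boldsymbol{\alpha})$, is $C^1$ in $(\boldsymbol{q},t,\boldsymbol{\alpha})$ and globally Lipschitz in $\boldsymbol{q}$ uniformly in $(t,\boldsymbol{\alpha})$. The divergence $h_{\boldsymbol{\alpha}}(\boldsymbol{q},t):=\nabla_{\boldsymbol{q}}\cdot\boldsymbol{R}(\boldsymbol{q},t;\boldsymbol{\alpha})$ is $C^1$ in $(\boldsymbol{q},\boldsymbol{\alpha})$. The initial density $f_0$ is a probability density on $\mathbb{R}^d$ with support $\Omega\subseteq\mathbb{R}^d$; it is $C^1$ and strictly positive on the interior $\Omega^{\circ}$ of $\Omega$, and $\Omega^{\circ}$ has full $f_0$-measure. Norms are Euclidean norms of vectors and operator norms of matrices. Constants, all finite: $$L_R:=\sup_{(\boldsymbol{q},t,\boldsymbol{\alpha})}\|\nabla_{\boldsymbol{q}}\boldsymbol{R}\|,\quad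 M_R:=\sup_{(\boldsymbol{q},t,\boldsymbol{\alpha})}\|\partial_{\boldsymbol{\alpha}}\boldsymbol{R}\|,\quad L_h:=\sup_{(\boldsymbol{q},t,\boldsymbol{\alpha})}\|\nabla_{\boldsymbol{q}}h_{\boldsymbol{\alpha}}\|,\quad M_h:=\sup_{(\boldsymbol{q},t,\boldsymbol{\alpha})}\|\partial_{\boldsymbol{\alpha}}h_{\boldsymbol{\alpha}}\|,$$ the suprema over $\mathbb{R}^d\times[0,T]\times\mathcal{A}$; $C_{\nabla f}^2:=\mathbb{E}_{\boldsymbol{q}_0\sim f_0}\|\nabla\log f_0(\boldsymbol{q}_0)\|^2$ (gradient taken on $\Omega^{\circ}$); and $M_\varphi:=\max_{1\le k\le K}\|\varphi_k\|_{L^\infty(\mathbb{R}^{d_x})}$ for the continuous bounded test functions $\varphi_1,\dots,\varphi_K\in C_b(\mathbb{R}^{d_x})$. Further, $$\Sigma_T:=M_R\frac{e^{L_RT}-1}{L_R}\ (\text{with }\Sigma_T=M_RT\text{ if }L_R=0),\qquad C_r:=(M_h+L_h\Sigma_T)T,\qquad \Gamma_T^2:=2C_r^2+2C_{\nabla f}^2\Sigma_T^2 .$$ Flow map and density. For $\boldsymbol{q}_0\in\mathbb{R}^d$, $t\mapsto\Phi_t(\boldsymbol{q}_0;\boldsymbol{\alpha})$ is the unique solution on $[0,T]$ of $\dot{\boldsymbol{q}}=\boldsymbol{R}(\boldsymbol{q},t;\boldsymbol{\alpha})$, $\boldsymbol{q}(0)=\boldsymbol{q}_0$; each $\Phi_t(\cdot;\boldsymbol{\alpha})$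 is a $C^1$ diffeomorphism of $\mathbb{R}^d$. $f(\cdot,t\mid\boldsymbol{\alpha})$ denotes the density of the pushforward $(\Phi_t(\cdot;\boldsymbol{\alpha}))_{\#}f_0$; it belongs to $C^1(\mathbb{R}^d\times[0,T])$ and solves the Liouville equation $\partial_t f+\nabla_{\boldsymbol{Q}}\cdot(f\boldsymbol{R})=0$ with $f(\cdot,0\mid\boldsymbol{\alpha})=f_0$. Observation. $d=d_x+d_y$, $\mathbb{R}^d\ni\boldsymbol{Q}=(\boldsymbol{X},\boldsymbol{Y})$ with $\boldsymbol{X}\in\mathbb{R}^{d_x}$ observed and $\boldsymbol{Y}\in\mathbb{R}^{d_y}$ latent; $\Pi_{\boldsymbol{X}}(\boldsymbol{X},\boldsymbol{Y})=\boldsymbol{X}$. The marginal $f_{\boldsymbol{x}}(\boldsymbol{X},t\mid\boldsymbol{\alpha}):=\int_{\mathbb{R}^{d_y}}f(\boldsymbol{X},\boldsymbol{Y},t\mid\boldsymbol{\alpha})\,d\boldsymbol{Y}$ is assumed weakly differentiable with respect to $\boldsymbol{\alpha}$ with $\partial_{\boldsymbol{\alpha}}f_{\boldsymbol{x}}(\cdot,t\mid\boldsymbol{\alpha})\in L^1(\mathbb{R}^{d_x})$ for all $t\in[0,T]$, $\boldsymbol{\alpha}\in\mathcal{A}$. Moments and true parameter. $\mu_k(\boldsymbol{\alpha}):=\mathbb{E}_{\boldsymbol{q}_0\sim f_0}[\varphi_k(\Pi_{\boldsymbol{X}}\Phi_T(\boldsymbol{q}_0;\boldsymbol{\alpha}))]$;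 $\tilde\mu_k:=\int\varphi_k(\boldsymbol{X})\tilde f_{\boldsymbol{x}}(\boldsymbol{X},T)\,d\boldsymbol{X}$, where $\tilde f_{\boldsymbol{x}}(\cdot,T)$ is a given (observed) probability density on $\mathbb{R}^{d_x}$. $\boldsymbol{\alpha}^\star\in\mathcal{A}$ denotes the true parameter, for which $f_{\boldsymbol{x}}(\cdot,T\mid\boldsymbol{\alpha}^\star)=\tilde f_{\boldsymbol{x}}(\cdot,T)$, so that $\mu_k(\boldsymbol{\alpha}^\star)=\tilde\mu_k$ for every $k$. Eulerian sensitivity. For $\boldsymbol{Q}_T$ with $\Phi_T^{-1}(\boldsymbol{Q}_T;\boldsymbol{\alpha})\in\Omega^{\circ}$, $G(\boldsymbol{Q}_T,T;\boldsymbol{\alpha}):=\partial_{\boldsymbol{\alpha}}\log f(\boldsymbol{Q}_T,T\mid\boldsymbol{\alpha})\in\mathbb{R}^p$, the derivative being taken with $\boldsymbol{Q}_T$ held fixed; thus $G(\Phi_T(\boldsymbol{q}_0;\boldsymbol{\alpha}),T;\boldsymbol{\alpha})$ is defined for $f_0$-almost every $\boldsymbol{q}_0$. *)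

theory Defs
  imports "HOL-Probability.Probability" "HOL-Library.Landau_Symbols"
begin

text \<open>On a set with boundary such as \<open>UNIV \<times> {0..T} \<times> A\<close> the derivative is the one within the set,
  that is, one-sided at the end points of the time interval.\<close>

definition C1_on :: "('a::real_normed_vector \<Rightarrow> 'b::real_normed_vector) \<Rightarrow> 'a set \<Rightarrow> bool" where
  "C1_on F S \<longleftrightarrow>
     (\<exists>F'. (\<forall>x\<in>S. (F has_derivative blinfun_apply (F' x)) (at x within S)) \<and> continuous_on S F')"

definition gradient :: "('a::euclidean_space \<Rightarrow> real) \<Rightarrow> 'a \<Rightarrow> 'a" where
  "gradient F x = (THE D. GDERIV F x :> D)"

definition divergence :: "('a::euclidean_space \<Rightarrow> 'a) \<Rightarrow> 'a \<Rightarrow> real" where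
  "divergence F x = (\<Sum>e\<in>Basis. frechet_derivative F (at x) e \<bullet> e)"

definition C1_diffeomorphism :: "('a::real_normed_vector \<Rightarrow> 'a) \<Rightarrow> bool" where
  "C1_diffeomorphism F \<longleftrightarrow> bij F \<and> C1_on F UNIV \<and> C1_on (inv F) UNIV"

text \<open>Test functions are \<open>C\<^sup>1\<close> with compact support in \<open>A\<close>; for locally integrable \<open>u\<close> and \<open>g\<close> this
  class and the smooth compactly supported functions define the same weak gradients (mollify).\<close>

definition is_weak_gradient ::
    "'p::euclidean_space set \<Rightarrow> ('p \<Rightarrow> real) \<Rightarrow> ('p \<Rightarrow> 'p) \<Rightarrow> bool" where
  "is_weak_gradient A u g \<longleftrightarrow>
     (\<forall>C. compact C \<longrightarrow> C \<subseteq> A \<longrightarrow> set_integrable lborel C u \<and> set_integrable lborel C g) \<and>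
     (\<forall>\<psi>. C1_on \<psi> UNIV \<longrightarrow> compact (closure {a. \<psi> a \<noteq> 0}) \<longrightarrow> closure {a. \<psi> a \<noteq> 0} \<subseteq> A \<longrightarrow>
        (LINT a:A|lborel. u a *\<^sub>R gradient \<psi> a) = - (LINT a:A|lborel. \<psi> a *\<^sub>R g a))"

definition probability_density :: "('a::euclidean_space \<Rightarrow> real) \<Rightarrow> bool" where
  "probability_density g \<longleftrightarrow>
     g \<in> borel_measurable borel \<and> (\<forall>x. 0 \<le> g x) \<and> prob_space (density lborel g)"

abbreviation law :: "('a::euclidean_space \<Rightarrow> real) \<Rightarrow> 'a measure" where
  "law g \<equiv> density lborel (\<lambda>x. ennreal (g x))"

definition supp :: "('a::euclidean_space \<Rightarrow> real) \<Rightarrow> 'a set" where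
  "supp g = closure {x. g x \<noteq> 0}"

definition div_field :: "('q::euclidean_space \<Rightarrow> real \<Rightarrow> 'p \<Rightarrow> 'q) \<Rightarrow> 'q \<Rightarrow> real \<Rightarrow> 'p \<Rightarrow> real" where
  "div_field R q t a = divergence (\<lambda>x. R x t a) q"

text \<open>The constants below are suprema of real functions and are meaningful only when these are
  bounded; boundedness is assumed in the setting by means of \<open>bounded_over\<close>.\<close>

definition sup_over :: "real \<Rightarrow> 'p set \<Rightarrow> ('q \<Rightarrow> real \<Rightarrow> 'p \<Rightarrow> real) \<Rightarrow> real" where
  "sup_over T A F = (SUP (q, t, a) \<in> UNIV \<times> {0..T} \<times> A. F q t a)"

definition bounded_over :: "real \<Rightarrow> 'p set \<Rightarrow> ('q \<Rightarrow> real \<Rightarrow> 'p \<Rightarrow> real) \<Rightarrow> bool" where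
  "bounded_over T A F \<longleftrightarrow> bdd_above ((\<lambda>(q, t, a). F q t a) ` (UNIV \<times> {0..T} \<times> A))"

definition norm_dq_R :: "('q::euclidean_space \<Rightarrow> real \<Rightarrow> 'p::euclidean_space \<Rightarrow> 'q) \<Rightarrow> 'q \<Rightarrow> real \<Rightarrow> 'p \<Rightarrow> real" where
  "norm_dq_R R q t a = onorm (frechet_derivative (\<lambda>x. R x t a) (at q))"

definition norm_da_R :: "('q::euclidean_space \<Rightarrow> real \<Rightarrow> 'p::euclidean_space \<Rightarrow> 'q) \<Rightarrow> 'q \<Rightarrow> real \<Rightarrow> 'p \<Rightarrow> real" where
  "norm_da_R R q t a = onorm (frechet_derivative (\<lambda>b. R q t b) (at a))"

definition norm_dq_h :: "('q::euclidean_space \<Rightarrow> real \<Rightarrow> 'p::euclidean_space \<Rightarrow> 'q) \<Rightarrow> 'q \<Rightarrow> real \<Rightarrow> 'p \<Rightarrow> real" where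
  "norm_dq_h R q t a = norm (gradient (\<lambda>x. div_field R x t a) q)"

definition norm_da_h :: "('q::euclidean_space \<Rightarrow> real \<Rightarrow> 'p::euclidean_space \<Rightarrow> 'q) \<Rightarrow> 'q \<Rightarrow> real \<Rightarrow> 'p \<Rightarrow> real" where
  "norm_da_h R q t a = norm (gradient (\<lambda>b. div_field R q t b) a)"

definition score_energy :: "('q::euclidean_space \<Rightarrow> real) \<Rightarrow> real" where
  "score_energy f0 =
     (LINT q:interior (supp f0)|law f0. (norm (gradient (\<lambda>x. ln (f0 x)) q))\<^sup>2)"

definition feature_bound :: "nat \<Rightarrow> (nat \<Rightarrow> 'x::euclidean_space \<Rightarrow> real) \<Rightarrow> real" where
  "feature_bound K \<phi> =
     Max ((\<lambda>k. real_of_ereal (esssup lborel (\<lambda>x. ereal \<bar>\<phi> k x\<bar>))) ` {1..K})"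

definition Sigma_const :: "real \<Rightarrow> real \<Rightarrow> real \<Rightarrow> real" where
  "Sigma_const LR MR T = (if LR = 0 then MR * T else MR * ((exp (LR * T) - 1) / LR))"

definition Cr_const :: "real \<Rightarrow> real \<Rightarrow> real \<Rightarrow> real \<Rightarrow> real \<Rightarrow> real" where
  "Cr_const LR MR Lh Mh T = (Mh + Lh * Sigma_const LR MR T) * T"

text \<open>The square of \<open>\<Gamma>\<^sub>T\<close>; the argument \<open>C2\<close> is the square of the score constant of \<open>f0\<close>.\<close>

definition Gamma_sq :: "real \<Rightarrow> real \<Rightarrow> real \<Rightarrow> real \<Rightarrow> real \<Rightarrow> real \<Rightarrow> real" where
  "Gamma_sq LR MR Lh Mh C2 T =
     2 * (Cr_const LR MR Lh Mh T)\<^sup>2 + 2 * C2 * (Sigma_const LR MR T)\<^sup>2"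

text \<open>The flow map \<open>\<Phi> t q a\<close> and the density \<open>f q t a\<close> carry time, state and parameter; the state
  is a pair of an observed and a latent component.\<close>

definition marginal :: "('x::euclidean_space \<times> 'y::euclidean_space \<Rightarrow> real \<Rightarrow> 'p \<Rightarrow> real) \<Rightarrow> 'x \<Rightarrow> real \<Rightarrow> 'p \<Rightarrow> real" where
  "marginal f X t a = (LINT Y|lborel. f (X, Y) t a)"

definition moment ::
    "('x::euclidean_space \<times> 'y::euclidean_space \<Rightarrow> real) \<Rightarrow> (real \<Rightarrow> 'x \<times> 'y \<Rightarrow> 'p \<Rightarrow> 'x \<times> 'y) \<Rightarrow> real \<Rightarrow>
     ('x \<Rightarrow> real) \<Rightarrow> 'p \<Rightarrow> real" where
  "moment f0 \<Phi> T \<phi> a = (LINT q|law f0. \<phi> (fst (\<Phi> T q a)))"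

definition observed_moment :: "('x::euclidean_space \<Rightarrow> real) \<Rightarrow> ('x \<Rightarrow> real) \<Rightarrow> real" where
  "observed_moment ftilde \<phi> = (LINT X|lborel. \<phi> X * ftilde X)"

text \<open>The sensitivity \<open>G(Q, T; a)\<close> is a partial function of \<open>Q\<close>. It is extended by 0, off a set of
  zero probability at \<open>Q = \<Phi> T q0 a\<close>.\<close>

definition sensitivity ::
    "('q::euclidean_space \<Rightarrow> real) \<Rightarrow> (real \<Rightarrow> 'q \<Rightarrow> 'p::euclidean_space \<Rightarrow> 'q) \<Rightarrow>
     ('q \<Rightarrow> real \<Rightarrow> 'p \<Rightarrow> real) \<Rightarrow> 'q \<Rightarrow> real \<Rightarrow> 'p \<Rightarrow> 'p" where
  "sensitivity f0 \<Phi> f Q T a =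
     (if inv (\<lambda>q. \<Phi> T q a) Q \<in> interior (supp f0) then gradient (\<lambda>b. ln (f Q T b)) a else 0)"

definition crossed_estimator :: "nat \<Rightarrow> (nat \<Rightarrow> real) \<Rightarrow> real \<Rightarrow> (nat \<Rightarrow> 'p::real_vector) \<Rightarrow> 'p" where
  "crossed_estimator N m mt G =
     (1 / (real N * (real N - 1))) *\<^sub>R
       (\<Sum>(i, j) \<in> {(i, j). i \<in> {1..N} \<and> j \<in> {1..N} \<and> i \<noteq> j}. ((m i - mt) * m j) *\<^sub>R G j)"

locale liouville_setting =
  fixes A :: "'p::euclidean_space set"
    and T :: real
    and R :: "'x::euclidean_space \<times> 'y::euclidean_space \<Rightarrow> real \<Rightarrow> 'p \<Rightarrow> 'x \<times> 'y"
    and f0 :: "'x \<times> 'y \<Rightarrow> real"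
    and \<Phi> :: "real \<Rightarrow> 'x \<times> 'y \<Rightarrow> 'p \<Rightarrow> 'x \<times> 'y"
    and f :: "'x \<times> 'y \<Rightarrow> real \<Rightarrow> 'p \<Rightarrow> real"
    and K :: nat
    and \<phi> :: "nat \<Rightarrow> 'x \<Rightarrow> real"
    and ftilde :: "'x \<Rightarrow> real"
    and a_star :: 'p
  assumes horizon: "0 < T"
    and open_parameters: "open A"
    and field_C1: "C1_on (\<lambda>(q, t, a). R q t a) (UNIV \<times> {0..T} \<times> A)"
    and field_lipschitz: "\<exists>L. \<forall>t\<in>{0..T}. \<forall>a\<in>A. L-lipschitz_on UNIV (\<lambda>q. R q t a)"
    and divergence_C1: "\<And>t. t \<in> {0..T} \<Longrightarrow> C1_on (\<lambda>(q, a). div_field R q t a) (UNIV \<times> A)"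
    and init_density: "probability_density f0"
    and init_C1: "C1_on f0 (interior (supp f0))"
    and init_pos: "\<And>q. q \<in> interior (supp f0) \<Longrightarrow> 0 < f0 q"
    and init_full: "AE q in law f0. q \<in> interior (supp f0)"
    and finite_LR: "bounded_over T A (norm_dq_R R)"
    and finite_MR: "bounded_over T A (norm_da_R R)"
    and finite_Lh: "bounded_over T A (norm_dq_h R)"
    and finite_Mh: "bounded_over T A (norm_da_h R)"
    and finite_energy:
      "set_integrable (law f0) (interior (supp f0)) (\<lambda>q. (norm (gradient (\<lambda>x. ln (f0 x)) q))\<^sup>2)"
    and flow_init: "\<And>q a. a \<in> A \<Longrightarrow> \<Phi> 0 q a = q"
    and flow_ode: "\<And>q t a. a \<in> A \<Longrightarrow> t \<in> {0..T} \<Longrightarrow>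
      ((\<lambda>s. \<Phi> s q a) has_vector_derivative R (\<Phi> t q a) t a) (at t within {0..T})"
    and flow_diffeo: "\<And>t a. a \<in> A \<Longrightarrow> t \<in> {0..T} \<Longrightarrow> C1_diffeomorphism (\<lambda>q. \<Phi> t q a)"
    and density_nonneg: "\<And>q t a. a \<in> A \<Longrightarrow> t \<in> {0..T} \<Longrightarrow> 0 \<le> f q t a"
    and density_pushforward: "\<And>t a. a \<in> A \<Longrightarrow> t \<in> {0..T} \<Longrightarrow>
      distr (law f0) borel (\<lambda>q. \<Phi> t q a) = law (\<lambda>q. f q t a)"
    and density_C1: "\<And>a. a \<in> A \<Longrightarrow> C1_on (\<lambda>(q, t). f q t a) (UNIV \<times> {0..T})"
    and liouville: "\<And>q t a. a \<in> A \<Longrightarrow> t \<in> {0..T} \<Longrightarrow>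
      ((\<lambda>s. f q s a) has_real_derivative - divergence (\<lambda>x. f x t a *\<^sub>R R x t a) q)
        (at t within {0..T})"
    and density_init: "\<And>q a. a \<in> A \<Longrightarrow> f q 0 a = f0 q"
    and marginal_weak: "\<exists>g. \<forall>t\<in>{0..T}.
      (AE X in lborel. is_weak_gradient A (\<lambda>a. marginal f X t a) (\<lambda>a. g X t a)) \<and>
      (\<forall>a\<in>A. integrable lborel (\<lambda>X. g X t a))"
    and test_continuous: "\<And>k. k \<in> {1..K} \<Longrightarrow> continuous_on UNIV (\<phi> k)"
    and test_bounded: "\<And>k. k \<in> {1..K} \<Longrightarrow> bounded (range (\<phi> k))"
    and observed_density: "probability_density ftilde"
    and true_parameter: "a_star \<in> A"
    and true_marginal: "AE X in lborel. marginal f X T a_star = ftilde X"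

end

theory Submission
  imports Defs "HOL-Real_Asymp.Real_Asymp"
begin

text \<open>
  The theorem combines a variance computation, which is pure probability, with the analytic fact that
  the sensitivity \<open>G\<close> exists, is the score of the transported density, and satisfies
  \<open>\<parallel>G(\<Phi>\<^sub>T(q))\<parallel> \<le> \<Sigma>\<^sub>T \<parallel>\<nabla> log f\<^sub>0(q)\<parallel> + C\<^sub>r\<close>.

  \<^emph>\<open>Sensitivity.\<close> Fix the end point \<open>Q\<close> and run the flow backwards, \<open>\<Psi> s Q a\<close> being the state at time
  \<open>T - s\<close>. Integrating the Liouville equation along this curve gives
  \<open>f Q T a = f\<^sub>0 (\<Psi> T Q a) exp (- \<integral>\<^sub>0\<^sup>T h (\<Psi> s Q a, T - s; a) ds)\<close> (\<open>density_along_backward_flow\<close>).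
  Since \<open>\<Psi>\<close> starts at the fixed point \<open>Q\<close>, it depends on \<open>a\<close> only through the field. Gronwall's
  inequality bounds its Lipschitz constant in \<open>a\<close> by \<open>\<Sigma>\<^sub>T\<close>, and its derivative in \<open>a\<close> solves the linear
  variational equation (\<open>y_parameter_derivative\<close>). Differentiating the displayed formula yields existence,
  joint continuity and the bound of \<open>G\<close> (\<open>transported_density_gradient\<close>), hence
  \<open>E \<parallel>G\<parallel>\<^sup>2 \<le> \<Gamma>\<^sub>T\<^sup>2\<close>.

  \<^emph>\<open>Gradient of the moment.\<close> As \<open>\<nabla>\<^sub>a f = f G\<close> everywhere, the fundamental theorem of calculus on a segment
  of parameters and Fubini's theorem express the increments of the moment as integrals of
  \<open>b(a) = E (\<phi> G)\<close> along the segment. The bound on \<open>G\<close> in the coordinates of the initial state does not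
  depend on \<open>a\<close>, so \<open>b\<close> is continuous by dominated convergence, and \<open>b\<close> is the gradient
  (\<open>GDERIV_lborel_integral\<close>, \<open>GDERIV_moment\<close>).

  \<^emph>\<open>Variance.\<close> With \<open>\<xi>\<^sub>i\<close> and \<open>\<eta>\<^sub>j\<close> the centred features and the centred products \<open>\<mu>\<^sub>j G\<^sub>j\<close>, the estimator
  minus its mean is the linear part \<open>(1/N) \<Sum>\<^sub>i (\<xi>\<^sub>i b + \<Delta> \<eta>\<^sub>i)\<close> plus the degenerate part
  \<open>1/(N(N-1)) \<Sum>\<^sub>j (\<Sum>\<^sub>i\<^sub>\<noteq>\<^sub>j \<xi>\<^sub>i) \<eta>\<^sub>j\<close>. By independence each of the two pieces of the linear part is a sum of
  \<open>N\<close> orthogonal terms, and each summand of the degenerate part has second moment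
  \<open>(N-1) \<sigma>\<^sup>2 v\<^sup>2\<close>. Minkowski's inequality gives the bound with \<open>\<sigma> v / sqrt (N-1)\<close> as the second term,
  which is at most \<open>2 M v / (sqrt N - 1)\<close> because \<open>\<sigma> \<le> M\<close> (\<open>crossed_estimator_bound\<close>). Inserting \<open>\<sigma> \<le> M\<close>,
  \<open>\<parallel>b\<parallel>, v \<le> M \<Gamma>\<^sub>T\<close>, \<open>\<bar>\<Delta>\<bar> \<le> 2 M\<close> and, for \<open>N \<ge> 4\<close>, \<open>sqrt N - 1 \<ge> sqrt N / 2\<close> gives the factor
  \<open>(1 + 2 + 4)\<^sup>2 = 49\<close>.

  \<^emph>\<open>Growth.\<close> The lower bound \<open>\<Gamma>\<^sub>T\<^sup>2 \<in> \<Omega>(exp (2 L T))\<close> needs a positive score energy: were it zero, \<open>f\<^sub>0\<close>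
  would be constant on the whole space and not integrable (\<open>score_energy_pos\<close>).
\<close>

section \<open>Gronwall's inequality and linear Volterra equations\<close>

lemma Sigma_const_nonneg:
  assumes "0 \<le> c" "0 \<le> t"
  shows "0 \<le> Sigma_const L c t"
proof (cases "L = 0")
  case False
  have "0 \<le> (exp (L * t) - 1) / L"
  proof (cases "L > 0")
    case True
    then show ?thesis using assms by simp
  next
    case neg: False
    then have "L * t \<le> 0" using assms by (simp add: mult_nonpos_nonneg)
    then have "exp (L * t) \<le> 1" by simp
    then show ?thesis using neg by (simp add: divide_nonpos_nonpos)
  qed
  then have "0 \<le> c * ((exp (L * t) - 1) / L)" using assms by (intro mult_nonneg_nonneg)
  then show ?thesis using False by (simp add: Sigma_const_def)
qed (use assms in \<open>simp add: Sigma_const_def\<close>)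

text \<open>The constant \<open>Sigma_const L c\<close> is the solution of \<open>S' = L S + c\<close>, \<open>S 0 = 0\<close>; it is the
  comparison function in Gronwall's inequality below.\<close>

lemma Sigma_const_has_derivative:
  "((\<lambda>t. Sigma_const L c t) has_real_derivative L * Sigma_const L c t + c) (at t within S)"
proof (cases "L = 0")
  case True
  have "((\<lambda>t. c * t) has_real_derivative c) (at t within S)"
    by (auto intro!: derivative_eq_intros)
  then show ?thesis using True by (simp add: Sigma_const_def)
next
  case False
  have "((\<lambda>t. c * ((exp (L * t) - 1) / L)) has_real_derivative L * (c * ((exp (L * t) - 1) / L)) + c)
      (at t within S)"
    by (rule derivative_eq_intros | use False in \<open>simp add: field_simps\<close>)+
  then show ?thesis using False by (simp add: Sigma_const_def)
qed

lemma Sigma_const_mono: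
  assumes "0 \<le> c" "0 \<le> L" "0 \<le> s" "s \<le> t"
  shows "Sigma_const L c s \<le> Sigma_const L c t"
proof (rule DERIV_nonneg_imp_nondecreasing[OF \<open>s \<le> t\<close>])
  fix x assume "s \<le> x" "x \<le> t"
  then show "\<exists>y. ((\<lambda>t. Sigma_const L c t) has_real_derivative y) (at x) \<and> 0 \<le> y"
    using Sigma_const_has_derivative[of L c x UNIV] Sigma_const_nonneg[of c x L] assms
    by (intro exI[of _ "L * Sigma_const L c x + c"] conjI) auto
qed

lemma Sigma_const_mult: "Sigma_const L (c * d) t = Sigma_const L c t * d"
  by (simp add: Sigma_const_def)

lemma Sigma_const_0 [simp]: "Sigma_const L 0 t = 0"
  by (simp add: Sigma_const_def)

lemma gronwall_integral:
  fixes u :: "real \<Rightarrow> real"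
  assumes cont: "continuous_on {0..T} u" and "0 \<le> L"
    and le: "\<And>t. t \<in> {0..T} \<Longrightarrow> u t \<le> B + integral {0..t} (\<lambda>s. L * u s + c)"
    and t: "t \<in> {0..T}"
  shows "u t \<le> B * exp (L * t) + Sigma_const L c t"
proof -
  define m where "m = (\<lambda>t. B + integral {0..t} (\<lambda>s. L * u s + c))"
  define k where "k = (\<lambda>t. (m t - B * exp (L * t) - Sigma_const L c t) * exp (- (L * t)))"
  have cont': "continuous_on {0..T} (\<lambda>s. L * u s + c)"
    by (intro continuous_intros cont)
  have dm: "(m has_real_derivative L * u s + c) (at s within {0..T})" if "s \<in> {0..T}" for s
    unfolding m_def
    by (rule derivative_eq_intros integral_has_real_derivative[OF cont'] that | simp add: that)+
  have dk: "(k has_real_derivative L * (u s - m s) * exp (- (L * s))) (at s within {0..T})"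
    if "s \<in> {0..T}" for s
    unfolding k_def
    by (rule derivative_eq_intros dm that Sigma_const_has_derivative refl | (simp add: algebra_simps; fail))+
  have "k t \<le> k 0"
  proof (rule DERIV_nonpos_imp_decreasing_open[where f = k])
    show "0 \<le> t" using t by simp
    show "continuous_on {0..t} k"
      using t by (intro continuous_on_subset[OF DERIV_continuous_on[OF dk]]) auto
  next
    fix x assume x: "0 < x" "x < t"
    then have xT: "x \<in> {0..T}" and "at x within {0..T} = at x"
      using t by (auto intro!: at_within_Icc_at)
    then have "(k has_real_derivative L * (u x - m x) * exp (- (L * x))) (at x)"
      using dk by metis
    moreover have "L * (u x - m x) * exp (- (L * x)) \<le> 0"
      using le[OF xT] \<open>0 \<le> L\<close> by (auto simp: m_def mult_nonneg_nonpos mult_nonpos_nonneg)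
    ultimately show "\<exists>y. (k has_real_derivative y) (at x) \<and> y \<le> 0" by blast
  qed
  also have "k 0 = 0" by (simp add: k_def m_def Sigma_const_def)
  finally have "m t \<le> B * exp (L * t) + Sigma_const L c t"
    by (simp add: k_def mult_le_0_iff)
  then show ?thesis using le[OF t] by (simp add: m_def)
qed

text \<open>The substitution \<open>s = t r\<close> turns the variable upper limit into the fixed interval \<open>[0, 1]\<close>.\<close>

lemma continuous_on_indefinite_integral_param:
  fixes g :: "real \<Rightarrow> 'z::topological_space \<Rightarrow> 'b::banach"
  assumes "continuous_on ({0..T} \<times> Z) (\<lambda>(s, z). g s z)"
  shows "continuous_on ({0..T} \<times> Z) (\<lambda>(t, z). integral {0..t} (\<lambda>s. g s z))"
proof -
  have eq: "integral {0..t} (\<lambda>s. g s z) = t *\<^sub>R integral {0..1} (\<lambda>r. g (t * r) z)"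
    if "t \<in> {0..T}" "z \<in> Z" for t z
  proof (cases "t = 0")
    case False
    then have "t > 0" using that by simp
    have "continuous_on {0..t} (\<lambda>s. (\<lambda>(s, z). g s z) (s, z))"
      by (rule continuous_on_compose2[OF assms]) (use that in \<open>auto intro!: continuous_intros\<close>)
    then have "((\<lambda>s. g s z) has_integral integral {0..t} (\<lambda>s. g s z)) {0..t}"
      by (intro integrable_integral integrable_continuous_interval) simp
    from has_integral_stretch_real[OF this False]
    have "((\<lambda>r. g (t * r) z) has_integral (1 / \<bar>t\<bar>) *\<^sub>R integral {0..t} (\<lambda>s. g s z)) {0..1}"
      using \<open>t > 0\<close> by (simp add: image_divide_atLeastAtMost)
    then have "integral {0..1} (\<lambda>r. g (t * r) z) = (1 / \<bar>t\<bar>) *\<^sub>R integral {0..t} (\<lambda>s. g s z)"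
      by (rule integral_unique)
    then show ?thesis using \<open>t > 0\<close> by simp
  qed simp
  have "continuous_on (({0..T} \<times> Z) \<times> cbox 0 1) (\<lambda>p. (\<lambda>(s, z). g s z) (fst (fst p) * snd p, snd (fst p)))"
    by (rule continuous_on_compose2[OF assms])
      (auto intro!: continuous_intros mult_le_one mult_nonneg_nonneg simp: mult_left_le order_trans[OF mult_left_le])
  then have "continuous_on (({0..T} \<times> Z) \<times> cbox 0 1) (\<lambda>(p, r). g (fst p * r) (snd p))"
    by (simp add: case_prod_unfold)
  from integral_continuous_on_param[OF this]
  have "continuous_on ({0..T} \<times> Z) (\<lambda>p. fst p *\<^sub>R integral {0..1} (\<lambda>r. g (fst p * r) (snd p)))"
    by (intro continuous_intros) simp
  then show ?thesis
    by (subst continuous_on_cong[OF refl]) (auto simp: eq)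
qed

text \<open>Picard iteration with a parameter \<open>z\<close>. Since the Lipschitz constant \<open>L\<close> and the bound
  \<open>C\<close> do not depend on \<open>z\<close>, the iterates converge uniformly in \<open>(t, z)\<close> and the solution is jointly continuous.\<close>

lemma volterra_solution:
  fixes g :: "real \<Rightarrow> 'z::topological_space \<Rightarrow> 'b::banach \<Rightarrow> 'b"
  assumes cont: "continuous_on ({0..T} \<times> Z \<times> UNIV) (\<lambda>(s, z, v). g s z v)"
    and lip: "\<And>s z v w. s \<in> {0..T} \<Longrightarrow> z \<in> Z \<Longrightarrow> norm (g s z v - g s z w) \<le> L * norm (v - w)"
    and bound: "\<And>s z. s \<in> {0..T} \<Longrightarrow> z \<in> Z \<Longrightarrow> norm (g s z 0) \<le> C"
    and "0 \<le> L" "0 \<le> C" "0 \<le> T"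
  obtains V where "continuous_on ({0..T} \<times> Z) (\<lambda>(t, z). V t z)"
    and "\<And>t z. t \<in> {0..T} \<Longrightarrow> z \<in> Z \<Longrightarrow> V t z = integral {0..t} (\<lambda>s. g s z (V s z))"
proof -
  define P where "P = (\<lambda>v t z. integral {0..t} (\<lambda>s. g s z (v s z)))"
  define v where "v = (\<lambda>n. (P ^^ n) (\<lambda>t z. 0))"
  have v0: "v 0 = (\<lambda>t z. 0)" and vS: "v (Suc n) = P (v n)" for n
    by (simp_all add: v_def)
  have vS': "v (Suc n) t z = integral {0..t} (\<lambda>s. g s z (v n s z))" for n t z
    by (simp add: vS P_def)
  have comp: "continuous_on ({0..T} \<times> Z) (\<lambda>(s, z). g s z (w s z))"
    if w: "continuous_on ({0..T} \<times> Z) (\<lambda>(t, z). w t z)" for w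
  proof -
    have "continuous_on ({0..T} \<times> Z) (\<lambda>p. (\<lambda>(s, z, v). g s z v) (fst p, snd p, (\<lambda>(t, z). w t z) p))"
      by (rule continuous_on_compose2[OF cont]) (auto intro!: continuous_intros w)
    then show ?thesis by (simp add: case_prod_unfold)
  qed
  have cv: "continuous_on ({0..T} \<times> Z) (\<lambda>(t, z). v n t z)" for n
  proof (induction n)
    case (Suc n)
    show ?case
      unfolding vS P_def by (rule continuous_on_indefinite_integral_param[OF comp[OF Suc]])
  qed (simp add: v0)
  have int: "(\<lambda>s. g s z (w s z)) integrable_on {0..t}"
    if w: "continuous_on ({0..T} \<times> Z) (\<lambda>(t, z). w t z)" and "t \<in> {0..T}" "z \<in> Z" for w t z
  proof (rule integrable_continuous_interval)
    have "continuous_on {0..t} (\<lambda>s. (\<lambda>(s, z). g s z (w s z)) (s, z))"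
      by (rule continuous_on_compose2[OF comp[OF w]]) (use that in \<open>auto intro!: continuous_intros\<close>)
    then show "continuous_on {0..t} (\<lambda>s. g s z (w s z))" by simp
  qed
  have step: "norm (v (Suc n) t z - v n t z) \<le> C * L ^ n * t ^ Suc n / fact (Suc n)"
    if "t \<in> {0..T}" "z \<in> Z" for n t z
    using that
  proof (induction n arbitrary: t)
    case 0
    have "norm (integral {0..t} (\<lambda>s. g s z 0)) \<le> C * (t - 0)"
      by (rule integral_bound) (use 0 bound int[OF cv[of 0], of t z] in \<open>auto simp: v0
        intro!: continuous_on_subset[OF continuous_on_compose2[OF cont, of _ "\<lambda>s. (s, z, 0)", simplified]] continuous_intros\<close>)
    then show ?case by (simp add: vS v0 P_def)
  next
    case (Suc n)
    have "v (Suc (Suc n)) t z - v (Suc n) t z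
        = integral {0..t} (\<lambda>s. g s z (v (Suc n) s z)) - integral {0..t} (\<lambda>s. g s z (v n s z))"
      by (simp only: vS'[of "Suc n" t z] vS'[of n t z])
    also have "\<dots> = integral {0..t} (\<lambda>s. g s z (v (Suc n) s z) - g s z (v n s z))"
      by (rule integral_diff[symmetric]) (intro int cv Suc.prems)+
    also have "norm \<dots> \<le> integral {0..t} (\<lambda>s. L * (C * L ^ n * s ^ Suc n / fact (Suc n)))"
    proof (rule integral_norm_bound_integral)
      show "(\<lambda>s. g s z (v (Suc n) s z) - g s z (v n s z)) integrable_on {0..t}"
        using Suc.prems by (intro integrable_diff int cv)
      show "(\<lambda>s. L * (C * L ^ n * s ^ Suc n / fact (Suc n))) integrable_on {0..t}"
        by (intro integrable_continuous_interval continuous_intros) auto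
    next
      fix s assume "s \<in> {0..t}"
      then have s: "s \<in> {0..T}" using Suc.prems by simp
      have "norm (g s z (v (Suc n) s z) - g s z (v n s z)) \<le> L * norm (v (Suc n) s z - v n s z)"
        by (rule lip[OF s Suc.prems(2)])
      also have "\<dots> \<le> L * (C * L ^ n * s ^ Suc n / fact (Suc n))"
        by (intro mult_left_mono Suc.IH s Suc.prems(2) \<open>0 \<le> L\<close>)
      finally show "norm (g s z (v (Suc n) s z) - g s z (v n s z)) \<le> \<dots>" .
    qed
    also have "integral {0..t} (\<lambda>s. L * (C * L ^ n * s ^ Suc n / fact (Suc n)))
        = C * L ^ Suc n * t ^ Suc (Suc n) / fact (Suc (Suc n))"
    proof -
      have "((\<lambda>s. L * (C * L ^ n * s ^ Suc n / fact (Suc n))) has_integral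
          (C * L ^ Suc n * t ^ Suc (Suc n) / fact (Suc (Suc n))
           - C * L ^ Suc n * 0 ^ Suc (Suc n) / fact (Suc (Suc n)))) {0..t}"
      proof (rule fundamental_theorem_of_calculus)
        fix x
        have "((\<lambda>t. C * L ^ Suc n * t ^ Suc (Suc n) / fact (Suc (Suc n))) has_real_derivative
            C * L ^ Suc n * (real (Suc (Suc n)) * x ^ Suc n) / fact (Suc (Suc n))) (at x within {0..t})"
          by (rule derivative_eq_intros | simp)+
        also have "C * L ^ Suc n * (real (Suc (Suc n)) * x ^ Suc n) / fact (Suc (Suc n))
            = L * (C * L ^ n * x ^ Suc n / fact (Suc n))"
          unfolding fact_Suc[of "Suc n"] by (simp del: fact_Suc)
        finally show "((\<lambda>t. C * L ^ Suc n * t ^ Suc (Suc n) / fact (Suc (Suc n))) has_vector_derivative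
            L * (C * L ^ n * x ^ Suc n / fact (Suc n))) (at x within {0..t})"
          by (simp only: has_real_derivative_iff_has_vector_derivative)
      qed (use Suc.prems in auto)
      then show ?thesis by (simp only: integral_unique) simp
    qed
    finally show ?case .
  qed
  define V where "V = (\<lambda>t z. \<Sum>n. v (Suc n) t z - v n t z)"
  have "summable (\<lambda>n. C * T * ((L * T) ^ n /\<^sub>R fact n))"
    by (intro summable_mult summable_exp_generic)
  then have sumM: "summable (\<lambda>n. C * T * ((L * T) ^ n / fact n))"
    by (simp add: divide_inverse mult.commute)
  have "uniform_limit ({0..T} \<times> Z) (\<lambda>N p. \<Sum>n<N. v (Suc n) (fst p) (snd p) - v n (fst p) (snd p))
      (\<lambda>p. \<Sum>n. v (Suc n) (fst p) (snd p) - v n (fst p) (snd p)) sequentially"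
  proof (rule Weierstrass_m_test[OF _ sumM])
    fix n p assume p: "p \<in> {0..T} \<times> Z"
    then have "norm (v (Suc n) (fst p) (snd p) - v n (fst p) (snd p)) \<le> C * L ^ n * fst p ^ Suc n / fact (Suc n)"
      by (intro step) auto
    also have "\<dots> \<le> C * L ^ n * T ^ Suc n / fact n"
    proof (intro frac_le mult_left_mono power_mono)
      show "(fact n :: real) \<le> fact (Suc n)" by (rule fact_mono) simp
    qed (use p \<open>0 \<le> C\<close> \<open>0 \<le> L\<close> \<open>0 \<le> T\<close> in auto)
    finally show "norm (v (Suc n) (fst p) (snd p) - v n (fst p) (snd p)) \<le> C * T * ((L * T) ^ n / fact n)"
      by (simp add: power_mult_distrib mult_ac)
  qed
  moreover have "(\<Sum>n<N. v (Suc n) t z - v n t z) = v N t z" for N t z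
    using sum_lessThan_telescope[of "\<lambda>n. v n t z" N] by (simp add: v0)
  ultimately have ul: "uniform_limit ({0..T} \<times> Z) (\<lambda>N (t, z). v N t z) (\<lambda>(t, z). V t z) sequentially"
    by (simp add: V_def case_prod_unfold)
  have cV: "continuous_on ({0..T} \<times> Z) (\<lambda>(t, z). V t z)"
    by (rule uniform_limit_theorem[OF _ ul]) (simp_all add: cv)
  show thesis
  proof (rule that[OF cV])
    fix t z assume t: "t \<in> {0..T}" and z: "z \<in> Z"
    have "(\<lambda>n. v (Suc n) t z) \<longlonglongrightarrow> V t z"
      using tendsto_uniform_limitI[OF ul, of "(t, z)"] t z by (intro LIMSEQ_Suc) auto
    moreover have "(\<lambda>n. v (Suc n) t z) \<longlonglongrightarrow> integral {0..t} (\<lambda>s. g s z (V s z))"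
    proof (rule LIMSEQ_I)
      fix e :: real assume "0 < e"
      define d where "d = e / (L * T + 1)"
      have pos: "0 < L * T + 1" using \<open>0 \<le> L\<close> \<open>0 \<le> T\<close> by (simp add: add_nonneg_pos)
      then have "0 < d" using \<open>0 < e\<close> by (simp add: d_def)
      then obtain N where N: "\<And>n s. n \<ge> N \<Longrightarrow> s \<in> {0..T} \<Longrightarrow> norm (v n s z - V s z) < d"
        using uniform_limitD[OF ul \<open>0 < d\<close>] z
        by (fastforce simp: eventually_sequentially dist_norm)
      have "norm (v (Suc n) t z - integral {0..t} (\<lambda>s. g s z (V s z))) < e" if "n \<ge> N" for n
      proof -
        have "v (Suc n) t z - integral {0..t} (\<lambda>s. g s z (V s z))
            = integral {0..t} (\<lambda>s. g s z (v n s z) - g s z (V s z))"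
          unfolding vS P_def using t z by (subst integral_diff) (auto intro!: int cv cV)
        also have "norm \<dots> \<le> integral {0..t} (\<lambda>s. L * d)"
        proof (rule integral_norm_bound_integral)
          fix s assume "s \<in> {0..t}"
          then have s: "s \<in> {0..T}" using t by simp
          show "norm (g s z (v n s z) - g s z (V s z)) \<le> L * d"
            using lip[OF s z, of "v n s z" "V s z"] N[OF that s] \<open>0 \<le> L\<close>
            by (meson less_imp_le mult_left_mono order_trans)
        qed (use t z in \<open>auto intro!: integrable_diff int cv cV\<close>)
        also have "\<dots> = L * t * d" using t by simp
        also have "\<dots> \<le> L * T * d"
          using t \<open>0 \<le> L\<close> \<open>0 < d\<close> by (intro mult_right_mono mult_left_mono) auto
        also have "\<dots> < (L * T + 1) * d" using \<open>0 < d\<close> by (simp add: algebra_simps)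
        also have "\<dots> = e" using pos by (simp add: d_def)
        finally show ?thesis .
      qed
      then show "\<exists>N. \<forall>n\<ge>N. norm (v (Suc n) t z - integral {0..t} (\<lambda>s. g s z (V s z))) < e" by blast
    qed
    ultimately show "V t z = integral {0..t} (\<lambda>s. g s z (V s z))"
      by (rule LIMSEQ_unique)
  qed
qed

section \<open>Differentiability of a flow in its parameter\<close>

text \<open>Differentiability tested along sequences of increments, the form in which dominated convergence
  applies.\<close>

lemma has_derivative_at_sequentially:
  fixes f :: "'a::real_normed_vector \<Rightarrow> 'b::real_normed_vector"
  assumes "0 < r" and "bounded_linear D"
    and lim: "\<And>d. (\<And>n. d n \<noteq> 0) \<Longrightarrow> (\<And>n. norm (d n) < r) \<Longrightarrow> d \<longlonglongrightarrow> 0 \<Longrightarrow>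
      (\<lambda>n. norm (f (x + d n) - f x - D (d n)) / norm (d n)) \<longlonglongrightarrow> 0"
  shows "(f has_derivative D) (at x)"
proof -
  have "((\<lambda>h. norm (f (x + h) - f x - D h) / norm h) \<longlongrightarrow> 0) (at 0 within ball 0 r)"
    unfolding tendsto_at_iff_sequentially comp_def using lim by auto
  then show ?thesis
    using \<open>0 < r\<close> assms(2) by (simp add: has_derivative_at at_within_open[of 0 "ball 0 r"])
qed

lemma open_contains_segments:
  fixes a :: "'a::real_normed_vector"
  assumes "open A" "a \<in> A"
  obtains r where "0 < r" "ball a r \<subseteq> A" "\<And>a'. norm (a' - a) < r \<Longrightarrow> closed_segment a a' \<subseteq> A"
proof -
  obtain r where r: "0 < r" "ball a r \<subseteq> A" using assms by (meson open_contains_ball)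
  show thesis
  proof (rule that[OF r])
    fix a' assume "norm (a' - a) < r"
    then have "a \<in> ball a r" "a' \<in> ball a r"
      using r(1) by (auto simp: dist_norm norm_minus_commute)
    then have "closed_segment a a' \<subseteq> ball a r" by (rule closed_segment_subset) simp
    then show "closed_segment a a' \<subseteq> A" using r(2) by simp
  qed
qed

lemma has_derivative_norm_le:
  fixes f :: "'a::real_normed_vector \<Rightarrow> 'b::real_normed_vector"
  assumes deriv: "(f has_derivative D) (at x)" and "0 < r"
    and lip: "\<And>x'. norm (x' - x) < r \<Longrightarrow> norm (f x' - f x) \<le> C * norm (x' - x)"
  shows "norm (D w) \<le> C * norm w"
proof (cases "w = 0")
  case True
  then show ?thesis using deriv by (simp add: has_derivative_bounded_linear linear_simps)
next
  case False
  interpret D: bounded_linear D using deriv by (rule has_derivative_bounded_linear)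
  let ?q = "\<lambda>h. norm (f (x + h) - f x - D h) / norm h"
  have "filterlim (\<lambda>t. t *\<^sub>R w) (at 0) (at_right (0::real))"
    using False by (auto simp: filterlim_at eventually_at_filter intro!: tendsto_eq_intros)
  moreover have "(?q \<longlongrightarrow> 0) (at 0)"
    using deriv by (simp add: has_derivative_at)
  ultimately have "((\<lambda>t. ?q (t *\<^sub>R w)) \<longlongrightarrow> 0) (at_right 0)"
    by (rule filterlim_compose[rotated])
  then have "((\<lambda>t. C * norm w + norm w * ?q (t *\<^sub>R w)) \<longlongrightarrow> C * norm w + norm w * 0) (at_right 0)"
    by (intro tendsto_intros)
  moreover have "\<forall>\<^sub>F t in at_right 0. norm (D w) \<le> C * norm w + norm w * ?q (t *\<^sub>R w)"
    unfolding eventually_at_right_field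
  proof (intro exI[of _ "r / norm w"] conjI allI impI)
    show "0 < r / norm w" using \<open>0 < r\<close> False by simp
  next
    fix t :: real assume t: "0 < t" "t < r / norm w"
    then have "norm (t *\<^sub>R w) < r" using False by (simp add: field_simps)
    then have "norm (f (x + t *\<^sub>R w) - f x) \<le> C * (t * norm w)"
      using lip[of "x + t *\<^sub>R w"] t(1) by simp
    moreover have "t * norm (D w) \<le> norm (f (x + t *\<^sub>R w) - f x) + norm (f (x + t *\<^sub>R w) - f x - D (t *\<^sub>R w))"
      using norm_triangle_ineq4[of "f (x + t *\<^sub>R w) - f x" "f (x + t *\<^sub>R w) - f x - D (t *\<^sub>R w)"] t(1)
      by (simp add: D.scaleR)
    ultimately have "t * norm (D w) \<le> t * (C * norm w + norm w * ?q (t *\<^sub>R w))"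
      using t(1) False by (simp add: distrib_left mult.left_commute)
    then show "norm (D w) \<le> C * norm w + norm w * ?q (t *\<^sub>R w)"
      using t(1) by simp
  qed
  ultimately have "norm (D w) \<le> C * norm w + norm w * 0"
    by (intro tendsto_lowerbound) auto
  then show ?thesis by simp
qed

text \<open>The two embeddings into a product, as bounded linear maps.\<close>

definition blinfun_inl :: "'a::real_normed_vector \<Rightarrow>\<^sub>L ('a \<times> 'b::real_normed_vector)" where
  "blinfun_inl = Blinfun (\<lambda>v. (v, 0))"

definition blinfun_inr :: "'b::real_normed_vector \<Rightarrow>\<^sub>L ('a::real_normed_vector \<times> 'b)" where
  "blinfun_inr = Blinfun (\<lambda>w. (0, w))"

lemma blinfun_apply_inl [simp]: "blinfun_apply blinfun_inl v = (v, 0)"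
  unfolding blinfun_inl_def
  by (subst bounded_linear_Blinfun_apply) (auto intro!: bounded_linear_intros bounded_linear_Pair)

lemma blinfun_apply_inr [simp]: "blinfun_apply blinfun_inr w = (0, w)"
  unfolding blinfun_inr_def
  by (subst bounded_linear_Blinfun_apply) (auto intro!: bounded_linear_intros bounded_linear_Pair)

text \<open>A flow \<open>y t x a\<close> of the field \<open>F t x a\<close> with initial state \<open>x\<close> and parameter \<open>a\<close>. The derivative \<open>DF t\<close> of
  \<open>F t\<close> is taken in state and parameter jointly; \<open>L\<close> and \<open>M\<close> bound its two partial derivatives. Time
  enters only through continuity, so the setting is stable under reversal of time.\<close>

locale parametric_flow =
  fixes A :: "'p::euclidean_space set"
    and T L M :: real
    and F :: "real \<Rightarrow> 'q::euclidean_space \<Rightarrow> 'p \<Rightarrow> 'q"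
    and DF :: "real \<Rightarrow> 'q \<times> 'p \<Rightarrow> ('q \<times> 'p) \<Rightarrow>\<^sub>L 'q"
    and y :: "real \<Rightarrow> 'q \<Rightarrow> 'p \<Rightarrow> 'q"
  assumes T_nonneg: "0 \<le> T" and A_open: "open A" and L_nonneg: "0 \<le> L" and M_nonneg: "0 \<le> M"
    and F_deriv: "\<And>t x a. t \<in> {0..T} \<Longrightarrow> a \<in> A \<Longrightarrow>
      ((\<lambda>(x, b). F t x b) has_derivative blinfun_apply (DF t (x, a))) (at (x, a))"
    and F_cont: "continuous_on ({0..T} \<times> UNIV \<times> A) (\<lambda>(t, x, a). F t x a)"
    and DF_cont: "continuous_on ({0..T} \<times> UNIV \<times> A) (\<lambda>(t, z). DF t z)"
    and DF_state: "\<And>t x a v. t \<in> {0..T} \<Longrightarrow> a \<in> A \<Longrightarrow> norm (DF t (x, a) (v, 0)) \<le> L * norm v"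
    and DF_param: "\<And>t x a w. t \<in> {0..T} \<Longrightarrow> a \<in> A \<Longrightarrow> norm (DF t (x, a) (0, w)) \<le> M * norm w"
    and y_init: "\<And>x a. a \<in> A \<Longrightarrow> y 0 x a = x"
    and y_ode: "\<And>t x a. a \<in> A \<Longrightarrow> t \<in> {0..T} \<Longrightarrow>
      ((\<lambda>s. y s x a) has_vector_derivative F t (y t x a) a) (at t within {0..T})"
begin

lemma DF_bound:
  assumes "t \<in> {0..T}" "a \<in> A"
  shows "norm (DF t (x, a) (v, w)) \<le> L * norm v + M * norm w"
proof -
  have "DF t (x, a) (v, w) = DF t (x, a) (v, 0) + DF t (x, a) (0, w)"
    by (simp add: blinfun.add_right[symmetric])
  then show ?thesis
    using DF_state[OF assms, of x v] DF_param[OF assms, of x w] norm_triangle_mono by metis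
qed

lemma F_lipschitz:
  assumes t: "t \<in> {0..T}" and seg: "closed_segment a a' \<subseteq> A"
  shows "norm (F t x' a' - F t x a) \<le> L * norm (x' - x) + M * norm (a' - a)"
proof -
  have a: "a \<in> A" "a' \<in> A" using seg by auto
  have "norm (F t x' a' - F t x a') \<le> L * norm (x' - x)"
  proof (rule differentiable_bound[OF convex_UNIV])
    fix u :: 'q
    have "((\<lambda>u. (\<lambda>(x, b). F t x b) (u, a')) has_derivative (\<lambda>v. DF t (u, a') (v, 0))) (at u)"
      by (rule has_derivative_compose[where g = "\<lambda>(x, b). F t x b" and g' = "blinfun_apply (DF t (u, a'))"])
        (auto intro!: derivative_eq_intros F_deriv[OF t a(2), of u, simplified])
    then show "((\<lambda>u. F t u a') has_derivative (\<lambda>v. DF t (u, a') (v, 0))) (at u within UNIV)" by simp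
    show "onorm (\<lambda>v. DF t (u, a') (v, 0)) \<le> L"
      by (rule onorm_bound[OF L_nonneg DF_state[OF t a(2)]])
  qed auto
  moreover have "norm (F t x a' - F t x a) \<le> M * norm (a' - a)"
  proof (rule differentiable_bound[of "closed_segment a a'"])
    fix b assume "b \<in> closed_segment a a'"
    then have b: "b \<in> A" using seg by auto
    have "((\<lambda>b. (\<lambda>(x, b). F t x b) (x, b)) has_derivative (\<lambda>w. DF t (x, b) (0, w))) (at b)"
      by (rule has_derivative_compose[where g = "\<lambda>(x, b). F t x b" and g' = "blinfun_apply (DF t (x, b))"])
        (auto intro!: derivative_eq_intros F_deriv[OF t b, of x, simplified])
    then show "((\<lambda>b. F t x b) has_derivative (\<lambda>w. DF t (x, b) (0, w))) (at b within closed_segment a a')"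
      by (simp add: has_derivative_at_withinI)
    show "onorm (\<lambda>w. DF t (x, b) (0, w)) \<le> M"
      by (rule onorm_bound[OF M_nonneg DF_param[OF t b]])
  qed auto
  ultimately show ?thesis
    using norm_triangle_ineq[of "F t x' a' - F t x a'" "F t x a' - F t x a"] by simp
qed

lemma y_cont_time: "a \<in> A \<Longrightarrow> continuous_on {0..T} (\<lambda>s. y s x a)"
  by (rule continuous_on_vector_derivative[where f' = "\<lambda>s. F s (y s x a) a"]) (rule y_ode)

lemma F_y_cont: "a \<in> A \<Longrightarrow> continuous_on {0..T} (\<lambda>s. F s (y s x a) a)"
  using continuous_on_compose2[OF F_cont, of "{0..T}" "\<lambda>s. (s, y s x a, a)"]
  by (simp add: image_subset_iff continuous_on_Pair continuous_on_const continuous_on_id y_cont_time)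

lemma F_y_integrable: "a \<in> A \<Longrightarrow> t \<in> {0..T} \<Longrightarrow> (\<lambda>s. F s (y s x a) a) integrable_on {0..t}"
  by (intro integrable_continuous_interval continuous_on_subset[OF F_y_cont]) auto

lemma y_integral:
  assumes "a \<in> A" "t \<in> {0..T}"
  shows "y t x a = x + integral {0..t} (\<lambda>s. F s (y s x a) a)"
proof -
  have "((\<lambda>s. F s (y s x a) a) has_integral y t x a - y 0 x a) {0..t}"
    by (rule fundamental_theorem_of_calculus)
      (use assms in \<open>auto intro!: has_vector_derivative_within_subset[OF y_ode]\<close>)
  then show ?thesis using y_init[OF assms(1)] by (simp add: integral_unique)
qed

text \<open>For \<open>x' = x\<close> this is the Lipschitz bound in the parameter with the constant \<open>Sigma_const L M t\<close>.\<close>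

lemma y_lipschitz:
  assumes t: "t \<in> {0..T}" and seg: "closed_segment a a' \<subseteq> A"
  shows "norm (y t x' a' - y t x a) \<le> norm (x' - x) * exp (L * t) + Sigma_const L M t * norm (a' - a)"
proof -
  have a: "a \<in> A" "a' \<in> A" using seg by auto
  have "norm (y t x' a' - y t x a) \<le> norm (x' - x) * exp (L * t) + Sigma_const L (M * norm (a' - a)) t"
  proof (rule gronwall_integral[OF _ L_nonneg _ t])
    show "continuous_on {0..T} (\<lambda>t. norm (y t x' a' - y t x a))"
      by (intro continuous_intros y_cont_time a)
  next
    fix t assume t: "t \<in> {0..T}"
    have "y t x' a' - y t x a = (x' - x) + integral {0..t} (\<lambda>s. F s (y s x' a') a' - F s (y s x a) a)"
      using y_integral[OF a(1) t, of x] y_integral[OF a(2) t, of x'] F_y_integrable a t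
      by (subst integral_diff) auto
    also have "norm \<dots> \<le> norm (x' - x) + norm (integral {0..t} (\<lambda>s. F s (y s x' a') a' - F s (y s x a) a))"
      by (rule norm_triangle_ineq)
    also have "norm (integral {0..t} (\<lambda>s. F s (y s x' a') a' - F s (y s x a) a))
        \<le> integral {0..t} (\<lambda>s. L * norm (y s x' a' - y s x a) + M * norm (a' - a))"
    proof (rule integral_norm_bound_integral)
      show "(\<lambda>s. F s (y s x' a') a' - F s (y s x a) a) integrable_on {0..t}"
        using a t by (intro integrable_diff F_y_integrable)
      have "continuous_on {0..T} (\<lambda>s. L * norm (y s x' a' - y s x a) + M * norm (a' - a))"
        by (intro continuous_intros y_cont_time a)
      then show "(\<lambda>s. L * norm (y s x' a' - y s x a) + M * norm (a' - a)) integrable_on {0..t}"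
        using t by (intro integrable_continuous_interval) (auto elim: continuous_on_subset)
    qed (use t in \<open>auto intro!: F_lipschitz seg\<close>)
    finally show "norm (y t x' a' - y t x a)
        \<le> norm (x' - x) + integral {0..t} (\<lambda>s. L * norm (y s x' a' - y s x a) + M * norm (a' - a))"
      by simp
  qed
  then show ?thesis by (simp add: Sigma_const_mult)
qed

lemma y_continuous: "continuous_on ({0..T} \<times> UNIV \<times> A) (\<lambda>(t, x, a). y t x a)"
proof (unfold continuous_on_def, intro ballI)
  fix p assume p: "p \<in> {0..T} \<times> (UNIV :: 'q set) \<times> A"
  obtain t x a where p_eq: "p = (t, x, a)" by (metis prod_cases3)
  have t: "t \<in> {0..T}" and a: "a \<in> A" using p by (auto simp: p_eq)
  obtain r where r: "0 < r" "\<And>a'. norm (a' - a) < r \<Longrightarrow> closed_segment a a' \<subseteq> A"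
    using open_contains_segments[OF A_open a] by metis
  let ?F = "at p within {0..T} \<times> (UNIV :: 'q set) \<times> A"
  have lims: "((\<lambda>p. fst p) \<longlongrightarrow> t) ?F" "((\<lambda>p. fst (snd p)) \<longlongrightarrow> x) ?F" "((\<lambda>p. snd (snd p)) \<longlongrightarrow> a) ?F"
    by (auto intro!: tendsto_eq_intros simp: p_eq)
  note lims' = tendsto_norm_zero[OF LIM_zero[OF lims(2)]] tendsto_norm_zero[OF LIM_zero[OF lims(3)]]
  let ?E = "\<lambda>q. norm (fst (snd q) - x) * exp (L * T) + Sigma_const L M T * norm (snd (snd q) - a)"
  have "((\<lambda>q. y (fst q) (fst (snd q)) (snd (snd q)) - y (fst q) x a) \<longlongrightarrow> 0) ?F"
  proof (rule Lim_null_comparison)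
    show "(?E \<longlongrightarrow> 0) ?F"
      using tendsto_add[OF tendsto_mult_left_zero[OF lims'(1)] tendsto_mult_right_zero[OF lims'(2)]]
      by simp
    have "\<forall>\<^sub>F q in ?F. norm (snd (snd q) - a) < r"
      using tendstoD[OF lims(3) r(1)] by (simp add: dist_norm)
    moreover have "\<forall>\<^sub>F q in ?F. q \<in> {0..T} \<times> UNIV \<times> A"
      by (auto simp: eventually_at_filter)
    ultimately show "\<forall>\<^sub>F q in ?F. norm (y (fst q) (fst (snd q)) (snd (snd q)) - y (fst q) x a) \<le> ?E q"
    proof eventually_elim
      case (elim q)
      then have q: "fst q \<in> {0..T}" by auto
      have "norm (y (fst q) (fst (snd q)) (snd (snd q)) - y (fst q) x a)
        \<le> norm (fst (snd q) - x) * exp (L * fst q) + Sigma_const L M (fst q) * norm (snd (snd q) - a)"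
        by (rule y_lipschitz[OF q r(2)[OF elim(1)]])
      also have "\<dots> \<le> ?E q"
        using q L_nonneg M_nonneg
        by (intro add_mono mult_left_mono mult_right_mono Sigma_const_mono) (auto intro!: mult_left_mono)
      finally show ?case .
    qed
  qed
  moreover have "((\<lambda>q. y (fst q) x a) \<longlongrightarrow> y t x a) ?F"
    by (rule continuous_on_tendsto_compose[OF y_cont_time[OF a] lims(1) t])
      (unfold eventually_at_filter, intro always_eventually, auto)
  ultimately have "((\<lambda>q. (y (fst q) (fst (snd q)) (snd (snd q)) - y (fst q) x a) + y (fst q) x a)
      \<longlongrightarrow> 0 + y t x a) ?F"
    by (rule tendsto_add)
  then show "((\<lambda>(t, x, a). y t x a) \<longlongrightarrow> (case p of (t, x, a) \<Rightarrow> y t x a)) ?F"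
    by (simp add: case_prod_unfold p_eq)
qed

text \<open>The derivative \<open>Y\<close> in the parameter is constructed as the solution of the variational equation
  \<open>Y' = D\<^sub>x F \<circ> Y + D\<^sub>a F\<close>, \<open>Y 0 = 0\<close>, in the Banach space of bounded linear maps. The remainder of the
  difference quotient solves a linear inequality whose inhomogeneity tends to 0 by dominated
  convergence, so it vanishes in the limit by Gronwall's inequality.\<close>

theorem y_parameter_derivative:
  obtains Y where
    "continuous_on ({0..T} \<times> UNIV \<times> A) (\<lambda>(t, z). Y t z)"
    "\<And>t x a. t \<in> {0..T} \<Longrightarrow> a \<in> A \<Longrightarrow> ((\<lambda>b. y t x b) has_derivative blinfun_apply (Y t (x, a))) (at a)"
    "\<And>t x a. t \<in> {0..T} \<Longrightarrow> a \<in> A \<Longrightarrow> norm (Y t (x, a)) \<le> Sigma_const L M t"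
proof -
  \<comment> \<open>For \<open>V = Y s z\<close>, the derivative of \<open>b \<mapsto> (y s x b, b)\<close> is \<open>J V\<close>.\<close>
  define J where "J = (\<lambda>V :: 'p \<Rightarrow>\<^sub>L 'q. (blinfun_inl o\<^sub>L V) + blinfun_inr)"
  have J: "blinfun_apply (J V) w = (V w, w)" for V w
    by (simp add: J_def blinfun.add_left)
  define g where "g = (\<lambda>s (z :: 'q \<times> 'p) V. DF s (y s (fst z) (snd z), snd z) o\<^sub>L J V)"
  have y_c': "continuous_on ({0..T} \<times> UNIV \<times> A) (\<lambda>p. y (fst p) (fst (snd p)) (snd (snd p)))"
    using y_continuous by (simp only: case_prod_unfold)
  have y_c: "continuous_on ({0..T} \<times> (UNIV \<times> A) \<times> (UNIV :: ('p \<Rightarrow>\<^sub>L 'q) set))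
      (\<lambda>p. y (fst p) (fst (fst (snd p))) (snd (fst (snd p))))"
    by (rule continuous_on_compose2[OF y_c', of _ "\<lambda>p. (fst p, fst (snd p))", simplified])
      (auto intro!: continuous_intros)
  have "continuous_on ({0..T} \<times> (UNIV \<times> A) \<times> (UNIV :: ('p \<Rightarrow>\<^sub>L 'q) set))
      (\<lambda>p. (\<lambda>(t, z). DF t z) (fst p, (y (fst p) (fst (fst (snd p))) (snd (fst (snd p))), snd (fst (snd p)))))"
    by (rule continuous_on_compose2[OF DF_cont]) (auto intro!: continuous_intros y_c)
  then have g_cont: "continuous_on ({0..T} \<times> (UNIV \<times> A) \<times> UNIV) (\<lambda>(s, z, V). g s z V)"
    unfolding g_def J_def case_prod_unfold by (auto intro!: continuous_intros)
  have g_lip: "norm (g s z V - g s z W) \<le> L * norm (V - W)" if "s \<in> {0..T}" "z \<in> UNIV \<times> A" for s z V W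
  proof (rule norm_blinfun_bound)
    fix w
    let ?D = "DF s (y s (fst z) (snd z), snd z)"
    have "(g s z V - g s z W) w = ?D ((V - W) w, 0)"
      by (simp add: g_def J blinfun.diff_left blinfun.diff_right[symmetric])
    also have "norm \<dots> \<le> L * norm ((V - W) w)"
      using that by (intro DF_state) auto
    also have "\<dots> \<le> L * (norm (V - W) * norm w)"
      by (intro mult_left_mono norm_blinfun L_nonneg)
    finally show "norm ((g s z V - g s z W) w) \<le> L * norm (V - W) * norm w" by simp
  qed (simp add: L_nonneg)
  have g_bd: "norm (g s z 0) \<le> M" if "s \<in> {0..T}" "z \<in> UNIV \<times> A" for s z
    using that by (intro norm_blinfun_bound M_nonneg) (auto simp: g_def J intro!: DF_param)
  obtain Y where Y_cont: "continuous_on ({0..T} \<times> UNIV \<times> A) (\<lambda>(t, z). Y t z)"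
    and Y_eq: "\<And>t z. t \<in> {0..T} \<Longrightarrow> z \<in> UNIV \<times> A \<Longrightarrow> Y t z = integral {0..t} (\<lambda>s. g s z (Y s z))"
    by (rule volterra_solution[OF g_cont g_lip g_bd L_nonneg M_nonneg T_nonneg])
      (assumption+, rule that)
  have Y_cont_time: "continuous_on {0..T} (\<lambda>s. Y s (x, a))" if "a \<in> A" for x a
    using continuous_on_compose2[OF Y_cont, of "{0..T}" "\<lambda>s. (s, x, a)"] that
    by (simp add: image_subset_iff continuous_on_Pair continuous_on_const continuous_on_id)
  have DF_cont_time: "continuous_on {0..T} (\<lambda>s. DF s (y s x a, a))" if "a \<in> A" for x a
    using continuous_on_compose2[OF DF_cont, of "{0..T}" "\<lambda>s. (s, y s x a, a)"] that
    by (simp add: image_subset_iff continuous_on_Pair continuous_on_const continuous_on_id y_cont_time)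
  have Y_apply: "Y t (x, a) w = integral {0..t} (\<lambda>s. DF s (y s x a, a) (Y s (x, a) w, w))"
    if "t \<in> {0..T}" "a \<in> A" for t x a w
  proof -
    have int: "(\<lambda>s. g s (x, a) (Y s (x, a))) integrable_on {0..t}"
      unfolding g_def J_def using that
      by (intro integrable_continuous_interval)
        (auto intro!: continuous_intros continuous_on_subset[OF Y_cont_time] continuous_on_subset[OF DF_cont_time])
    have "Y t (x, a) w = integral {0..t} ((\<lambda>B. blinfun_apply B w) \<circ> (\<lambda>s. g s (x, a) (Y s (x, a))))"
      using that Y_eq[of t "(x, a)"]
      by (subst integral_linear[OF int]) (auto intro!: bounded_linear_intros)
    then show ?thesis by (simp add: g_def J comp_def)
  qed
  have deriv: "((\<lambda>b. y t x b) has_derivative blinfun_apply (Y t (x, a))) (at a)"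
    if t: "t \<in> {0..T}" and a: "a \<in> A" for t x a
  proof -
    obtain r where r: "0 < r" "ball a r \<subseteq> A" "\<And>a'. norm (a' - a) < r \<Longrightarrow> closed_segment a a' \<subseteq> A"
      using open_contains_segments[OF A_open a] by metis
    show ?thesis
    proof (rule has_derivative_at_sequentially[OF r(1) blinfun.bounded_linear_right])
      fix d :: "nat \<Rightarrow> 'p"
      assume d0: "\<And>n. d n \<noteq> 0" and dr: "\<And>n. norm (d n) < r" and dl: "d \<longlonglongrightarrow> 0"
      have seg: "closed_segment a (a + d n) \<subseteq> A" for n using r(3)[of "a + d n"] dr by simp
      then have ad: "a + d n \<in> A" for n by (meson ends_in_segment(2) subsetD)
      define u where "u = (\<lambda>n s. y s x (a + d n) - y s x a)"
      \<comment> \<open>\<open>\<rho>\<close> is the linearisation error of the field along the unperturbed trajectory.\<close>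
      define \<rho> where "\<rho> = (\<lambda>n s. F s (y s x (a + d n)) (a + d n) - F s (y s x a) a
        - DF s (y s x a, a) (u n s, d n))"
      have u_cont: "continuous_on {0..T} (u n)" for n
        unfolding u_def by (intro continuous_intros y_cont_time a ad)
      have \<rho>_cont: "continuous_on {0..T} (\<rho> n)" for n
        unfolding \<rho>_def
        by (intro continuous_intros F_y_cont a ad DF_cont_time blinfun.continuous_on u_cont)
      have u_bd: "norm (u n s) \<le> Sigma_const L M T * norm (d n)" if s: "s \<in> {0..T}" for n s
      proof -
        have "norm (u n s) \<le> Sigma_const L M s * norm (d n)"
          using y_lipschitz[OF s seg[of n], of x x] by (simp add: u_def)
        also have "\<dots> \<le> Sigma_const L M T * norm (d n)"
          using s L_nonneg M_nonneg by (intro mult_right_mono Sigma_const_mono) auto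
        finally show ?thesis .
      qed
      define C where "C = 2 * (L * Sigma_const L M T + M)"
      have \<rho>_bd: "norm (\<rho> n s) / norm (d n) \<le> C" if s: "s \<in> {0..T}" for n s
      proof -
        have "norm (\<rho> n s) \<le> norm (F s (y s x (a + d n)) (a + d n) - F s (y s x a) a)
            + norm (DF s (y s x a, a) (u n s, d n))"
          unfolding \<rho>_def by (rule norm_triangle_ineq4)
        also have "\<dots> \<le> (L * norm (u n s) + M * norm (d n)) + (L * norm (u n s) + M * norm (d n))"
          using F_lipschitz[OF s seg[of n], of "y s x (a + d n)" "y s x a"] DF_bound[OF s a]
          by (intro add_mono) (auto simp: u_def)
        also have "\<dots> \<le> C * norm (d n)"
          using mult_left_mono[OF u_bd[OF s, of n] L_nonneg] by (simp add: C_def algebra_simps)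
        finally show ?thesis using d0[of n] by (simp add: field_simps)
      qed
      have \<rho>_lim: "(\<lambda>n. norm (\<rho> n s) / norm (d n)) \<longlonglongrightarrow> 0" if s: "s \<in> {0..T}" for s
      proof -
        let ?z = "(y s x a, a)"
        let ?h = "\<lambda>n. (u n s, d n)"
        have h_le: "norm (?h n) \<le> (Sigma_const L M T + 1) * norm (d n)" for n
          using norm_Pair_le[of "u n s" "d n"] u_bd[OF s, of n] by (simp add: algebra_simps)
        have "?h \<longlonglongrightarrow> 0"
          by (rule Lim_null_comparison[OF always_eventually[OF allI[OF h_le]]])
            (auto intro!: tendsto_eq_intros dl)
        then have hl: "filterlim ?h (at 0) sequentially"
          using d0 by (auto simp: filterlim_at zero_prod_def)
        have "((\<lambda>h. norm ((\<lambda>(x, b). F s x b) (?z + h) - (\<lambda>(x, b). F s x b) ?z - DF s ?z h) / norm h) \<longlongrightarrow> 0) (at 0)"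
          using F_deriv[OF s a, of "y s x a"] by (simp add: has_derivative_at)
        from filterlim_compose[OF this hl]
        have q: "(\<lambda>n. norm (\<rho> n s) / norm (?h n)) \<longlonglongrightarrow> 0"
          by (simp add: \<rho>_def u_def)
        show ?thesis
        proof (rule Lim_null_comparison)
          show "(\<lambda>n. (Sigma_const L M T + 1) * (norm (\<rho> n s) / norm (?h n))) \<longlonglongrightarrow> 0"
            using tendsto_mult[OF tendsto_const q, of "Sigma_const L M T + 1"] by simp
          have "norm (norm (\<rho> n s) / norm (d n)) \<le> (Sigma_const L M T + 1) * (norm (\<rho> n s) / norm (?h n))" for n
          proof -
            have pos: "0 < norm (?h n)" using d0 by (simp add: zero_prod_def)
            have "norm (\<rho> n s) * norm (?h n) \<le> norm (\<rho> n s) * ((Sigma_const L M T + 1) * norm (d n))"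
              by (intro mult_left_mono h_le) simp
            then show ?thesis using pos d0[of n] by (simp add: field_simps)
          qed
          then show "\<forall>\<^sub>F n in sequentially. norm (norm (\<rho> n s) / norm (d n))
              \<le> (Sigma_const L M T + 1) * (norm (\<rho> n s) / norm (?h n))" by simp
        qed
      qed
      define I where "I = (\<lambda>n. integral {0..T} (\<lambda>s. norm (\<rho> n s) / norm (d n)))"
      have \<rho>_int: "(\<lambda>s. norm (\<rho> n s) / norm (d n)) integrable_on {0..T}" for n
        using d0 by (intro integrable_continuous_interval continuous_intros \<rho>_cont) auto
      have I_lim: "I \<longlonglongrightarrow> 0"
      proof -
        have "I \<longlonglongrightarrow> integral {0..T} (\<lambda>s. 0)"
          unfolding I_def
        proof (rule dominated_convergence(2)[OF \<rho>_int])
          show "(\<lambda>s. C) integrable_on {0..T}" by (rule integrable_const_ivl)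
        qed (use \<rho>_bd \<rho>_lim in auto)
        then show ?thesis by simp
      qed
      have rem: "norm (y t x (a + d n) - y t x a - Y t (x, a) (d n)) \<le> norm (d n) * I n * exp (L * t)" for n
      proof -
        define e where "e = (\<lambda>s. u n s - Y s (x, a) (d n))"
        have e_cont: "continuous_on {0..T} e"
          unfolding e_def by (intro continuous_intros u_cont blinfun.continuous_on Y_cont_time a)
        have "norm (e t) \<le> (norm (d n) * I n) * exp (L * t) + Sigma_const L 0 t"
        proof (rule gronwall_integral[OF _ L_nonneg _ t])
          show "continuous_on {0..T} (\<lambda>s. norm (e s))" by (intro continuous_intros e_cont)
        next
          fix \<tau> assume \<tau>: "\<tau> \<in> {0..T}"
          have sub: "{0..\<tau>} \<subseteq> {0..T}" using \<tau> by auto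
          have D_e: "DF s (y s x a, a) (e s, 0) = DF s (y s x a, a) (u n s, d n) - DF s (y s x a, a) (Y s (x, a) (d n), d n)" for s
            by (simp add: e_def blinfun.diff_right[symmetric])
          have "e \<tau> = integral {0..\<tau>} (\<lambda>s. F s (y s x (a + d n)) (a + d n) - F s (y s x a) a)
              - integral {0..\<tau>} (\<lambda>s. DF s (y s x a, a) (Y s (x, a) (d n), d n))"
            using y_integral[OF a \<tau>, of x] y_integral[OF ad[of n] \<tau>, of x] F_y_integrable[OF a \<tau>] F_y_integrable[OF ad[of n] \<tau>]
            by (simp add: e_def u_def Y_apply[OF \<tau> a] integral_diff)
          also have "\<dots> = integral {0..\<tau>} (\<lambda>s. (F s (y s x (a + d n)) (a + d n) - F s (y s x a) a)
              - DF s (y s x a, a) (Y s (x, a) (d n), d n))"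
            using sub by (intro integral_diff[symmetric] integrable_continuous_interval
              continuous_on_subset[OF _ sub] continuous_intros F_y_cont a ad blinfun.continuous_on DF_cont_time Y_cont_time)
          also have "\<dots> = integral {0..\<tau>} (\<lambda>s. DF s (y s x a, a) (e s, 0) + \<rho> n s)"
            by (rule integral_cong) (simp add: D_e \<rho>_def)
          also have "norm \<dots> \<le> integral {0..\<tau>} (\<lambda>s. L * norm (e s) + norm (\<rho> n s))"
          proof (rule integral_norm_bound_integral)
            show "(\<lambda>s. DF s (y s x a, a) (e s, 0) + \<rho> n s) integrable_on {0..\<tau>}"
              by (intro integrable_continuous_interval continuous_on_subset[OF _ sub] continuous_intros
                  blinfun.continuous_on DF_cont_time a e_cont \<rho>_cont)
            show "(\<lambda>s. L * norm (e s) + norm (\<rho> n s)) integrable_on {0..\<tau>}"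
              by (intro integrable_continuous_interval continuous_on_subset[OF _ sub] continuous_intros e_cont \<rho>_cont)
            fix s assume "s \<in> {0..\<tau>}"
            then have s: "s \<in> {0..T}" using sub by auto
            show "norm (DF s (y s x a, a) (e s, 0) + \<rho> n s) \<le> L * norm (e s) + norm (\<rho> n s)"
              using DF_state[OF s a, of "y s x a" "e s"] norm_triangle_ineq[of "DF s (y s x a, a) (e s, 0)" "\<rho> n s"]
              by linarith
          qed
          also have "\<dots> = integral {0..\<tau>} (\<lambda>s. L * norm (e s)) + integral {0..\<tau>} (\<lambda>s. norm (\<rho> n s))"
            by (intro integral_add integrable_continuous_interval continuous_on_subset[OF _ sub]
                continuous_intros e_cont \<rho>_cont)
          also have "integral {0..\<tau>} (\<lambda>s. norm (\<rho> n s)) \<le> integral {0..T} (\<lambda>s. norm (\<rho> n s))"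
            by (intro integral_subset_le sub integrable_continuous_interval continuous_on_subset[OF _ sub]
                continuous_intros \<rho>_cont) auto
          also have "integral {0..T} (\<lambda>s. norm (\<rho> n s)) = norm (d n) * I n"
            using d0[of n] by (simp add: I_def integral_divide)
          finally show "norm (e \<tau>) \<le> norm (d n) * I n + integral {0..\<tau>} (\<lambda>s. L * norm (e s) + 0)"
            by simp
        qed
        then show ?thesis by (simp add: e_def u_def)
      qed
      show "(\<lambda>n. norm (y t x (a + d n) - y t x a - Y t (x, a) (d n)) / norm (d n)) \<longlonglongrightarrow> 0"
      proof (rule Lim_null_comparison)
        show "\<forall>\<^sub>F n in sequentially. norm (norm (y t x (a + d n) - y t x a - Y t (x, a) (d n)) / norm (d n)) \<le> I n * exp (L * t)"
          using rem d0 by (intro always_eventually allI) (simp add: field_simps)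
        show "(\<lambda>n. I n * exp (L * t)) \<longlonglongrightarrow> 0"
          using tendsto_mult[OF I_lim tendsto_const, of "exp (L * t)"] by simp
      qed
    qed
  qed
  have bd: "norm (Y t (x, a)) \<le> Sigma_const L M t" if t: "t \<in> {0..T}" and a: "a \<in> A" for t x a
  proof -
    \<comment> \<open>The operator norm is controlled by the Lipschitz constant, with no reference to the equation for \<open>Y\<close>.\<close>
    have S0: "0 \<le> Sigma_const L M t" using t M_nonneg by (auto intro: Sigma_const_nonneg)
    obtain r where r: "0 < r" "\<And>a'. norm (a' - a) < r \<Longrightarrow> closed_segment a a' \<subseteq> A"
      using open_contains_segments[OF A_open a] by metis
    show ?thesis
    proof (rule norm_blinfun_bound[OF S0])
      fix w
      show "norm (Y t (x, a) w) \<le> Sigma_const L M t * norm w"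
        by (rule has_derivative_norm_le[OF deriv[OF t a] r(1)])
          (use y_lipschitz[OF t r(2), of _ x x] in simp)
    qed
  qed
  from that[OF Y_cont deriv bd] show thesis .
qed

end

section \<open>Gradients and differentiation under the integral sign\<close>

lemma GDERIV_unique:
  assumes "GDERIV F x :> D" "GDERIV F x :> D'"
  shows "D = D'"
proof -
  have "(\<lambda>h. h \<bullet> D) = (\<lambda>h. h \<bullet> D')"
    using assms unfolding gderiv_def by (rule has_derivative_unique)
  from fun_cong[OF this, of "D - D'"] have "(D - D') \<bullet> (D - D') = 0"
    by (simp add: inner_diff_right)
  then show ?thesis by simp
qed

lemma gradient_eqI: "GDERIV F x :> D \<Longrightarrow> gradient F x = D"
  unfolding gradient_def by (rule the_equality) (auto intro: GDERIV_unique)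

text \<open>The vector that represents a linear functional through the inner product; it translates between
  derivatives as bounded linear maps and gradients.\<close>

definition riesz_vector :: "('a::euclidean_space \<Rightarrow>\<^sub>L real) \<Rightarrow> 'a" where
  "riesz_vector B = (\<Sum>e\<in>Basis. B e *\<^sub>R e)"

lemma inner_riesz_vector:
  fixes B :: "'a::euclidean_space \<Rightarrow>\<^sub>L real"
  shows "w \<bullet> riesz_vector B = B w"
proof -
  have "B w = B (\<Sum>e\<in>Basis. (w \<bullet> e) *\<^sub>R e)" by (simp add: euclidean_representation)
  also have "\<dots> = (\<Sum>e\<in>Basis. (w \<bullet> e) * B e)"
    by (simp add: blinfun.sum_right blinfun.scaleR_right)
  finally show ?thesis by (simp add: riesz_vector_def inner_sum_right mult.commute)
qed

lemma GDERIV_riesz_vector: "(F has_derivative blinfun_apply B) (at x) \<Longrightarrow> GDERIV F x :> riesz_vector B"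
  by (simp add: gderiv_def inner_riesz_vector)

lemma norm_riesz_vector_le:
  fixes B :: "'a::euclidean_space \<Rightarrow>\<^sub>L real"
  assumes "\<And>w. \<bar>B w\<bar> \<le> c * norm w"
  shows "norm (riesz_vector B) \<le> c"
proof (cases "riesz_vector B = 0")
  case True
  obtain e :: 'a where "e \<in> Basis" using nonempty_Basis by blast
  then have "0 \<le> c" using assms[of e] by simp
  then show ?thesis using True by simp
next
  case False
  let ?v = "riesz_vector B"
  have "norm ?v * norm ?v = B ?v"
    using inner_riesz_vector[of ?v B] by (simp add: power2_norm_eq_inner[symmetric] power2_eq_square)
  also have "\<dots> \<le> c * norm ?v" using assms[of ?v] by linarith
  finally show ?thesis using False by simp
qed

lemma continuous_on_riesz_vector [continuous_intros]:
  "continuous_on S B \<Longrightarrow> continuous_on S (\<lambda>x. riesz_vector (B x))"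
  unfolding riesz_vector_def by (intro continuous_intros)

lemma GDERIV_mean_value_bound:
  assumes "closed_segment a a' \<subseteq> A"
    and "\<And>b. b \<in> A \<Longrightarrow> GDERIV F b :> G b" and "\<And>b. b \<in> A \<Longrightarrow> norm (G b) \<le> C"
  shows "\<bar>F a' - F a\<bar> \<le> C * norm (a' - a)"
proof -
  have "norm (F a' - F a) \<le> C * norm (a' - a)"
  proof (rule differentiable_bound[of "closed_segment a a'" F "\<lambda>b h. h \<bullet> G b"])
    fix b assume "b \<in> closed_segment a a'"
    then have b: "b \<in> A" using assms(1) by blast
    show "(F has_derivative (\<lambda>h. h \<bullet> G b)) (at b within closed_segment a a')"
      using assms(2)[OF b] by (simp add: gderiv_def has_derivative_at_withinI)
    have C: "0 \<le> C" using assms(3)[OF b] norm_ge_zero order_trans by blast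
    show "onorm (\<lambda>h. h \<bullet> G b) \<le> C"
    proof (rule onorm_bound[OF C])
      fix h
      have "norm (h \<bullet> G b) \<le> norm h * norm (G b)" by (simp add: Cauchy_Schwarz_ineq2)
      also have "\<dots> \<le> C * norm h" using mult_left_mono[OF assms(3)[OF b], of "norm h"] by (simp add: mult.commute)
      finally show "norm (h \<bullet> G b) \<le> C * norm h" .
    qed
  qed auto
  then show ?thesis by simp
qed

text \<open>
  The gradient \<open>g t z a\<close> of the integrand is only assumed continuous in \<open>(z, a)\<close> for each fixed \<open>t\<close>, with
  no regularity in \<open>t\<close>. Its integrability in \<open>t\<close> comes from the dominated convergence of difference quotients.
\<close>

lemma
  fixes k :: "real \<Rightarrow> 'z::metric_space \<Rightarrow> 'p::euclidean_space \<Rightarrow> real"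
  assumes A: "open A" and T: "0 \<le> T"
    and deriv: "\<And>t z a. t \<in> {0..T} \<Longrightarrow> a \<in> A \<Longrightarrow> GDERIV (k t z) a :> g t z a"
    and cont: "\<And>t. t \<in> {0..T} \<Longrightarrow> continuous_on (UNIV \<times> A) (\<lambda>(z, a). g t z a)"
    and bd: "\<And>t z a. t \<in> {0..T} \<Longrightarrow> a \<in> A \<Longrightarrow> norm (g t z a) \<le> C"
    and int: "\<And>z a. a \<in> A \<Longrightarrow> (\<lambda>t. k t z a) integrable_on {0..T}"
  shows gradient_integral_integrable: "\<And>z a. a \<in> A \<Longrightarrow> (\<lambda>t. g t z a) integrable_on {0..T}"
    and GDERIV_integral: "\<And>z a. a \<in> A \<Longrightarrow>
      GDERIV (\<lambda>a. integral {0..T} (\<lambda>t. k t z a)) a :> integral {0..T} (\<lambda>t. g t z a)"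
    and continuous_on_gradient_integral:
      "continuous_on (UNIV \<times> A) (\<lambda>(z, a). integral {0..T} (\<lambda>t. g t z a))"
    and norm_gradient_integral_le: "\<And>z a. a \<in> A \<Longrightarrow> norm (integral {0..T} (\<lambda>t. g t z a)) \<le> C * T"
proof -
  have segment: "\<exists>r>0. \<forall>d. norm d < r \<longrightarrow> closed_segment a (a + d) \<subseteq> A" if "a \<in> A" for a
  proof -
    obtain r where r: "0 < r" "\<And>a'. norm (a' - a) < r \<Longrightarrow> closed_segment a a' \<subseteq> A"
      using open_contains_segments[OF A \<open>a \<in> A\<close>] by metis
    then show ?thesis by (intro exI[of _ r]) simp
  qed
  have lim: "(\<lambda>n. \<bar>k t z (a + d n) - k t z a - d n \<bullet> g t z a\<bar> / norm (d n)) \<longlonglongrightarrow> 0"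
    if "t \<in> {0..T}" "a \<in> A" "\<And>n. d n \<noteq> 0" "d \<longlonglongrightarrow> 0" for t z a and d :: "nat \<Rightarrow> 'p"
  proof -
    have lim0: "((\<lambda>h. norm (k t z (a + h) - k t z a - h \<bullet> g t z a) / norm h) \<longlongrightarrow> 0) (at 0)"
      using deriv[OF that(1,2), of z] by (simp add: gderiv_def has_derivative_at)
    have "filterlim d (at 0) sequentially"
      using that by (simp add: filterlim_at)
    from filterlim_compose[OF lim0 this] show ?thesis by simp
  qed
  have mv: "\<bar>k t z (a + d) - k t z a\<bar> \<le> C * norm d"
    if "t \<in> {0..T}" "closed_segment a (a + d) \<subseteq> A" for t z a d
    using GDERIV_mean_value_bound[OF that(2) deriv[OF that(1)] bd[OF that(1)]] by simp
  show gint: "(\<lambda>t. g t z a) integrable_on {0..T}" if a: "a \<in> A" for z a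
  proof (subst integrable_componentwise_iff, rule ballI)
    fix e :: 'p assume e: "e \<in> Basis"
    obtain r where r: "0 < r" "\<And>d. norm d < r \<Longrightarrow> closed_segment a (a + d) \<subseteq> A"
      using segment[OF a] by blast
    obtain N where N: "inverse (real (Suc N)) < r" using reals_Archimedean[OF r(1)] by blast
    define d where "d = (\<lambda>n. inverse (real (Suc (n + N))) *\<^sub>R e)"
    have d0: "d n \<noteq> 0" for n using e by (auto simp: d_def)
    have nd: "norm (d n) = inverse (real (Suc (n + N)))" for n
      using e by (simp add: d_def)
    have dr: "norm (d n) < r" for n
    proof -
      have "inverse (real (Suc (n + N))) \<le> inverse (real (Suc N))"
        by (intro le_imp_inverse_le) auto
      then show ?thesis using N unfolding nd by linarith
    qed
    have dl: "d \<longlonglongrightarrow> 0"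
    proof -
      have "(\<lambda>n. inverse (real (Suc (n + N)))) \<longlonglongrightarrow> 0"
        using LIMSEQ_ignore_initial_segment[OF LIMSEQ_inverse_real_of_nat, of N] by simp
      from tendsto_scaleR[OF this tendsto_const[of e]] show ?thesis by (simp add: d_def)
    qed
    show "(\<lambda>t. g t z a \<bullet> e) integrable_on {0..T}"
    proof (rule dominated_convergence(1)[where h = "\<lambda>_. C"])
      fix n
      have "a + d n \<in> A" using r(2)[OF dr] ends_in_segment(2) by blast
      then show "(\<lambda>t. (k t z (a + d n) - k t z a) / norm (d n)) integrable_on {0..T}"
        by (intro integrable_on_divide integrable_diff int a)
      show "norm ((k t z (a + d n) - k t z a) / norm (d n)) \<le> C" if "t \<in> {0..T}" for t
        using mv[OF that r(2)[OF dr], of z n] d0[of n] by (simp add: field_simps)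
    next
      fix t assume t: "t \<in> {0..T}"
      have "(\<lambda>n. (k t z (a + d n) - k t z a - d n \<bullet> g t z a) / norm (d n)) \<longlonglongrightarrow> 0"
        by (rule tendsto_norm_zero_cancel) (use lim[OF t a d0 dl] in simp)
      moreover have "d n \<bullet> g t z a / norm (d n) = g t z a \<bullet> e" for n
        unfolding nd by (simp add: d_def inner_commute)
      ultimately have "(\<lambda>n. (k t z (a + d n) - k t z a) / norm (d n) - g t z a \<bullet> e) \<longlonglongrightarrow> 0"
        by (simp add: diff_divide_distrib)
      then show "(\<lambda>n. (k t z (a + d n) - k t z a) / norm (d n)) \<longlonglongrightarrow> g t z a \<bullet> e"
        by (rule LIM_zero_cancel)
    qed (rule integrable_const_ivl)
  qed
  show "GDERIV (\<lambda>a. integral {0..T} (\<lambda>t. k t z a)) a :> integral {0..T} (\<lambda>t. g t z a)"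
    if a: "a \<in> A" for z a
    unfolding gderiv_def
  proof -
    obtain r where r: "0 < r" "\<And>d. norm d < r \<Longrightarrow> closed_segment a (a + d) \<subseteq> A"
      using segment[OF a] by blast
    show "((\<lambda>a. integral {0..T} (\<lambda>t. k t z a)) has_derivative (\<lambda>h. h \<bullet> integral {0..T} (\<lambda>t. g t z a))) (at a)"
    proof (rule has_derivative_at_sequentially[OF r(1)])
      show "bounded_linear (\<lambda>h. h \<bullet> integral {0..T} (\<lambda>t. g t z a))"
        by (rule bounded_linear_inner_left)
    next
      fix d :: "nat \<Rightarrow> 'p"
      assume d0: "\<And>n. d n \<noteq> 0" and dr: "\<And>n. norm (d n) < r" and dl: "d \<longlonglongrightarrow> 0"
      have ad: "a + d n \<in> A" for n using r(2)[OF dr] using ends_in_segment(2) by blast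
      let ?e = "\<lambda>n t. (k t z (a + d n) - k t z a - d n \<bullet> g t z a) / norm (d n)"
      have igi: "(\<lambda>t. w \<bullet> g t z a) integrable_on {0..T}" for w
        using integrable_linear[OF gint[OF a, of z] bounded_linear_inner_right[of w]] by (simp add: comp_def)
      have iei: "?e n integrable_on {0..T}" for n
        by (intro integrable_on_divide integrable_diff int a ad igi)
      have "(\<lambda>n. integral {0..T} (?e n)) \<longlonglongrightarrow> integral {0..T} (\<lambda>t. 0)"
      proof (rule dominated_convergence(2)[OF iei, where h = "\<lambda>_. 2 * C"])
        fix n t assume t: "t \<in> {0..T}"
        have "\<bar>d n \<bullet> g t z a\<bar> \<le> C * norm (d n)"
          using Cauchy_Schwarz_ineq2[of "d n" "g t z a"] mult_left_mono[OF bd[OF t a, of z], of "norm (d n)"]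
          by (simp add: mult.commute)
        then have "\<bar>k t z (a + d n) - k t z a - d n \<bullet> g t z a\<bar> \<le> 2 * C * norm (d n)"
          using mv[OF t r(2)[OF dr], of z n] by linarith
        then show "norm (?e n t) \<le> 2 * C" using d0[of n] by (simp add: field_simps)
      next
        fix t assume t: "t \<in> {0..T}"
        show "(\<lambda>n. ?e n t) \<longlonglongrightarrow> 0"
          by (rule tendsto_norm_zero_cancel) (use lim[OF t a d0 dl] in simp)
      qed (rule integrable_const_ivl)
      then have "(\<lambda>n. \<bar>integral {0..T} (?e n)\<bar>) \<longlonglongrightarrow> 0"
        by (intro tendsto_rabs_zero) (simp only: integral_0)
      moreover have "\<bar>integral {0..T} (?e n)\<bar> = norm (integral {0..T} (\<lambda>t. k t z (a + d n))
          - integral {0..T} (\<lambda>t. k t z a) - d n \<bullet> integral {0..T} (\<lambda>t. g t z a)) / norm (d n)" for n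
      proof -
        have "integral {0..T} (\<lambda>t. d n \<bullet> g t z a) = d n \<bullet> integral {0..T} (\<lambda>t. g t z a)"
          using integral_linear[OF gint[OF a, of z] bounded_linear_inner_right[of "d n"]] by (simp add: comp_def)
        then have "integral {0..T} (?e n) = (integral {0..T} (\<lambda>t. k t z (a + d n))
          - integral {0..T} (\<lambda>t. k t z a) - d n \<bullet> integral {0..T} (\<lambda>t. g t z a)) / norm (d n)"
          by (simp add: integral_diff integrable_diff int a ad igi integral_divide)
        then show ?thesis by (simp only: abs_divide real_norm_def abs_norm_cancel)
      qed
      ultimately show "(\<lambda>n. norm (integral {0..T} (\<lambda>t. k t z (a + d n)) - integral {0..T} (\<lambda>t. k t z a)
          - d n \<bullet> integral {0..T} (\<lambda>t. g t z a)) / norm (d n)) \<longlonglongrightarrow> 0" by (simp only:)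
    qed
  qed
  show "continuous_on (UNIV \<times> A) (\<lambda>(z, a). integral {0..T} (\<lambda>t. g t z a))"
  proof (subst continuous_on_sequentially, intro ballI allI impI, elim conjE)
    fix p and q :: "nat \<Rightarrow> 'z \<times> 'p"
    assume p: "p \<in> UNIV \<times> A" and q: "\<forall>n. q n \<in> UNIV \<times> A" and l: "q \<longlonglongrightarrow> p"
    have "(\<lambda>n. integral {0..T} (\<lambda>t. g t (fst (q n)) (snd (q n)))) \<longlonglongrightarrow> integral {0..T} (\<lambda>t. g t (fst p) (snd p))"
    proof (rule dominated_convergence(2)[where h = "\<lambda>_. C"])
      show "(\<lambda>t. g t (fst (q n)) (snd (q n))) integrable_on {0..T}" for n
        using q by (intro gint) (auto simp: mem_Times_iff)
      show "norm (g t (fst (q n)) (snd (q n))) \<le> C" if "t \<in> {0..T}" for n t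
        using q that by (intro bd) (auto simp: mem_Times_iff)
      show "(\<lambda>n. g t (fst (q n)) (snd (q n))) \<longlonglongrightarrow> g t (fst p) (snd p)" if "t \<in> {0..T}" for t
        using continuous_on_tendsto_compose[OF cont[OF that] l p always_eventually[OF q]]
        by (simp add: case_prod_unfold)
    qed (rule integrable_const_ivl)
    then show "((\<lambda>(z, a). integral {0..T} (\<lambda>t. g t z a)) \<circ> q) \<longlonglongrightarrow> (case p of (z, a) \<Rightarrow> integral {0..T} (\<lambda>t. g t z a))"
      by (simp add: case_prod_unfold comp_def)
  qed
  show "norm (integral {0..T} (\<lambda>t. g t z a)) \<le> C * T" if a: "a \<in> A" for z a
    using integral_norm_bound_integral[OF gint[OF a] integrable_const_ivl[of C 0 T] bd[OF _ a], of z] T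
    by (simp add: mult.commute)
qed

text \<open>Differentiation of \<open>\<integral> w(Q) u(Q, a) dQ\<close> in \<open>a\<close> without a majorant of \<open>\<nabla>\<^sub>a u\<close> that is uniform in \<open>a\<close>: a
  uniform bound on the \<open>L\<^sup>1\<close> norms together with the continuity of the candidate derivative suffices.\<close>

theorem GDERIV_lborel_integral:
  fixes u :: "'q::euclidean_space \<Rightarrow> 'p::euclidean_space \<Rightarrow> real" and w :: "'q \<Rightarrow> real"
  assumes A: "open A" and a: "a \<in> A"
    and deriv: "\<And>Q a. a \<in> A \<Longrightarrow> GDERIV (\<lambda>b. u Q b) a :> du Q a"
    and du_cont: "continuous_on (UNIV \<times> A) (\<lambda>(Q, a). du Q a)"
    and w [measurable]: "w \<in> borel_measurable borel" and w_bd: "\<And>Q. \<bar>w Q\<bar> \<le> B"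
    and u_int: "\<And>a. a \<in> A \<Longrightarrow> integrable lborel (\<lambda>Q. w Q * u Q a)"
    and du_int: "\<And>a. a \<in> A \<Longrightarrow> integrable lborel (\<lambda>Q. du Q a)"
    and du_bd: "\<And>a. a \<in> A \<Longrightarrow> (LINT Q|lborel. norm (du Q a)) \<le> C"
    and b_cont: "continuous_on A (\<lambda>a. LINT Q|lborel. w Q *\<^sub>R du Q a)"
  shows "GDERIV (\<lambda>a. LINT Q|lborel. w Q * u Q a) a :> (LINT Q|lborel. w Q *\<^sub>R du Q a)"
proof -
  define m where "m = (\<lambda>a. LINT Q|lborel. w Q * u Q a)"
  define b where "b = (\<lambda>a. LINT Q|lborel. w Q *\<^sub>R du Q a)"
  obtain r where r: "0 < r" "ball a r \<subseteq> A" using A a by (meson open_contains_ball)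
  have B: "0 \<le> B" using w_bd[of 0] by linarith
  have wdu_int: "integrable lborel (\<lambda>Q. w Q *\<^sub>R du Q a)" if "a \<in> A" for a
  proof (rule Bochner_Integration.integrable_bound)
    show "integrable lborel (\<lambda>Q. B * norm (du Q a))" using du_int[OF that] by simp
    show "(\<lambda>Q. w Q *\<^sub>R du Q a) \<in> borel_measurable lborel"
      using borel_measurable_integrable[OF du_int[OF that]] by simp
    show "AE Q in lborel. norm (w Q *\<^sub>R du Q a) \<le> norm (B * norm (du Q a))"
      using w_bd B by (auto simp: abs_mult intro!: mult_right_mono)
  qed
  have segment: "(LINT \<tau>|lborel. indicator {0..1} \<tau> * (d \<bullet> b (a + \<tau> *\<^sub>R d))) = m (a + d) - m a"
    and segment_int: "integrable lborel (\<lambda>\<tau>. indicator {0..1} \<tau> * (d \<bullet> b (a + \<tau> *\<^sub>R d)))"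
    if d: "norm d < r" for d
  proof -
    have in_A: "a + \<tau> *\<^sub>R d \<in> A" if "\<tau> \<in> {0..1}" for \<tau>
    proof -
      have "\<bar>\<tau>\<bar> * norm d \<le> 1 * norm d" using that by (intro mult_right_mono) auto
      then have "a + \<tau> *\<^sub>R d \<in> ball a r" using d by (simp add: dist_norm)
      then show ?thesis using r by blast
    qed
    \<comment> \<open>The derivative in \<open>\<tau>\<close> of \<open>w Q * u Q (a + \<tau> d)\<close>, extended by 0 off the unit interval.\<close>
    define F where "F = (\<lambda>\<tau> Q. indicator {0..1} \<tau> * (w Q * (d \<bullet> du Q (a + \<tau> *\<^sub>R d))))"
    have "continuous_on ({0..1} \<times> UNIV) (\<lambda>p. (\<lambda>(Q, a). du Q a) (snd p, a + fst p *\<^sub>R d))"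
      by (rule continuous_on_compose2[OF du_cont]) (auto intro!: continuous_intros in_A)
    then have "continuous_on ({0..1} \<times> UNIV) (\<lambda>p. d \<bullet> du (snd p) (a + fst p *\<^sub>R d))"
      by (auto intro!: continuous_intros)
    then have "(\<lambda>p. indicator ({0..1} \<times> UNIV) p *\<^sub>R (d \<bullet> du (snd p) (a + fst p *\<^sub>R d))) \<in> borel_measurable (borel :: (real \<times> 'q) measure)"
      by (intro borel_measurable_continuous_on_indicator borel_closed closed_Times) auto
    then have "(\<lambda>p. indicator ({0..1} \<times> UNIV) p *\<^sub>R (d \<bullet> du (snd p) (a + fst p *\<^sub>R d)))
        \<in> borel_measurable (lborel \<Otimes>\<^sub>M lborel)"
      by (simp add: borel_prod[symmetric])
    then have "(\<lambda>p. w (snd p) * (indicator ({0..1} \<times> UNIV) p *\<^sub>R (d \<bullet> du (snd p) (a + fst p *\<^sub>R d))))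
        \<in> borel_measurable (lborel \<Otimes>\<^sub>M lborel)"
      by measurable
    also have "(\<lambda>p. w (snd p) * (indicator ({0..1} \<times> UNIV) p *\<^sub>R (d \<bullet> du (snd p) (a + fst p *\<^sub>R d)))) = case_prod F"
      by (auto simp: F_def fun_eq_iff indicator_def)
    finally have F_meas: "case_prod F \<in> borel_measurable (lborel \<Otimes>\<^sub>M lborel)" .
    have F_int: "integrable lborel (F \<tau>)" for \<tau>
    proof (cases "\<tau> \<in> {0..1}")
      case True
      have "F \<tau> = (\<lambda>Q. d \<bullet> (w Q *\<^sub>R du Q (a + \<tau> *\<^sub>R d)))"
        using True by (auto simp: F_def)
      then show ?thesis
        by (simp only:) (rule integrable_inner_right, use wdu_int[OF in_A[OF True]] in auto)
    qed (simp add: F_def)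
    have F_LINT: "(LINT Q|lborel. F \<tau> Q) = indicator {0..1} \<tau> * (d \<bullet> b (a + \<tau> *\<^sub>R d))" for \<tau>
    proof (cases "\<tau> \<in> {0..1}")
      case True
      have "F \<tau> = (\<lambda>Q. d \<bullet> (w Q *\<^sub>R du Q (a + \<tau> *\<^sub>R d)))"
        using True by (auto simp: F_def)
      then have "(LINT Q|lborel. F \<tau> Q) = (LINT Q|lborel. d \<bullet> (w Q *\<^sub>R du Q (a + \<tau> *\<^sub>R d)))"
        by (simp only:)
      also have "\<dots> = d \<bullet> b (a + \<tau> *\<^sub>R d)"
        unfolding b_def by (rule integral_inner_right) (use wdu_int[OF in_A[OF True]] in auto)
      finally show ?thesis using True by simp
    qed (simp add: F_def)
    have F_norm: "(LINT Q|lborel. norm (F \<tau> Q)) \<le> indicator {0..1} \<tau> * (B * (norm d * C))" for \<tau>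
    proof (cases "\<tau> \<in> {0..1}")
      case True
      have "(LINT Q|lborel. norm (F \<tau> Q)) \<le> (LINT Q|lborel. B * (norm d * norm (du Q (a + \<tau> *\<^sub>R d))))"
      proof (rule integral_mono)
        show "integrable lborel (\<lambda>Q. norm (F \<tau> Q))" using F_int by simp
        show "integrable lborel (\<lambda>Q. B * (norm d * norm (du Q (a + \<tau> *\<^sub>R d))))"
          using du_int[OF in_A[OF True]] by simp
        show "norm (F \<tau> Q) \<le> B * (norm d * norm (du Q (a + \<tau> *\<^sub>R d)))" for Q
          using True w_bd[of Q] B Cauchy_Schwarz_ineq2[of d "du Q (a + \<tau> *\<^sub>R d)"]
          by (auto simp: F_def abs_mult intro!: mult_mono)
      qed
      also have "\<dots> = B * (norm d * (LINT Q|lborel. norm (du Q (a + \<tau> *\<^sub>R d))))" by simp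
      also have "\<dots> \<le> B * (norm d * C)"
        using du_bd[OF in_A[OF True]] B by (intro mult_left_mono) auto
      finally show ?thesis using True by simp
    qed (simp add: F_def)
    have F_pair: "integrable (lborel \<Otimes>\<^sub>M lborel) (case_prod F)"
    proof (rule lborel_pair.Fubini_integrable[OF F_meas])
      show "integrable lborel (\<lambda>\<tau>. LINT Q|lborel. norm (case_prod F (\<tau>, Q)))"
      proof (rule Bochner_Integration.integrable_bound)
        show "integrable lborel (\<lambda>\<tau>::real. indicator {0..1} \<tau> * (B * (norm d * C)))"
          by (intro integrable_mult_left integrable_real_indicator) auto
        have "(\<lambda>p. norm (case_prod F p)) \<in> borel_measurable (lborel \<Otimes>\<^sub>M lborel)"
          using F_meas by measurable
        from lborel.borel_measurable_lebesgue_integral[of "\<lambda>\<tau> Q. norm (F \<tau> Q)" lborel] this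
        show "(\<lambda>\<tau>. LINT Q|lborel. norm (case_prod F (\<tau>, Q))) \<in> borel_measurable lborel"
          by (simp add: case_prod_unfold)
        show "AE \<tau> in lborel. norm (LINT Q|lborel. norm (case_prod F (\<tau>, Q)))
            \<le> norm (indicator {0..1} \<tau> * (B * (norm d * C)))"
        proof (rule AE_I2)
          fix \<tau> :: real
          have "norm (LINT Q|lborel. norm (F \<tau> Q)) = (LINT Q|lborel. norm (F \<tau> Q))"
            by (simp add: integral_nonneg_AE)
          then show "norm (LINT Q|lborel. norm (case_prod F (\<tau>, Q)))
              \<le> norm (indicator {0..1} \<tau> * (B * (norm d * C)))"
            using order_trans[OF F_norm[of \<tau>] abs_ge_self] by (simp only: prod.case real_norm_def)
        qed
      qed
      show "AE \<tau> in lborel. integrable lborel (\<lambda>Q. case_prod F (\<tau>, Q))"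
        using F_int by simp
    qed
    have FTC: "(LINT \<tau>|lborel. F \<tau> Q) = w Q * (u Q (a + d) - u Q a)" for Q
    proof -
      have "(LINT \<tau>|lborel. indicator {0..1} \<tau> *\<^sub>R (d \<bullet> du Q (a + \<tau> *\<^sub>R d))) = u Q (a + 1 *\<^sub>R d) - u Q (a + 0 *\<^sub>R d)"
      proof (rule integral_FTC_Icc)
        fix \<tau> :: real assume "0 \<le> \<tau>" "\<tau> \<le> 1"
        then have \<tau>: "\<tau> \<in> {0..1}" by simp
        have "((\<lambda>\<tau>. u Q (a + \<tau> *\<^sub>R d)) has_derivative (\<lambda>h. (h *\<^sub>R d) \<bullet> du Q (a + \<tau> *\<^sub>R d))) (at \<tau>)"
          by (rule has_derivative_compose[where g = "u Q" and g' = "\<lambda>h. h \<bullet> du Q (a + \<tau> *\<^sub>R d)"])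
            (use deriv[OF in_A[OF \<tau>], of Q] in \<open>auto intro!: derivative_eq_intros simp: gderiv_def\<close>)
        then show "((\<lambda>\<tau>. u Q (a + \<tau> *\<^sub>R d)) has_vector_derivative d \<bullet> du Q (a + \<tau> *\<^sub>R d)) (at \<tau> within {0..1})"
          by (simp add: has_vector_derivative_def has_derivative_at_withinI)
      next
        have "continuous_on {0..1} (\<lambda>\<tau>. (\<lambda>(Q, a). du Q a) (Q, a + \<tau> *\<^sub>R d))"
          by (rule continuous_on_compose2[OF du_cont]) (auto intro!: continuous_intros in_A)
        then show "continuous_on {0..1} (\<lambda>\<tau>. d \<bullet> du Q (a + \<tau> *\<^sub>R d))"
          by (auto intro!: continuous_intros)
      qed simp
      moreover have "(LINT \<tau>|lborel. F \<tau> Q) = w Q * (LINT \<tau>|lborel. indicator {0..1} \<tau> *\<^sub>R (d \<bullet> du Q (a + \<tau> *\<^sub>R d)))"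
        unfolding F_def by (subst integral_mult_right_zero[symmetric]) (simp add: mult_ac)
      ultimately show ?thesis by simp
    qed
    have "a \<in> A" "a + d \<in> A" using in_A[of 0] in_A[of 1] by auto
    then have "m (a + d) - m a = (LINT Q|lborel. w Q * (u Q (a + d) - u Q a))"
      unfolding m_def by (subst Bochner_Integration.integral_diff[symmetric]) (auto intro!: u_int simp: algebra_simps)
    also have "\<dots> = (LINT Q|lborel. LINT \<tau>|lborel. F \<tau> Q)" by (simp add: FTC)
    also have "\<dots> = (LINT \<tau>|lborel. LINT Q|lborel. F \<tau> Q)"
      by (rule lborel_pair.Fubini_integral[OF F_pair])
    finally show "(LINT \<tau>|lborel. indicator {0..1} \<tau> * (d \<bullet> b (a + \<tau> *\<^sub>R d))) = m (a + d) - m a"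
      by (simp add: F_LINT)
    have "integrable lborel (\<lambda>\<tau>. LINT Q|lborel. F \<tau> Q)"
      using lborel_pair.integrable_fst[OF F_pair] by simp
    then show "integrable lborel (\<lambda>\<tau>. indicator {0..1} \<tau> * (d \<bullet> b (a + \<tau> *\<^sub>R d)))"
      by (simp add: F_LINT)
  qed
  have "(m has_derivative (\<lambda>h. h \<bullet> b a)) (at a)"
    unfolding has_derivative_at_alt
  proof (intro conjI allI impI)
    show "bounded_linear (\<lambda>h. h \<bullet> b a)" by (rule bounded_linear_inner_left)
  next
    fix e :: real assume e: "0 < e"
    from b_cont a e obtain \<delta> where \<delta>: "0 < \<delta>" "\<And>a'. a' \<in> A \<Longrightarrow> dist a' a < \<delta> \<Longrightarrow> dist (b a') (b a) < e"
      unfolding b_def[symmetric] continuous_on_iff by blast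
    show "\<exists>\<delta>>0. \<forall>y. norm (y - a) < \<delta> \<longrightarrow> norm (m y - m a - (y - a) \<bullet> b a) \<le> e * norm (y - a)"
    proof (intro exI[of _ "min r \<delta>"] conjI allI impI)
      show "0 < min r \<delta>" using r \<delta> by simp
      fix y assume y: "norm (y - a) < min r \<delta>"
      define d where "d = y - a"
      have d: "norm d < r" "norm d < \<delta>" "y = a + d" using y by (auto simp: d_def)
      have near: "\<bar>d \<bullet> b (a + \<tau> *\<^sub>R d) - d \<bullet> b a\<bar> \<le> norm d * e" if "\<tau> \<in> {0..1}" for \<tau>
      proof -
        have "\<bar>\<tau>\<bar> * norm d \<le> 1 * norm d" using that by (intro mult_right_mono) auto
        then have "norm (\<tau> *\<^sub>R d) < r" "norm (\<tau> *\<^sub>R d) < \<delta>" using d by auto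
        then have "a + \<tau> *\<^sub>R d \<in> A" "dist (a + \<tau> *\<^sub>R d) a < \<delta>"
          using r(2) by (auto simp: dist_norm subset_iff)
        then have "norm (b (a + \<tau> *\<^sub>R d) - b a) \<le> e"
          using \<delta>(2) by (fastforce simp: dist_norm)
        then have "norm d * norm (b (a + \<tau> *\<^sub>R d) - b a) \<le> norm d * e"
          by (intro mult_left_mono) auto
        then show ?thesis
          using Cauchy_Schwarz_ineq2[of d "b (a + \<tau> *\<^sub>R d) - b a"] by (simp add: inner_diff_right)
      qed
      let ?i = "indicator {0..1::real}"
      have const: "integrable lborel (\<lambda>\<tau>::real. ?i \<tau> * c)" "(LINT \<tau>|lborel. ?i \<tau> * c) = c" for c :: real
        by (auto intro!: integrable_mult_left integrable_real_indicator)
      have "m y - m a - (y - a) \<bullet> b a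
          = (LINT \<tau>|lborel. ?i \<tau> * (d \<bullet> b (a + \<tau> *\<^sub>R d)) - ?i \<tau> * (d \<bullet> b a))"
        using segment[OF d(1)] segment_int[OF d(1)] const[of "d \<bullet> b a"]
        by (subst Bochner_Integration.integral_diff) (auto simp: d(3))
      also have "norm \<dots> \<le> (LINT \<tau>|lborel. ?i \<tau> * (norm d * e))"
      proof (rule order_trans[OF integral_norm_bound integral_mono])
        show "integrable lborel (\<lambda>\<tau>. norm (?i \<tau> * (d \<bullet> b (a + \<tau> *\<^sub>R d)) - ?i \<tau> * (d \<bullet> b a)))"
          using segment_int[OF d(1)] const(1)[of "d \<bullet> b a"]
          by (intro integrable_norm Bochner_Integration.integrable_diff) auto
        show "norm (?i \<tau> * (d \<bullet> b (a + \<tau> *\<^sub>R d)) - ?i \<tau> * (d \<bullet> b a)) \<le> ?i \<tau> * (norm d * e)" for \<tau>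
          using near[of \<tau>] by (auto simp: indicator_def)
      qed (rule const(1))
      also have "\<dots> = e * norm (y - a)" by (simp only: const(2)) (simp add: d_def)
      finally show "norm (m y - m a - (y - a) \<bullet> b a) \<le> e * norm (y - a)" .
    qed
  qed
  then show ?thesis unfolding gderiv_def m_def b_def .
qed

section \<open>Variance of the crossed U-statistic\<close>

lemma crossed_estimator_eq:
  "crossed_estimator N m mt G = (1 / (real N * (real N - 1))) *\<^sub>R
     (\<Sum>j\<in>{1..N}. (\<Sum>i\<in>{1..N} - {j}. m i - mt) *\<^sub>R (m j *\<^sub>R G j))"
proof -
  have "(\<Sum>j\<in>{1..N}. (\<Sum>i\<in>{1..N} - {j}. m i - mt) *\<^sub>R (m j *\<^sub>R G j))
      = (\<Sum>j\<in>{1..N}. \<Sum>i\<in>{1..N} - {j}. ((m i - mt) * m j) *\<^sub>R G j)"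
    by (simp add: scaleR_sum_left sum_distrib_right)
  also have "\<dots> = (\<Sum>(j, i)\<in>(SIGMA j:{1..N}. {1..N} - {j}). ((m i - mt) * m j) *\<^sub>R G j)"
    by (rule sum.Sigma) auto
  also have "\<dots> = (\<Sum>(i, j) \<in> {(i, j). i \<in> {1..N} \<and> j \<in> {1..N} \<and> i \<noteq> j}. ((m i - mt) * m j) *\<^sub>R G j)"
    by (rule sum.reindex_bij_witness[of _ "\<lambda>(i, j). (j, i)" "\<lambda>(i, j). (j, i)"]) auto
  finally show ?thesis by (simp add: crossed_estimator_def)
qed

lemma integrable_bounded_scaleR:
  fixes h :: "'a \<Rightarrow> 'b::{banach, second_countable_topology}"
  assumes "integrable M h" "u \<in> borel_measurable M" "\<And>x. \<bar>u x\<bar> \<le> B"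
  shows "integrable M (\<lambda>x. u x *\<^sub>R h x)"
proof (rule Bochner_Integration.integrable_bound)
  show "integrable M (\<lambda>x. B * norm (h x))" using assms(1) by simp
  show "(\<lambda>x. u x *\<^sub>R h x) \<in> borel_measurable M"
    using assms(2) borel_measurable_integrable[OF assms(1)] by simp
  show "AE x in M. norm (u x *\<^sub>R h x) \<le> norm (B * norm (h x))"
  proof (rule AE_I2)
    fix x
    have "\<bar>u x\<bar> * norm (h x) \<le> B * norm (h x)" by (intro mult_right_mono assms(3)) simp
    then show "norm (u x *\<^sub>R h x) \<le> norm (B * norm (h x))" by simp
  qed
qed

lemma integral_double_sum:
  fixes u :: "'i \<Rightarrow> 'j \<Rightarrow> 'a \<Rightarrow> 'b::{banach, second_countable_topology}"
  assumes "\<And>i k. i \<in> I \<Longrightarrow> k \<in> J \<Longrightarrow> integrable M (u i k)"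
  shows "(LINT x|M. (\<Sum>i\<in>I. \<Sum>k\<in>J. u i k x)) = (\<Sum>i\<in>I. \<Sum>k\<in>J. (LINT x|M. u i k x))"
proof -
  have "(LINT x|M. (\<Sum>i\<in>I. \<Sum>k\<in>J. u i k x)) = (\<Sum>i\<in>I. (LINT x|M. (\<Sum>k\<in>J. u i k x)))"
    by (intro Bochner_Integration.integral_sum Bochner_Integration.integrable_sum assms)
  also have "\<dots> = (\<Sum>i\<in>I. \<Sum>k\<in>J. (LINT x|M. u i k x))"
    by (intro sum.cong refl Bochner_Integration.integral_sum assms)
  finally show ?thesis .
qed

lemma integral_euclidean_eq_0:
  fixes h :: "'a \<Rightarrow> 'b::euclidean_space"
  assumes "integrable M h" and "\<And>e. e \<in> Basis \<Longrightarrow> (LINT x|M. h x \<bullet> e) = 0"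
  shows "(LINT x|M. h x) = 0"
proof (rule euclidean_eqI)
  fix e :: 'b assume "e \<in> Basis"
  then show "(LINT x|M. h x) \<bullet> e = 0 \<bullet> e"
    using assms(2)[of e] integral_inner_left[of e M h] assms(1) by simp
qed

text \<open>The norm of \<open>L\<^sup>2(M)\<close> for vector valued functions; it is meaningful for functions that satisfy the
  predicate \<open>square_integrable_fun\<close>.\<close>

definition L2_norm :: "'a measure \<Rightarrow> ('a \<Rightarrow> 'b::real_normed_vector) \<Rightarrow> real" where
  "L2_norm M h = sqrt (LINT x|M. (norm (h x))\<^sup>2)"

text \<open>Measurable functions with integrable squared norm.\<close>

definition square_integrable_fun :: "'a measure \<Rightarrow> ('a \<Rightarrow> 'b::euclidean_space) \<Rightarrow> bool" where
  "square_integrable_fun M h \<longleftrightarrow> h \<in> borel_measurable M \<and> integrable M (\<lambda>x. (norm (h x))\<^sup>2)"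

lemma square_add_le:
  fixes x y p q :: real
  assumes "0 < p" "0 < q"
  shows "(x + y)\<^sup>2 \<le> (p + q) * (x\<^sup>2 / p + y\<^sup>2 / q)"
proof -
  define u w where "u = x / p" and "w = y / q"
  have x: "x = p * u" "x\<^sup>2 / p = p * u\<^sup>2" and y: "y = q * w" "y\<^sup>2 / q = q * w\<^sup>2"
    using assms by (simp_all add: u_def w_def power2_eq_square)
  have "(p + q) * (p * u\<^sup>2 + q * w\<^sup>2) - (p * u + q * w)\<^sup>2 = p * q * (u - w)\<^sup>2"
    by (simp add: power2_eq_square algebra_simps)
  moreover have "0 \<le> p * q * (u - w)\<^sup>2" using assms by simp
  ultimately show ?thesis unfolding x(2) y(2) unfolding x(1) y(1) by linarith
qed

lemma
  fixes g h :: "'a \<Rightarrow> 'b::euclidean_space"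
  assumes g: "square_integrable_fun M g" and h: "square_integrable_fun M h"
  shows square_integrable_add: "square_integrable_fun M (\<lambda>x. g x + h x)"
    and L2_norm_add: "L2_norm M (\<lambda>x. g x + h x) \<le> L2_norm M g + L2_norm M h"
proof -
  have ptw: "(norm (g x + h x))\<^sup>2 \<le> (p + q) * ((norm (g x))\<^sup>2 / p + (norm (h x))\<^sup>2 / q)"
    if "0 < p" "0 < q" for p q x
  proof -
    have "(norm (g x + h x))\<^sup>2 \<le> (norm (g x) + norm (h x))\<^sup>2"
      by (intro power_mono norm_triangle_ineq) simp
    also have "\<dots> \<le> (p + q) * ((norm (g x))\<^sup>2 / p + (norm (h x))\<^sup>2 / q)"
      by (rule square_add_le[OF that])
    finally show ?thesis .
  qed
  have maj: "integrable M (\<lambda>x. (p + q) * ((norm (g x))\<^sup>2 / p + (norm (h x))\<^sup>2 / q))" for p q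
    using g h by (simp add: square_integrable_fun_def)
  have meas: "(\<lambda>x. g x + h x) \<in> borel_measurable M"
    using g h by (auto simp: square_integrable_fun_def)
  have int: "integrable M (\<lambda>x. (norm (g x + h x))\<^sup>2)"
  proof (rule Bochner_Integration.integrable_bound[OF maj[of 1 1]])
    show "(\<lambda>x. (norm (g x + h x))\<^sup>2) \<in> borel_measurable M" using meas by simp
    show "AE x in M. norm ((norm (g x + h x))\<^sup>2) \<le> norm ((1 + 1) * ((norm (g x))\<^sup>2 / 1 + (norm (h x))\<^sup>2 / 1))"
      using ptw[of 1 1] by simp
  qed
  then show "square_integrable_fun M (\<lambda>x. g x + h x)"
    using meas by (simp add: square_integrable_fun_def)
  have nonneg: "0 \<le> L2_norm M g" "0 \<le> L2_norm M h" by (simp_all add: L2_norm_def)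
  show "L2_norm M (\<lambda>x. g x + h x) \<le> L2_norm M g + L2_norm M h"
  proof (rule field_le_epsilon)
    fix e :: real assume "0 < e"
    \<comment> \<open>The weights \<open>p, q\<close> are the two norms, made positive by \<open>e\<close>; the pointwise bound then integrates to at most \<open>(p + q)\<^sup>2\<close>.\<close>
    define p where "p = L2_norm M g + e / 2"
    define q where "q = L2_norm M h + e / 2"
    have pq: "0 < p" "0 < q" using nonneg \<open>0 < e\<close> by (auto simp: p_def q_def)
    have sq: "(LINT x|M. (norm (g x))\<^sup>2) \<le> p\<^sup>2" "(LINT x|M. (norm (h x))\<^sup>2) \<le> q\<^sup>2"
    proof -
      have "(L2_norm M g)\<^sup>2 \<le> p\<^sup>2" "(L2_norm M h)\<^sup>2 \<le> q\<^sup>2"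
        using nonneg \<open>0 < e\<close> by (auto simp: p_def q_def intro!: power_mono)
      then show "(LINT x|M. (norm (g x))\<^sup>2) \<le> p\<^sup>2" "(LINT x|M. (norm (h x))\<^sup>2) \<le> q\<^sup>2"
        by (simp_all add: L2_norm_def)
    qed
    have "(LINT x|M. (norm (g x + h x))\<^sup>2) \<le> (LINT x|M. (p + q) * ((norm (g x))\<^sup>2 / p + (norm (h x))\<^sup>2 / q))"
      by (rule integral_mono[OF int maj ptw[OF pq]])
    also have "\<dots> = (p + q) * ((LINT x|M. (norm (g x))\<^sup>2) / p + (LINT x|M. (norm (h x))\<^sup>2) / q)"
      using g h by (simp add: square_integrable_fun_def)
    also have "\<dots> \<le> (p + q) * (p\<^sup>2 / p + q\<^sup>2 / q)"
      using sq pq by (intro mult_left_mono add_mono divide_right_mono) auto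
    also have "\<dots> = (p + q)\<^sup>2" using pq by (simp add: power2_eq_square)
    finally have "L2_norm M (\<lambda>x. g x + h x) \<le> p + q"
      using pq unfolding L2_norm_def by (intro real_le_lsqrt) auto
    then show "L2_norm M (\<lambda>x. g x + h x) \<le> L2_norm M g + L2_norm M h + e"
      by (simp add: p_def q_def)
  qed
qed

lemma square_integrable_fun_scaleR:
  assumes "square_integrable_fun M h"
  shows "square_integrable_fun M (\<lambda>x. c *\<^sub>R h x)"
  using assms by (auto simp: square_integrable_fun_def power_mult_distrib)

lemma L2_norm_scaleR: "L2_norm M (\<lambda>x. c *\<^sub>R h x) = \<bar>c\<bar> * L2_norm M h"
  by (simp add: L2_norm_def power_mult_distrib real_sqrt_mult)

lemma (in prob_space) square_integrable_fun_imp_integrable: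
  assumes "square_integrable_fun M h"
  shows "integrable M h"
proof (rule Bochner_Integration.integrable_bound)
  show "integrable M (\<lambda>x. 1 + (norm (h x))\<^sup>2)" using assms by (simp add: square_integrable_fun_def)
  show "h \<in> borel_measurable M" using assms by (simp add: square_integrable_fun_def)
  show "AE x in M. norm (h x) \<le> norm (1 + (norm (h x))\<^sup>2)"
  proof (rule AE_I2)
    fix x
    have "0 \<le> (norm (h x) - 1)\<^sup>2" by simp
    then have "2 * norm (h x) \<le> 1 + (norm (h x))\<^sup>2" by (simp add: power2_diff)
    moreover have "norm (1 + (norm (h x))\<^sup>2) = 1 + (norm (h x))\<^sup>2" by simp
    ultimately show "norm (h x) \<le> norm (1 + (norm (h x))\<^sup>2)"
      using norm_ge_zero[of "h x"] by linarith
  qed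
qed

text \<open>An independent sample of pairs \<open>(X i, W i)\<close>, bounded in the first and square integrable in the second
  component, with common means \<open>m\<close>, \<open>b\<close> and common spreads (root mean square deviations) \<open>s\<close>, \<open>v\<close>. The two
  components of one pair may be dependent.\<close>

locale crossed_sample = prob_space M for M :: "'w measure" +
  fixes N :: nat
    and X :: "nat \<Rightarrow> 'w \<Rightarrow> real"
    and W :: "nat \<Rightarrow> 'w \<Rightarrow> 'p::euclidean_space"
    and m :: real and b :: 'p and s v B :: real
  assumes N2: "2 \<le> N"
    and indep: "indep_vars (\<lambda>_. borel) (\<lambda>i \<omega>. (X i \<omega>, W i \<omega>)) {1..N}"
    and X_bound: "\<And>i \<omega>. \<bar>X i \<omega>\<bar> \<le> B"
    and W_square: "\<And>i. i \<in> {1..N} \<Longrightarrow> integrable M (\<lambda>\<omega>. (norm (W i \<omega>))\<^sup>2)"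
    and mean_X: "\<And>i. i \<in> {1..N} \<Longrightarrow> expectation (X i) = m"
    and mean_W: "\<And>i. i \<in> {1..N} \<Longrightarrow> expectation (W i) = b"
    and spread_X: "\<And>i. i \<in> {1..N} \<Longrightarrow> L2_norm M (\<lambda>\<omega>. X i \<omega> - m) = s"
    and spread_W: "\<And>i. i \<in> {1..N} \<Longrightarrow> L2_norm M (\<lambda>\<omega>. W i \<omega> - b) = v"
begin

text \<open>The centred components.\<close>

definition \<xi> :: "nat \<Rightarrow> 'w \<Rightarrow> real" where "\<xi> i \<omega> = X i \<omega> - m"
definition \<eta> :: "nat \<Rightarrow> 'w \<Rightarrow> 'p" where "\<eta> i \<omega> = W i \<omega> - b"

lemma measurable_fst_snd [measurable]:
  "fst \<in> borel_measurable (borel :: (real \<times> 'p) measure)" "snd \<in> borel_measurable (borel :: (real \<times> 'p) measure)"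
  by (auto intro!: borel_measurable_continuous_onI continuous_intros)

lemma pair_measurable: "i \<in> {1..N} \<Longrightarrow> (\<lambda>\<omega>. (X i \<omega>, W i \<omega>)) \<in> borel_measurable M"
  using indep unfolding indep_vars_def by auto

lemma
  assumes "i \<in> {1..N}"
  shows X_measurable: "X i \<in> borel_measurable M" and W_measurable: "W i \<in> borel_measurable M"
  using measurable_compose[OF pair_measurable[OF assms] measurable_fst_snd(1)]
    measurable_compose[OF pair_measurable[OF assms] measurable_fst_snd(2)] by simp_all

lemma \<xi>_measurable: "i \<in> {1..N} \<Longrightarrow> \<xi> i \<in> borel_measurable M"
  unfolding \<xi>_def by (intro borel_measurable_diff X_measurable) auto

lemma \<eta>_measurable: "i \<in> {1..N} \<Longrightarrow> \<eta> i \<in> borel_measurable M"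
  unfolding \<eta>_def by (intro borel_measurable_diff W_measurable) auto

lemma \<xi>_bound: "\<bar>\<xi> i \<omega>\<bar> \<le> B + \<bar>m\<bar>"
  unfolding \<xi>_def using X_bound[of i \<omega>] by linarith

lemma X_integrable: "i \<in> {1..N} \<Longrightarrow> integrable M (X i)"
  using X_bound X_measurable by (intro integrable_const_bound[where B = B]) auto

lemma \<xi>_integrable: "i \<in> {1..N} \<Longrightarrow> integrable M (\<xi> i)"
  unfolding \<xi>_def using X_integrable by simp

lemma \<xi>_mean: "i \<in> {1..N} \<Longrightarrow> expectation (\<xi> i) = 0"
  unfolding \<xi>_def using X_integrable mean_X by (simp add: prob_space)

lemma W_square_integrable: "i \<in> {1..N} \<Longrightarrow> square_integrable_fun M (W i)"
  using W_square W_measurable by (simp add: square_integrable_fun_def)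

lemma \<eta>_square_integrable:
  assumes "i \<in> {1..N}"
  shows "square_integrable_fun M (\<eta> i)"
proof -
  have "square_integrable_fun M (\<lambda>\<omega>. W i \<omega> + (- b))"
    by (rule square_integrable_add[OF W_square_integrable[OF assms]]) (simp add: square_integrable_fun_def)
  then show ?thesis by (simp add: \<eta>_def[abs_def])
qed

lemma \<eta>_integrable: "i \<in> {1..N} \<Longrightarrow> integrable M (\<eta> i)"
  by (rule square_integrable_fun_imp_integrable[OF \<eta>_square_integrable])

lemma \<eta>_mean: "i \<in> {1..N} \<Longrightarrow> expectation (\<eta> i) = 0"
  unfolding \<eta>_def
  using square_integrable_fun_imp_integrable[OF W_square_integrable] mean_W by (simp add: prob_space)

lemma \<xi>_sq: "i \<in> {1..N} \<Longrightarrow> expectation (\<lambda>\<omega>. (\<xi> i \<omega>)\<^sup>2) = s\<^sup>2"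
  using spread_X[of i] by (auto simp: L2_norm_def \<xi>_def)

lemma \<eta>_sq: "i \<in> {1..N} \<Longrightarrow> expectation (\<lambda>\<omega>. (norm (\<eta> i \<omega>))\<^sup>2) = v\<^sup>2"
  using spread_W[of i] by (auto simp: L2_norm_def \<eta>_def)

lemma s_nonneg: "0 \<le> s"
  using spread_X[of 1] N2 by (auto simp: L2_norm_def)

lemma v_nonneg: "0 \<le> v"
  using spread_W[of 1] N2 by (auto simp: L2_norm_def)

lemma expectation_prod:
  fixes h :: "nat \<Rightarrow> real \<times> 'p \<Rightarrow> real"
  assumes I: "I \<subseteq> {1..N}"
    and h: "\<And>l. l \<in> I \<Longrightarrow> h l \<in> borel_measurable borel"
    and int: "\<And>l. l \<in> I \<Longrightarrow> integrable M (\<lambda>\<omega>. h l (X l \<omega>, W l \<omega>))"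
  shows "expectation (\<lambda>\<omega>. \<Prod>l\<in>I. h l (X l \<omega>, W l \<omega>)) = (\<Prod>l\<in>I. expectation (\<lambda>\<omega>. h l (X l \<omega>, W l \<omega>)))"
proof (rule indep_vars_lebesgue_integral)
  show "finite I" using I finite_subset by blast
  show "indep_vars (\<lambda>_. borel) (\<lambda>l \<omega>. h l (X l \<omega>, W l \<omega>)) I"
    by (rule indep_vars_compose2[OF indep_vars_subset[OF indep I] h])
qed (rule int)

lemma expectation_cross:
  fixes h g :: "real \<times> 'p \<Rightarrow> real"
  assumes "i \<in> {1..N}" "j \<in> {1..N}" "i \<noteq> j"
    and "h \<in> borel_measurable borel" "g \<in> borel_measurable borel"
    and "integrable M (\<lambda>\<omega>. h (X i \<omega>, W i \<omega>))" "integrable M (\<lambda>\<omega>. g (X j \<omega>, W j \<omega>))"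
  shows "expectation (\<lambda>\<omega>. h (X i \<omega>, W i \<omega>) * g (X j \<omega>, W j \<omega>))
    = expectation (\<lambda>\<omega>. h (X i \<omega>, W i \<omega>)) * expectation (\<lambda>\<omega>. g (X j \<omega>, W j \<omega>))"
proof -
  have "expectation (\<lambda>\<omega>. \<Prod>l\<in>{i, j}. (if l = i then h else g) (X l \<omega>, W l \<omega>))
      = (\<Prod>l\<in>{i, j}. expectation (\<lambda>\<omega>. (if l = i then h else g) (X l \<omega>, W l \<omega>)))"
    by (rule expectation_prod) (use assms in \<open>auto split: if_splits\<close>)
  then show ?thesis using assms(3) by simp
qed

lemma \<eta>_component:
  assumes "i \<in> {1..N}"
  shows "integrable M (\<lambda>\<omega>. \<eta> i \<omega> \<bullet> e)" "expectation (\<lambda>\<omega>. \<eta> i \<omega> \<bullet> e) = 0"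
  using \<eta>_integrable[OF assms] \<eta>_mean[OF assms] by simp_all

lemma expectation_\<xi>_\<xi>:
  assumes "i \<in> {1..N}" "j \<in> {1..N}" "i \<noteq> j"
  shows "expectation (\<lambda>\<omega>. \<xi> i \<omega> * \<xi> j \<omega>) = 0"
  using expectation_cross[of i j "\<lambda>p. fst p - m" "\<lambda>p. fst p - m"] assms
    \<xi>_integrable[of i] \<xi>_integrable[of j] \<xi>_mean[of i]
  by (simp add: \<xi>_def[abs_def])

lemma expectation_\<xi>_\<eta>:
  assumes "i \<in> {1..N}" "j \<in> {1..N}" "i \<noteq> j"
  shows "expectation (\<lambda>\<omega>. \<xi> i \<omega> * (\<eta> j \<omega> \<bullet> e)) = 0"
  using expectation_cross[of i j "\<lambda>p. fst p - m" "\<lambda>p. (snd p - b) \<bullet> e"] assms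
    \<xi>_integrable[of i] \<eta>_component[of j e] \<xi>_mean[of i]
  by (simp add: \<xi>_def[abs_def] \<eta>_def[abs_def])

lemma expectation_\<eta>_\<eta>:
  assumes "i \<in> {1..N}" "j \<in> {1..N}" "i \<noteq> j"
  shows "expectation (\<lambda>\<omega>. (\<eta> i \<omega> \<bullet> e) * (\<eta> j \<omega> \<bullet> e)) = 0"
  using expectation_cross[of i j "\<lambda>p. (snd p - b) \<bullet> e" "\<lambda>p. (snd p - b) \<bullet> e"] assms
    \<eta>_component[of i e] \<eta>_component[of j e]
  by (simp add: \<eta>_def[abs_def])

lemma expectation_\<xi>_\<xi>_\<eta>:
  assumes "i \<in> {1..N}" "k \<in> {1..N}" "j \<in> {1..N}" "i \<noteq> j" "k \<noteq> j"
  shows "expectation (\<lambda>\<omega>. \<xi> i \<omega> * \<xi> k \<omega> * (norm (\<eta> j \<omega>))\<^sup>2) = (if i = k then s\<^sup>2 * v\<^sup>2 else 0)"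
proof (cases "i = k")
  case True
  have "integrable M (\<lambda>\<omega>. \<xi> i \<omega> * \<xi> i \<omega>)"
    using integrable_bounded_scaleR[OF \<xi>_integrable \<xi>_measurable \<xi>_bound] assms by simp
  then show ?thesis
    using expectation_cross[of i j "\<lambda>p. (fst p - m)\<^sup>2" "\<lambda>p. (norm (snd p - b))\<^sup>2"] assms
      \<eta>_square_integrable[of j] \<xi>_sq[of i] \<eta>_sq[of j] True
    by (simp add: \<xi>_def[abs_def] \<eta>_def[abs_def] square_integrable_fun_def power2_eq_square)
next
  case False
  have "expectation (\<lambda>\<omega>. \<Prod>l\<in>{i, k, j}. (if l = j then \<lambda>p. (norm (snd p - b))\<^sup>2 else (\<lambda>p. fst p - m)) (X l \<omega>, W l \<omega>))
     = (\<Prod>l\<in>{i, k, j}. expectation (\<lambda>\<omega>. (if l = j then \<lambda>p. (norm (snd p - b))\<^sup>2 else (\<lambda>p. fst p - m)) (X l \<omega>, W l \<omega>)))"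
    using assms \<eta>_square_integrable[of j] \<xi>_integrable[of i] \<xi>_integrable[of k]
    by (intro expectation_prod) (auto simp: \<xi>_def[abs_def] \<eta>_def[abs_def] square_integrable_fun_def)
  then show ?thesis
    using assms False \<xi>_mean[of i] by (simp add: \<xi>_def[abs_def] \<eta>_def[abs_def] mult_ac)
qed

lemma sum_\<xi>_bound:
  assumes "J \<subseteq> {1..N}"
  shows "\<bar>\<Sum>i\<in>J. \<xi> i \<omega>\<bar> \<le> real (card J) * (B + \<bar>m\<bar>)"
  by (rule order_trans[OF sum_abs sum_bounded_above]) (rule \<xi>_bound)

lemma sum_\<xi>_measurable: "J \<subseteq> {1..N} \<Longrightarrow> (\<lambda>\<omega>. \<Sum>i\<in>J. \<xi> i \<omega>) \<in> borel_measurable M"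
  by (intro borel_measurable_sum \<xi>_measurable) auto

lemma L2_sum_\<xi>:
  "square_integrable_fun M (\<lambda>\<omega>. \<Sum>i\<in>{1..N}. \<xi> i \<omega>)"
  "L2_norm M (\<lambda>\<omega>. \<Sum>i\<in>{1..N}. \<xi> i \<omega>) = sqrt (real N) * s"
proof -
  have int: "integrable M (\<lambda>\<omega>. \<xi> i \<omega> * \<xi> k \<omega>)" if "i \<in> {1..N}" "k \<in> {1..N}" for i k
    using integrable_bounded_scaleR[OF \<xi>_integrable[OF that(2)] \<xi>_measurable[OF that(1)] \<xi>_bound] by simp
  have eq: "(norm (\<Sum>i\<in>{1..N}. \<xi> i \<omega>))\<^sup>2 = (\<Sum>i\<in>{1..N}. \<Sum>k\<in>{1..N}. \<xi> i \<omega> * \<xi> k \<omega>)" for \<omega>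
    by (simp add: power2_eq_square sum_product)
  show "square_integrable_fun M (\<lambda>\<omega>. \<Sum>i\<in>{1..N}. \<xi> i \<omega>)"
    unfolding square_integrable_fun_def eq
    by (intro conjI sum_\<xi>_measurable order_refl Bochner_Integration.integrable_sum int)
  have "expectation (\<lambda>\<omega>. (norm (\<Sum>i\<in>{1..N}. \<xi> i \<omega>))\<^sup>2)
      = (\<Sum>i\<in>{1..N}. \<Sum>k\<in>{1..N}. expectation (\<lambda>\<omega>. \<xi> i \<omega> * \<xi> k \<omega>))"
    unfolding eq by (rule integral_double_sum) (rule int)
  also have "\<dots> = (\<Sum>i\<in>{1..N}. \<Sum>k\<in>{1..N}. if i = k then s\<^sup>2 else 0)"
    using \<xi>_sq by (intro sum.cong refl) (auto simp: expectation_\<xi>_\<xi> power2_eq_square)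
  also have "\<dots> = real N * s\<^sup>2" by simp
  finally show "L2_norm M (\<lambda>\<omega>. \<Sum>i\<in>{1..N}. \<xi> i \<omega>) = sqrt (real N) * s"
    using s_nonneg by (simp add: L2_norm_def real_sqrt_mult)
qed

lemma \<eta>_inner_integrable:
  assumes "i \<in> {1..N}" "k \<in> {1..N}"
  shows "integrable M (\<lambda>\<omega>. (\<eta> i \<omega> \<bullet> e) * (\<eta> k \<omega> \<bullet> e))"
proof (rule Bochner_Integration.integrable_bound)
  show "integrable M (\<lambda>\<omega>. ((norm (\<eta> i \<omega>))\<^sup>2 + (norm (\<eta> k \<omega>))\<^sup>2) * (norm e)\<^sup>2)"
    using \<eta>_square_integrable assms by (simp add: square_integrable_fun_def)
  show "(\<lambda>\<omega>. (\<eta> i \<omega> \<bullet> e) * (\<eta> k \<omega> \<bullet> e)) \<in> borel_measurable M"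
    using \<eta>_measurable assms by simp
  show "AE \<omega> in M. norm ((\<eta> i \<omega> \<bullet> e) * (\<eta> k \<omega> \<bullet> e)) \<le> norm (((norm (\<eta> i \<omega>))\<^sup>2 + (norm (\<eta> k \<omega>))\<^sup>2) * (norm e)\<^sup>2)"
  proof (rule AE_I2)
    fix \<omega>
    let ?x = "norm (\<eta> i \<omega>)" and ?y = "norm (\<eta> k \<omega>)"
    have "\<bar>(\<eta> i \<omega> \<bullet> e) * (\<eta> k \<omega> \<bullet> e)\<bar> \<le> (?x * norm e) * (?y * norm e)"
      unfolding abs_mult by (intro mult_mono Cauchy_Schwarz_ineq2) auto
    also have "\<dots> = (?x * ?y) * (norm e)\<^sup>2" by (simp add: power2_eq_square)
    also have "\<dots> \<le> (?x\<^sup>2 + ?y\<^sup>2) * (norm e)\<^sup>2"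
    proof (rule mult_right_mono)
      have "2 * ?x * ?y \<le> ?x\<^sup>2 + ?y\<^sup>2" by (rule sum_squares_bound)
      moreover have "0 \<le> ?x * ?y" by simp
      ultimately show "?x * ?y \<le> ?x\<^sup>2 + ?y\<^sup>2" by linarith
    qed simp
    finally show "norm ((\<eta> i \<omega> \<bullet> e) * (\<eta> k \<omega> \<bullet> e)) \<le> norm ((?x\<^sup>2 + ?y\<^sup>2) * (norm e)\<^sup>2)"
      by simp
  qed
qed

lemma L2_sum_\<eta>:
  "square_integrable_fun M (\<lambda>\<omega>. \<Sum>i\<in>{1..N}. \<eta> i \<omega>)"
  "L2_norm M (\<lambda>\<omega>. \<Sum>i\<in>{1..N}. \<eta> i \<omega>) = sqrt (real N) * v"
proof -
  have inner_eq: "\<eta> i \<omega> \<bullet> \<eta> k \<omega> = (\<Sum>e\<in>Basis. (\<eta> i \<omega> \<bullet> e) * (\<eta> k \<omega> \<bullet> e))" for i k \<omega>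
    by (rule euclidean_inner)
  have int: "integrable M (\<lambda>\<omega>. \<eta> i \<omega> \<bullet> \<eta> k \<omega>)" if "i \<in> {1..N}" "k \<in> {1..N}" for i k
    unfolding inner_eq by (intro Bochner_Integration.integrable_sum \<eta>_inner_integrable that)
  have eq: "(norm (\<Sum>i\<in>{1..N}. \<eta> i \<omega>))\<^sup>2 = (\<Sum>i\<in>{1..N}. \<Sum>k\<in>{1..N}. \<eta> i \<omega> \<bullet> \<eta> k \<omega>)" for \<omega>
    by (simp only: power2_norm_eq_inner inner_sum_left) (simp only: inner_sum_right)
  have meas: "(\<lambda>\<omega>. \<Sum>i\<in>{1..N}. \<eta> i \<omega>) \<in> borel_measurable M"
    by (intro borel_measurable_sum \<eta>_measurable)
  show "square_integrable_fun M (\<lambda>\<omega>. \<Sum>i\<in>{1..N}. \<eta> i \<omega>)"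
    unfolding square_integrable_fun_def eq
    by (intro conjI meas Bochner_Integration.integrable_sum int)
  have "expectation (\<lambda>\<omega>. (norm (\<Sum>i\<in>{1..N}. \<eta> i \<omega>))\<^sup>2)
      = (\<Sum>i\<in>{1..N}. \<Sum>k\<in>{1..N}. expectation (\<lambda>\<omega>. \<eta> i \<omega> \<bullet> \<eta> k \<omega>))"
    unfolding eq by (rule integral_double_sum) (rule int)
  also have "\<dots> = (\<Sum>i\<in>{1..N}. \<Sum>k\<in>{1..N}. if i = k then v\<^sup>2 else 0)"
  proof (intro sum.cong refl)
    fix i k assume ik: "i \<in> {1..N}" "k \<in> {1..N}"
    show "expectation (\<lambda>\<omega>. \<eta> i \<omega> \<bullet> \<eta> k \<omega>) = (if i = k then v\<^sup>2 else 0)"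
    proof (cases "i = k")
      case True
      then show ?thesis using \<eta>_sq[OF ik(1)] by (simp add: power2_norm_eq_inner)
    next
      case False
      then show ?thesis
        unfolding inner_eq using ik
        by (subst Bochner_Integration.integral_sum) (auto intro!: \<eta>_inner_integrable simp: expectation_\<eta>_\<eta>)
    qed
  qed
  also have "\<dots> = real N * v\<^sup>2" by simp
  finally show "L2_norm M (\<lambda>\<omega>. \<Sum>i\<in>{1..N}. \<eta> i \<omega>) = sqrt (real N) * v"
    using v_nonneg by (simp add: L2_norm_def real_sqrt_mult)
qed

text \<open>The degenerate terms of the decomposition, grouped by the index of \<open>\<eta>\<close>.\<close>

definition cross :: "nat \<Rightarrow> 'w \<Rightarrow> 'p" where
  "cross j \<omega> = (\<Sum>i\<in>{1..N} - {j}. \<xi> i \<omega>) *\<^sub>R \<eta> j \<omega>"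

lemma cross_integrable: "j \<in> {1..N} \<Longrightarrow> integrable M (cross j)"
  unfolding cross_def
  by (intro integrable_bounded_scaleR[OF \<eta>_integrable sum_\<xi>_measurable sum_\<xi>_bound]) auto

lemma cross_mean:
  assumes "j \<in> {1..N}"
  shows "expectation (cross j) = 0"
proof (rule integral_euclidean_eq_0[OF cross_integrable[OF assms]])
  fix e :: 'p
  have "expectation (\<lambda>\<omega>. cross j \<omega> \<bullet> e) = expectation (\<lambda>\<omega>. \<Sum>i\<in>{1..N} - {j}. \<xi> i \<omega> * (\<eta> j \<omega> \<bullet> e))"
    by (simp add: cross_def sum_distrib_right)
  also have "\<dots> = (\<Sum>i\<in>{1..N} - {j}. expectation (\<lambda>\<omega>. \<xi> i \<omega> * (\<eta> j \<omega> \<bullet> e)))"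
    using integrable_bounded_scaleR[OF \<eta>_component(1)[OF assms] \<xi>_measurable \<xi>_bound]
    by (intro Bochner_Integration.integral_sum) auto
  also have "\<dots> = 0" using assms by (intro sum.neutral) (auto simp: expectation_\<xi>_\<eta>)
  finally show "expectation (\<lambda>\<omega>. cross j \<omega> \<bullet> e) = 0" .
qed

lemma cross_square:
  assumes j: "j \<in> {1..N}"
  shows "integrable M (\<lambda>\<omega>. (norm (cross j \<omega>))\<^sup>2)"
    and "expectation (\<lambda>\<omega>. (norm (cross j \<omega>))\<^sup>2) = real (N - 1) * (s\<^sup>2 * v\<^sup>2)"
proof -
  let ?J = "{1..N} - {j}"
  have int: "integrable M (\<lambda>\<omega>. \<xi> i \<omega> * \<xi> k \<omega> * (norm (\<eta> j \<omega>))\<^sup>2)" if "i \<in> ?J" "k \<in> ?J" for i k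
  proof -
    have sq: "integrable M (\<lambda>\<omega>. (norm (\<eta> j \<omega>))\<^sup>2)"
      using \<eta>_square_integrable[OF j] by (simp add: square_integrable_fun_def)
    have "integrable M (\<lambda>\<omega>. \<xi> k \<omega> *\<^sub>R (norm (\<eta> j \<omega>))\<^sup>2)"
      using that by (intro integrable_bounded_scaleR[OF sq \<xi>_measurable \<xi>_bound]) auto
    from integrable_bounded_scaleR[OF this \<xi>_measurable \<xi>_bound, of i] that(1)
    show ?thesis by (simp add: mult.assoc)
  qed
  have eq: "(norm (cross j \<omega>))\<^sup>2 = (\<Sum>i\<in>?J. \<Sum>k\<in>?J. \<xi> i \<omega> * \<xi> k \<omega> * (norm (\<eta> j \<omega>))\<^sup>2)" for \<omega>
  proof -
    have "(norm (cross j \<omega>))\<^sup>2 = (\<Sum>i\<in>?J. \<xi> i \<omega>)\<^sup>2 * (norm (\<eta> j \<omega>))\<^sup>2"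
      by (simp add: cross_def power_mult_distrib)
    then show ?thesis
      by (simp only: power2_eq_square[of "\<Sum>i\<in>?J. \<xi> i \<omega>"] sum_product) (simp only: sum_distrib_right)
  qed
  show "integrable M (\<lambda>\<omega>. (norm (cross j \<omega>))\<^sup>2)"
    unfolding eq by (intro Bochner_Integration.integrable_sum int)
  have "expectation (\<lambda>\<omega>. (norm (cross j \<omega>))\<^sup>2)
      = (\<Sum>i\<in>?J. \<Sum>k\<in>?J. expectation (\<lambda>\<omega>. \<xi> i \<omega> * \<xi> k \<omega> * (norm (\<eta> j \<omega>))\<^sup>2))"
    unfolding eq by (rule integral_double_sum) (rule int)
  also have "\<dots> = (\<Sum>i\<in>?J. \<Sum>k\<in>?J. if i = k then s\<^sup>2 * v\<^sup>2 else 0)"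
    using j by (intro sum.cong refl expectation_\<xi>_\<xi>_\<eta>) auto
  also have "\<dots> = real (N - 1) * (s\<^sup>2 * v\<^sup>2)" using j by simp
  finally show "expectation (\<lambda>\<omega>. (norm (cross j \<omega>))\<^sup>2) = real (N - 1) * (s\<^sup>2 * v\<^sup>2)" .
qed

lemma cross_measurable: "j \<in> {1..N} \<Longrightarrow> cross j \<in> borel_measurable M"
  by (rule borel_measurable_integrable[OF cross_integrable])

lemma L2_sum_cross:
  "square_integrable_fun M (\<lambda>\<omega>. \<Sum>j\<in>{1..N}. cross j \<omega>)"
  "L2_norm M (\<lambda>\<omega>. \<Sum>j\<in>{1..N}. cross j \<omega>) \<le> real N * sqrt (real N - 1) * (s * v)"
proof -
  have meas: "(\<lambda>\<omega>. \<Sum>j\<in>{1..N}. cross j \<omega>) \<in> borel_measurable M"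
    by (intro borel_measurable_sum cross_measurable)
  \<comment> \<open>The Cauchy-Schwarz inequality loses a factor of order \<open>N\<close>; the resulting order \<open>1 / sqrt N\<close> of the degenerate part is enough.\<close>
  have ptw: "(norm (\<Sum>j\<in>{1..N}. cross j \<omega>))\<^sup>2 \<le> real N * (\<Sum>j\<in>{1..N}. (norm (cross j \<omega>))\<^sup>2)" for \<omega>
  proof -
    have "(norm (\<Sum>j\<in>{1..N}. cross j \<omega>))\<^sup>2 \<le> (\<Sum>j\<in>{1..N}. norm (cross j \<omega>))\<^sup>2"
      by (intro power_mono norm_sum) simp
    also have "\<dots> \<le> real N * (\<Sum>j\<in>{1..N}. (norm (cross j \<omega>))\<^sup>2)"
      using Cauchy_Schwarz_ineq_sum[of "\<lambda>_. 1" "\<lambda>j. norm (cross j \<omega>)" "{1..N}"] by simp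
    finally show ?thesis .
  qed
  have maj: "integrable M (\<lambda>\<omega>. real N * (\<Sum>j\<in>{1..N}. (norm (cross j \<omega>))\<^sup>2))"
    by (intro integrable_mult_right Bochner_Integration.integrable_sum cross_square)
  have int: "integrable M (\<lambda>\<omega>. (norm (\<Sum>j\<in>{1..N}. cross j \<omega>))\<^sup>2)"
  proof (rule Bochner_Integration.integrable_bound[OF maj])
    show "(\<lambda>\<omega>. (norm (\<Sum>j\<in>{1..N}. cross j \<omega>))\<^sup>2) \<in> borel_measurable M" using meas by simp
    show "AE \<omega> in M. norm ((norm (\<Sum>j\<in>{1..N}. cross j \<omega>))\<^sup>2) \<le> norm (real N * (\<Sum>j\<in>{1..N}. (norm (cross j \<omega>))\<^sup>2))"
      using ptw by (intro AE_I2) (simp add: sum_nonneg)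
  qed
  show "square_integrable_fun M (\<lambda>\<omega>. \<Sum>j\<in>{1..N}. cross j \<omega>)"
    using meas int by (simp add: square_integrable_fun_def)
  have "expectation (\<lambda>\<omega>. (norm (\<Sum>j\<in>{1..N}. cross j \<omega>))\<^sup>2)
      \<le> expectation (\<lambda>\<omega>. real N * (\<Sum>j\<in>{1..N}. (norm (cross j \<omega>))\<^sup>2))"
    by (rule integral_mono[OF int maj ptw])
  also have "\<dots> = real N * (\<Sum>j\<in>{1..N}. expectation (\<lambda>\<omega>. (norm (cross j \<omega>))\<^sup>2))"
    by (simp add: Bochner_Integration.integral_sum cross_square)
  also have "\<dots> = real N * (real N * ((real N - 1) * (s\<^sup>2 * v\<^sup>2)))"
    using N2 by (simp add: cross_square of_nat_diff)
  also have "\<dots> = (real N * sqrt (real N - 1) * (s * v))\<^sup>2"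
    using N2 by (simp add: power_mult_distrib power2_eq_square[of "real N"])
  finally show "L2_norm M (\<lambda>\<omega>. \<Sum>j\<in>{1..N}. cross j \<omega>) \<le> real N * sqrt (real N - 1) * (s * v)"
    unfolding L2_norm_def using N2 s_nonneg v_nonneg by (intro real_le_lsqrt) auto
qed

text \<open>The crossed U-statistic, with the deterministic offset \<open>c\<close> in the role of the observed moment.\<close>

definition estimator :: "real \<Rightarrow> 'w \<Rightarrow> 'p" where
  "estimator c \<omega> = (1 / (real N * (real N - 1))) *\<^sub>R
     (\<Sum>j\<in>{1..N}. (\<Sum>i\<in>{1..N} - {j}. X i \<omega> - c) *\<^sub>R W j \<omega>)"

text \<open>Hoeffding decomposition of the estimator around its mean \<open>(m - c) b\<close>.\<close>

lemma hoeffding_decomposition: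
  "estimator c \<omega> - (m - c) *\<^sub>R b =
     (1 / real N) *\<^sub>R ((\<Sum>i\<in>{1..N}. \<xi> i \<omega>) *\<^sub>R b) +
     (((m - c) / real N) *\<^sub>R (\<Sum>j\<in>{1..N}. \<eta> j \<omega>) +
      (1 / (real N * (real N - 1))) *\<^sub>R (\<Sum>j\<in>{1..N}. cross j \<omega>))"
proof -
  define S where "S = (\<Sum>i\<in>{1..N}. \<xi> i \<omega>)"
  define E where "E = (\<Sum>j\<in>{1..N}. \<eta> j \<omega>)"
  define n where "n = real N"
  have n: "n \<noteq> 0" "n - 1 \<noteq> 0" using N2 by (auto simp: n_def)
  have row: "(\<Sum>i\<in>{1..N} - {j}. X i \<omega> - c) = (\<Sum>i\<in>{1..N} - {j}. \<xi> i \<omega>) + (n - 1) * (m - c)"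
    if "j \<in> {1..N}" for j
  proof -
    have "(\<Sum>i\<in>{1..N} - {j}. X i \<omega> - c) = (\<Sum>i\<in>{1..N} - {j}. \<xi> i \<omega> + (m - c))"
      by (simp add: \<xi>_def)
    also have "\<dots> = (\<Sum>i\<in>{1..N} - {j}. \<xi> i \<omega>) + (n - 1) * (m - c)"
      using that N2 by (simp add: sum.distrib n_def of_nat_diff)
    finally show ?thesis .
  qed
  have rest: "(\<Sum>j\<in>{1..N}. \<Sum>i\<in>{1..N} - {j}. \<xi> i \<omega>) = (n - 1) * S"
  proof -
    have "(\<Sum>j\<in>{1..N}. \<Sum>i\<in>{1..N} - {j}. \<xi> i \<omega>) = (\<Sum>j\<in>{1..N}. S - \<xi> j \<omega>)"
      by (intro sum.cong refl) (simp add: S_def sum_diff1)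
    also have "\<dots> = n * S - S" by (simp add: sum_subtractf n_def S_def)
    finally show ?thesis by (simp add: algebra_simps)
  qed
  have "(\<Sum>j\<in>{1..N}. (\<Sum>i\<in>{1..N} - {j}. X i \<omega> - c) *\<^sub>R W j \<omega>)
      = (\<Sum>j\<in>{1..N}. cross j \<omega> + (\<Sum>i\<in>{1..N} - {j}. \<xi> i \<omega>) *\<^sub>R b
          + ((n - 1) * (m - c)) *\<^sub>R \<eta> j \<omega> + ((n - 1) * (m - c)) *\<^sub>R b)"
  proof (intro sum.cong refl)
    fix j assume j: "j \<in> {1..N}"
    show "(\<Sum>i\<in>{1..N} - {j}. X i \<omega> - c) *\<^sub>R W j \<omega> = cross j \<omega> + (\<Sum>i\<in>{1..N} - {j}. \<xi> i \<omega>) *\<^sub>R b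
        + ((n - 1) * (m - c)) *\<^sub>R \<eta> j \<omega> + ((n - 1) * (m - c)) *\<^sub>R b"
      unfolding row[OF j] by (simp add: cross_def \<eta>_def scaleR_add_left scaleR_diff_right)
  qed
  also have "\<dots> = (\<Sum>j\<in>{1..N}. cross j \<omega>) + ((n - 1) * S) *\<^sub>R b
      + ((n - 1) * (m - c)) *\<^sub>R E + (n * ((n - 1) * (m - c))) *\<^sub>R b"
    by (simp only: sum.distrib scaleR_sum_left[symmetric] scaleR_sum_right[symmetric] rest E_def[symmetric])
      (simp add: n_def)
  finally have "estimator c \<omega> = (1 / (n * (n - 1))) *\<^sub>R ((\<Sum>j\<in>{1..N}. cross j \<omega>) + ((n - 1) * S) *\<^sub>R b
      + ((n - 1) * (m - c)) *\<^sub>R E + (n * ((n - 1) * (m - c))) *\<^sub>R b)"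
    by (simp add: estimator_def n_def)
  also have "\<dots> = (1 / (n * (n - 1))) *\<^sub>R (\<Sum>j\<in>{1..N}. cross j \<omega>) + (1 / n) *\<^sub>R (S *\<^sub>R b)
      + ((m - c) / n) *\<^sub>R E + (m - c) *\<^sub>R b"
    using n by (simp add: scaleR_add_right)
  finally show ?thesis by (simp add: S_def E_def n_def)
qed

theorem crossed_estimator_bound:
  shows estimator_integrable: "integrable M (estimator c)"
    and estimator_mean: "expectation (estimator c) = (m - c) *\<^sub>R b"
    and estimator_square: "integrable M (\<lambda>\<omega>. (norm (estimator c \<omega> - (m - c) *\<^sub>R b))\<^sup>2)"
    and estimator_spread: "L2_norm M (\<lambda>\<omega>. estimator c \<omega> - (m - c) *\<^sub>R b)
      \<le> (s * norm b + \<bar>m - c\<bar> * v) / sqrt (real N) + s * v / sqrt (real N - 1)"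
proof -
  let ?A = "\<lambda>\<omega>. (1 / real N) *\<^sub>R ((\<Sum>i\<in>{1..N}. \<xi> i \<omega>) *\<^sub>R b)"
  let ?E = "\<lambda>\<omega>. ((m - c) / real N) *\<^sub>R (\<Sum>j\<in>{1..N}. \<eta> j \<omega>)"
  let ?C = "\<lambda>\<omega>. (1 / (real N * (real N - 1))) *\<^sub>R (\<Sum>j\<in>{1..N}. cross j \<omega>)"
  have N1: "1 < real N" "0 < real N - 1" using N2 by auto
  have sS: "square_integrable_fun M (\<lambda>\<omega>. (\<Sum>i\<in>{1..N}. \<xi> i \<omega>) *\<^sub>R b)"
    using L2_sum_\<xi>(1) unfolding square_integrable_fun_def
    by (auto simp: power_mult_distrib intro!: borel_measurable_scaleR)
  have sA: "square_integrable_fun M ?A" by (rule square_integrable_fun_scaleR[OF sS])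
  have sE: "square_integrable_fun M ?E" by (rule square_integrable_fun_scaleR[OF L2_sum_\<eta>(1)])
  have sC: "square_integrable_fun M ?C" by (rule square_integrable_fun_scaleR[OF L2_sum_cross(1)])
  note sEC = square_integrable_add[OF sE sC]
  have dec: "(\<lambda>\<omega>. estimator c \<omega> - (m - c) *\<^sub>R b) = (\<lambda>\<omega>. ?A \<omega> + (?E \<omega> + ?C \<omega>))"
    by (rule ext) (rule hoeffding_decomposition)
  have sq: "square_integrable_fun M (\<lambda>\<omega>. estimator c \<omega> - (m - c) *\<^sub>R b)"
    unfolding dec by (rule square_integrable_add[OF sA sEC])
  then show "integrable M (\<lambda>\<omega>. (norm (estimator c \<omega> - (m - c) *\<^sub>R b))\<^sup>2)"
    by (simp add: square_integrable_fun_def)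
  note int = square_integrable_fun_imp_integrable[OF sq]
  have est: "estimator c = (\<lambda>\<omega>. (estimator c \<omega> - (m - c) *\<^sub>R b) + (m - c) *\<^sub>R b)" by simp
  show "integrable M (estimator c)"
    by (subst est) (intro Bochner_Integration.integrable_add int, simp)
  have "expectation (\<lambda>\<omega>. \<Sum>i\<in>{1..N}. \<xi> i \<omega>) = 0"
    by (subst Bochner_Integration.integral_sum) (auto intro!: \<xi>_integrable simp: \<xi>_mean)
  then have mA: "expectation ?A = 0"
    using square_integrable_fun_imp_integrable[OF L2_sum_\<xi>(1)] by simp
  have "expectation (\<lambda>\<omega>. \<Sum>j\<in>{1..N}. \<eta> j \<omega>) = 0"
    by (subst Bochner_Integration.integral_sum) (auto intro!: \<eta>_integrable simp: \<eta>_mean)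
  then have mE: "expectation ?E = 0" by simp
  have "expectation (\<lambda>\<omega>. \<Sum>j\<in>{1..N}. cross j \<omega>) = 0"
    by (subst Bochner_Integration.integral_sum) (auto intro!: cross_integrable simp: cross_mean)
  then have mC: "expectation ?C = 0" by simp
  have "expectation (\<lambda>\<omega>. estimator c \<omega> - (m - c) *\<^sub>R b) = expectation ?A + (expectation ?E + expectation ?C)"
    unfolding dec
      Bochner_Integration.integral_add[OF sA[THEN square_integrable_fun_imp_integrable] sEC[THEN square_integrable_fun_imp_integrable]]
      Bochner_Integration.integral_add[OF sE[THEN square_integrable_fun_imp_integrable] sC[THEN square_integrable_fun_imp_integrable]] ..
  then have zero: "expectation (\<lambda>\<omega>. estimator c \<omega> - (m - c) *\<^sub>R b) = 0" by (simp only: mA mE mC) simp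
  have "expectation (estimator c) = expectation (\<lambda>\<omega>. estimator c \<omega> - (m - c) *\<^sub>R b) + expectation (\<lambda>\<omega>. (m - c) *\<^sub>R b)"
    by (subst est) (rule Bochner_Integration.integral_add[OF int], simp)
  then show "expectation (estimator c) = (m - c) *\<^sub>R b" by (simp add: zero prob_space)
  have root: "sqrt (real N) / real N = 1 / sqrt (real N)" "sqrt (real N - 1) / (real N - 1) = 1 / sqrt (real N - 1)"
    using N1 by (simp_all add: real_div_sqrt divide_simps)
  have lA: "L2_norm M ?A = s * norm b / sqrt (real N)"
  proof -
    have "L2_norm M (\<lambda>\<omega>. (\<Sum>i\<in>{1..N}. \<xi> i \<omega>) *\<^sub>R b) = norm b * L2_norm M (\<lambda>\<omega>. \<Sum>i\<in>{1..N}. \<xi> i \<omega>)"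
      by (simp add: L2_norm_def power_mult_distrib real_sqrt_mult)
    then show ?thesis
      unfolding L2_norm_scaleR L2_sum_\<xi>(2) using N1 root(1) by (simp add: field_simps)
  qed
  have lE: "L2_norm M ?E = \<bar>m - c\<bar> * v / sqrt (real N)"
    unfolding L2_norm_scaleR L2_sum_\<eta>(2) using N1 root(1) by (simp add: field_simps)
  have lC: "L2_norm M ?C \<le> s * v / sqrt (real N - 1)"
  proof -
    have "L2_norm M ?C \<le> (1 / (real N * (real N - 1))) * (real N * sqrt (real N - 1) * (s * v))"
      unfolding L2_norm_scaleR using N1 by (intro mult_mono L2_sum_cross(2)) (auto simp: L2_norm_def)
    also have "\<dots> = (sqrt (real N - 1) / (real N - 1)) * (s * v)" using N1 by simp
    also have "\<dots> = s * v / sqrt (real N - 1)" unfolding root(2) by simp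
    finally show ?thesis .
  qed
  have "L2_norm M (\<lambda>\<omega>. estimator c \<omega> - (m - c) *\<^sub>R b) \<le> L2_norm M ?A + (L2_norm M ?E + L2_norm M ?C)"
    unfolding dec by (intro order_trans[OF L2_norm_add[OF sA sEC]] add_left_mono L2_norm_add[OF sE sC])
  also have "\<dots> \<le> s * norm b / sqrt (real N) + (\<bar>m - c\<bar> * v / sqrt (real N) + s * v / sqrt (real N - 1))"
    using lC by (simp only: lA lE add_left_mono)
  finally show "L2_norm M (\<lambda>\<omega>. estimator c \<omega> - (m - c) *\<^sub>R b)
      \<le> (s * norm b + \<bar>m - c\<bar> * v) / sqrt (real N) + s * v / sqrt (real N - 1)"
    by (simp add: add_divide_distrib)
qed

end

lemma (in prob_space) expectation_centred_square:
  fixes h :: "'a \<Rightarrow> 'b::euclidean_space"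
  assumes h: "square_integrable_fun M h"
  shows "expectation (\<lambda>x. (norm (h x - expectation h))\<^sup>2)
    = expectation (\<lambda>x. (norm (h x))\<^sup>2) - (norm (expectation h))\<^sup>2"
proof -
  let ?c = "expectation h"
  have int: "integrable M h" by (rule square_integrable_fun_imp_integrable[OF h])
  have sq: "integrable M (\<lambda>x. (norm (h x))\<^sup>2)" using h by (simp add: square_integrable_fun_def)
  have eq: "(norm (h x - ?c))\<^sup>2 = (norm (h x))\<^sup>2 - (2 * (h x \<bullet> ?c) - (norm ?c)\<^sup>2)" for x
    by (simp add: power2_norm_eq_inner inner_diff_left inner_diff_right inner_commute)
  have "expectation (\<lambda>x. (norm (h x - ?c))\<^sup>2)
      = expectation (\<lambda>x. (norm (h x))\<^sup>2) - expectation (\<lambda>x. 2 * (h x \<bullet> ?c) - (norm ?c)\<^sup>2)"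
    unfolding eq by (rule Bochner_Integration.integral_diff[OF sq]) (use int in simp)
  also have "expectation (\<lambda>x. 2 * (h x \<bullet> ?c) - (norm ?c)\<^sup>2) = 2 * (?c \<bullet> ?c) - (norm ?c)\<^sup>2"
    using int by (simp add: prob_space)
  finally show ?thesis by (simp add: power2_norm_eq_inner)
qed

section \<open>Growth of the constants\<close>

lemma Sigma_const_sq_bigtheta:
  assumes "0 < L" "0 < c"
  shows "(\<lambda>s. (Sigma_const L c s)\<^sup>2) \<in> \<Theta>(\<lambda>s. exp (2 * L * s))"
proof -
  have "(\<lambda>s. (c * ((exp (L * s) - 1) / L))\<^sup>2) \<in> \<Theta>(\<lambda>s. exp (2 * L * s))"
    using assms by real_asymp
  then show ?thesis using assms(1) by (simp add: Sigma_const_def)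
qed

lemma Gamma_sq_bigomega:
  assumes "0 < L" "0 < c" "0 < C2" "0 < K"
  shows "(\<lambda>s. K * Gamma_sq L c Lh Mh C2 s) \<in> \<Omega>(\<lambda>s. exp (2 * L * s))"
proof -
  have "(\<lambda>s. (Sigma_const L c s)\<^sup>2) \<in> O(\<lambda>s. K * Gamma_sq L c Lh Mh C2 s)"
  proof (rule bigoI[where c = "1 / (2 * K * C2)"], intro always_eventually allI)
    fix s
    have "2 * C2 * (Sigma_const L c s)\<^sup>2 \<le> Gamma_sq L c Lh Mh C2 s"
      by (simp add: Gamma_sq_def)
    then have "K * (2 * C2 * (Sigma_const L c s)\<^sup>2) \<le> K * Gamma_sq L c Lh Mh C2 s"
      using assms by (intro mult_left_mono) auto
    then have "(Sigma_const L c s)\<^sup>2 \<le> 1 / (2 * K * C2) * (K * Gamma_sq L c Lh Mh C2 s)"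
      using assms by (simp add: field_simps)
    also have "\<dots> \<le> 1 / (2 * K * C2) * \<bar>K * Gamma_sq L c Lh Mh C2 s\<bar>"
      using assms by (intro mult_left_mono abs_ge_self) auto
    finally show "norm ((Sigma_const L c s)\<^sup>2) \<le> 1 / (2 * K * C2) * norm (K * Gamma_sq L c Lh Mh C2 s)"
      by simp
  qed
  moreover have "(\<lambda>s. exp (2 * L * s)) \<in> O(\<lambda>s. (Sigma_const L c s)\<^sup>2)"
    using Sigma_const_sq_bigtheta[OF assms(1,2)] by (simp add: bigtheta_def bigomega_iff_bigo)
  ultimately show ?thesis
    unfolding bigomega_iff_bigo by (rule landau_o.big_trans[rotated])
qed

lemma Gamma_sq_bigo:
  assumes "0 < L"
  shows "(\<lambda>s. K * Gamma_sq L c Lh Mh C2 s) \<in> O(\<lambda>s. s\<^sup>2 * exp (2 * L * s))"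
proof -
  have "(\<lambda>s. (exp (L * s) - 1) / L) \<in> O(\<lambda>s. exp (L * s))"
    using assms by real_asymp
  then have S: "(\<lambda>s. Sigma_const L c s) \<in> O(\<lambda>s. exp (L * s))"
    using assms by (cases "c = 0") (simp_all add: Sigma_const_def)
  have one: "(\<lambda>s. 1) \<in> O(\<lambda>s. exp (L * s))" using assms by real_asymp
  have const: "(\<lambda>s. Mh) \<in> O(\<lambda>s. exp (L * s))"
    using landau_o.big.cmult_in_iff'[of Mh] one by (cases "Mh = 0") (auto intro: landau_o.big_trans[OF bigo_const])
  have "(\<lambda>s. Lh * Sigma_const L c s) \<in> O(\<lambda>s. exp (L * s))"
    using S by (cases "Lh = 0") simp_all
  then have "(\<lambda>s. Mh + Lh * Sigma_const L c s) \<in> O(\<lambda>s. exp (L * s))"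
    by (intro sum_in_bigo const)
  from landau_o.big_power[OF landau_o.big.mult[OF this landau_o.big_refl[of "\<lambda>s. s"]], of 2]
  have Cr: "(\<lambda>s. (Cr_const L c Lh Mh s)\<^sup>2) \<in> O(\<lambda>s. s\<^sup>2 * exp (2 * L * s))"
    by (simp add: Cr_const_def power_mult_distrib mult_ac flip: exp_double)
  have "(\<lambda>s. (Sigma_const L c s)\<^sup>2) \<in> O(\<lambda>s. (exp (L * s))\<^sup>2)"
    by (rule landau_o.big_power[OF S])
  also have "(\<lambda>s. (exp (L * s))\<^sup>2) \<in> O(\<lambda>s. s\<^sup>2 * exp (2 * L * s))"
    using assms by real_asymp
  finally have S2: "(\<lambda>s. (Sigma_const L c s)\<^sup>2) \<in> O(\<lambda>s. s\<^sup>2 * exp (2 * L * s))" .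
  have "(\<lambda>s. 2 * (Cr_const L c Lh Mh s)\<^sup>2) \<in> O(\<lambda>s. s\<^sup>2 * exp (2 * L * s))"
    using Cr by simp
  moreover have "(\<lambda>s. 2 * C2 * (Sigma_const L c s)\<^sup>2) \<in> O(\<lambda>s. s\<^sup>2 * exp (2 * L * s))"
    using S2 by (cases "C2 = 0") simp_all
  ultimately have "(\<lambda>s. Gamma_sq L c Lh Mh C2 s) \<in> O(\<lambda>s. s\<^sup>2 * exp (2 * L * s))"
    unfolding Gamma_sq_def by (rule sum_in_bigo)
  then show ?thesis by (cases "K = 0") simp_all
qed

section \<open>The flow, its reversal and the divergence\<close>

text \<open>A choice of the continuous derivative whose existence \<open>C1_on\<close> asserts.\<close>

definition C1_derivative :: "('a::real_normed_vector \<Rightarrow> 'b::real_normed_vector) \<Rightarrow> 'a set \<Rightarrow> 'a \<Rightarrow> ('a \<Rightarrow>\<^sub>L 'b)" where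
  "C1_derivative F S = (SOME F'. (\<forall>x\<in>S. (F has_derivative blinfun_apply (F' x)) (at x within S)) \<and> continuous_on S F')"

lemma
  assumes "C1_on F S"
  shows C1_derivative: "x \<in> S \<Longrightarrow> (F has_derivative blinfun_apply (C1_derivative F S x)) (at x within S)"
    and continuous_on_C1_derivative: "continuous_on S (C1_derivative F S)"
proof -
  have "(\<forall>x\<in>S. (F has_derivative blinfun_apply (C1_derivative F S x)) (at x within S))
      \<and> continuous_on S (C1_derivative F S)"
    unfolding C1_derivative_def using assms unfolding C1_on_def by (rule someI_ex)
  then show "x \<in> S \<Longrightarrow> (F has_derivative blinfun_apply (C1_derivative F S x)) (at x within S)"
    and "continuous_on S (C1_derivative F S)" by auto
qed

lemma sup_over_upper:
  assumes "bounded_over T A F" "t \<in> {0..T}" "a \<in> A"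
  shows "F q t a \<le> sup_over T A F"
proof -
  have "(\<lambda>(q, t, a). F q t a) (q, t, a) \<le> sup_over T A F"
    unfolding sup_over_def
    by (rule cSUP_upper) (use assms in \<open>auto simp: bounded_over_def\<close>)
  then show ?thesis by simp
qed

lemma has_derivative_slice_fst:
  assumes "(F has_derivative D) (at (x, b))"
  shows "((\<lambda>x. F (x, b)) has_derivative (\<lambda>v. D (v, 0))) (at x)"
  by (rule has_derivative_compose[where g = F and g' = D]) (auto intro!: derivative_eq_intros assms)

lemma has_derivative_slice_snd:
  assumes "(F has_derivative D) (at (x, b))"
  shows "((\<lambda>b. F (x, b)) has_derivative (\<lambda>w. D (0, w))) (at b)"
  by (rule has_derivative_compose[where g = F and g' = D]) (auto intro!: derivative_eq_intros assms)

context liouville_setting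
begin

text \<open>Short names for the suprema that enter the constants of the setting.\<close>

abbreviation "LR \<equiv> sup_over T A (norm_dq_R R)"
abbreviation "MR \<equiv> sup_over T A (norm_da_R R)"
abbreviation "Lh \<equiv> sup_over T A (norm_dq_h R)"
abbreviation "Mh \<equiv> sup_over T A (norm_da_h R)"

text \<open>The derivative of the field in state and parameter at fixed time, cut out of its derivative in all
  three variables.\<close>

definition DF :: "real \<Rightarrow> ('x \<times> 'y) \<times> 'p \<Rightarrow> (('x \<times> 'y) \<times> 'p) \<Rightarrow>\<^sub>L ('x \<times> 'y)" where
  "DF t z = C1_derivative (\<lambda>(q, t, a). R q t a) (UNIV \<times> {0..T} \<times> A) (fst z, t, snd z) o\<^sub>L
     ((blinfun_inl o\<^sub>L fst_blinfun) + (blinfun_inr o\<^sub>L (blinfun_inr o\<^sub>L snd_blinfun)))"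

lemma at_within_parameters: "a \<in> A \<Longrightarrow> at (q, a) within UNIV \<times> A = at (q, a)"
  by (rule at_within_open) (auto intro: open_Times open_parameters)

lemma field_deriv:
  assumes t: "t \<in> {0..T}" and a: "a \<in> A"
  shows "((\<lambda>(x, b). R x t b) has_derivative blinfun_apply (DF t (q, a))) (at (q, a))"
proof -
  let ?S = "UNIV \<times> {0..T} \<times> A"
  let ?j = "\<lambda>z :: ('x \<times> 'y) \<times> 'p. (fst z, t, snd z)"
  have "((\<lambda>z. (\<lambda>(q, t, a). R q t a) (?j z)) has_derivative
      (\<lambda>z. C1_derivative (\<lambda>(q, t, a). R q t a) ?S (?j (q, a)) (fst z, 0, snd z))) (at (q, a) within UNIV \<times> A)"
  proof (rule has_derivative_in_compose2[OF C1_derivative[OF field_C1]])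
    show "?j ` (UNIV \<times> A) \<subseteq> ?S" "(q, a) \<in> UNIV \<times> A" using t a by auto
    show "(?j has_derivative (\<lambda>z. (fst z, 0, snd z))) (at (q, a) within UNIV \<times> A)"
      by (intro derivative_eq_intros) auto
  qed
  moreover have "blinfun_apply (DF t (q, a)) =
      (\<lambda>z. C1_derivative (\<lambda>(q, t, a). R q t a) ?S (?j (q, a)) (fst z, 0, snd z))"
    by (rule ext) (simp add: DF_def blinfun.add_left)
  ultimately show ?thesis
    using at_within_parameters[OF a, of q] by (simp add: case_prod_unfold)
qed

lemma DF_cont: "continuous_on ({0..T} \<times> UNIV \<times> A) (\<lambda>(t, z). DF t z)"
proof -
  have "continuous_on ({0..T} \<times> UNIV \<times> A) (\<lambda>p. C1_derivative (\<lambda>(q, t, a). R q t a)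
      (UNIV \<times> {0..T} \<times> A) (fst (snd p), fst p, snd (snd p)))"
    by (rule continuous_on_compose2[OF continuous_on_C1_derivative[OF field_C1]])
      (auto intro!: continuous_intros)
  then show ?thesis
    unfolding DF_def case_prod_unfold by (intro continuous_intros)
qed

lemma field_continuous: "continuous_on ({0..T} \<times> UNIV \<times> A) (\<lambda>(t, x, a). R x t a)"
proof -
  have "continuous_on (UNIV \<times> {0..T} \<times> A) (\<lambda>(q, t, a). R q t a)"
    by (rule has_derivative_continuous_on[OF C1_derivative[OF field_C1]])
  then have "continuous_on ({0..T} \<times> UNIV \<times> A) (\<lambda>p. (\<lambda>(q, t, a). R q t a) (fst (snd p), fst p, snd (snd p)))"
    by (rule continuous_on_compose2) (auto intro!: continuous_intros)
  then show ?thesis by (simp add: case_prod_unfold)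
qed

lemma field_deriv_state:
  assumes "t \<in> {0..T}" "a \<in> A"
  shows "((\<lambda>x. R x t a) has_derivative (\<lambda>v. DF t (q, a) (v, 0))) (at q)"
  using has_derivative_slice_fst[OF field_deriv[OF assms]] by simp

lemma field_deriv_param:
  assumes "t \<in> {0..T}" "a \<in> A"
  shows "((\<lambda>b. R q t b) has_derivative (\<lambda>w. DF t (q, a) (0, w))) (at a)"
  using has_derivative_slice_snd[OF field_deriv[OF assms]] by simp

lemma norm_DF_state:
  assumes "t \<in> {0..T}" "a \<in> A"
  shows "norm (DF t (q, a) (v, 0)) \<le> LR * norm v"
proof -
  note D = field_deriv_state[OF assms, of q]
  have "norm (DF t (q, a) (v, 0)) \<le> onorm (\<lambda>v. DF t (q, a) (v, 0)) * norm v"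
    by (rule onorm[OF has_derivative_bounded_linear[OF D]])
  also have "onorm (\<lambda>v. DF t (q, a) (v, 0)) = norm_dq_R R q t a"
    using frechet_derivative_at[OF D] by (simp add: norm_dq_R_def)
  also have "norm_dq_R R q t a * norm v \<le> LR * norm v"
    using assms by (intro mult_right_mono sup_over_upper finite_LR) auto
  finally show ?thesis .
qed

lemma norm_DF_param:
  assumes "t \<in> {0..T}" "a \<in> A"
  shows "norm (DF t (q, a) (0, w)) \<le> MR * norm w"
proof -
  note D = field_deriv_param[OF assms, of q]
  have "norm (DF t (q, a) (0, w)) \<le> onorm (\<lambda>w. DF t (q, a) (0, w)) * norm w"
    by (rule onorm[OF has_derivative_bounded_linear[OF D]])
  also have "onorm (\<lambda>w. DF t (q, a) (0, w)) = norm_da_R R q t a"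
    using frechet_derivative_at[OF D] by (simp add: norm_da_R_def)
  also have "norm_da_R R q t a * norm w \<le> MR * norm w"
    using assms by (intro mult_right_mono sup_over_upper finite_MR) auto
  finally show ?thesis .
qed

lemma
  shows LR_nonneg: "0 \<le> LR" and MR_nonneg: "0 \<le> MR"
    and Lh_nonneg: "0 \<le> Lh" and Mh_nonneg: "0 \<le> Mh"
proof -
  have t: "0 \<in> {0..T}" using horizon by simp
  note a = true_parameter
  show "0 \<le> LR"
    using sup_over_upper[OF finite_LR t a, of 0] onorm_pos_le[OF has_derivative_bounded_linear[OF field_deriv_state[OF t a, of 0]]]
      frechet_derivative_at[OF field_deriv_state[OF t a, of 0]] by (simp add: norm_dq_R_def)
  show "0 \<le> MR"
    using sup_over_upper[OF finite_MR t a, of 0] onorm_pos_le[OF has_derivative_bounded_linear[OF field_deriv_param[OF t a, of 0]]]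
      frechet_derivative_at[OF field_deriv_param[OF t a, of 0]] by (simp add: norm_da_R_def)
  show "0 \<le> Lh"
    using sup_over_upper[OF finite_Lh t a, of 0] norm_ge_zero order_trans unfolding norm_dq_h_def by blast
  show "0 \<le> Mh"
    using sup_over_upper[OF finite_Mh t a, of 0] norm_ge_zero order_trans unfolding norm_da_h_def by blast
qed

sublocale forward: parametric_flow A T LR MR "\<lambda>t x a. R x t a" DF \<Phi>
  by unfold_locales
    (use horizon open_parameters LR_nonneg MR_nonneg field_deriv field_continuous DF_cont
      norm_DF_state norm_DF_param flow_init flow_ode in auto)

text \<open>The reversed flow: \<open>\<Psi> s Q a\<close> is the state at time \<open>T - s\<close> of the trajectory that is at \<open>Q\<close> at time \<open>T\<close>.\<close>

definition \<Psi> :: "real \<Rightarrow> 'x \<times> 'y \<Rightarrow> 'p \<Rightarrow> 'x \<times> 'y" where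
  "\<Psi> s Q a = \<Phi> (T - s) (inv (\<lambda>q. \<Phi> T q a) Q) a"

lemma flow_bij: "a \<in> A \<Longrightarrow> t \<in> {0..T} \<Longrightarrow> bij (\<lambda>q. \<Phi> t q a)"
  using flow_diffeo by (simp add: C1_diffeomorphism_def)

lemma backward_init: "a \<in> A \<Longrightarrow> \<Psi> 0 Q a = Q"
  using surj_f_inv_f[OF bij_is_surj[OF flow_bij], of a T Q] horizon by (simp add: \<Psi>_def)

lemma backward_end: "a \<in> A \<Longrightarrow> \<Psi> T Q a = inv (\<lambda>q. \<Phi> T q a) Q"
  by (simp add: \<Psi>_def flow_init)

text \<open>The reversed flow recovers the initial state from the terminal state of a trajectory.\<close>

lemma backward_end_flow: "a \<in> A \<Longrightarrow> \<Psi> T (\<Phi> T q a) a = q"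
  using inv_f_f[OF bij_is_inj[OF flow_bij], of a T q] horizon by (simp add: backward_end)

lemma backward_ode:
  assumes a: "a \<in> A" and t: "t \<in> {0..T}"
  shows "((\<lambda>s. \<Psi> s Q a) has_vector_derivative - R (\<Psi> t Q a) (T - t) a) (at t within {0..T})"
proof -
  let ?q = "inv (\<lambda>q. \<Phi> T q a) Q"
  have "(((\<lambda>s. \<Phi> s ?q a) \<circ> (\<lambda>s. T - s)) has_vector_derivative (- 1) *\<^sub>R R (\<Phi> (T - t) ?q a) (T - t) a)
      (at t within {0..T})"
  proof (rule vector_diff_chain_within)
    show "((\<lambda>s. T - s) has_vector_derivative - 1) (at t within {0..T})"
      by (auto intro!: derivative_eq_intros)
    have "(\<lambda>s. T - s) ` {0..T} \<subseteq> {0..T}" by auto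
    then show "((\<lambda>s. \<Phi> s ?q a) has_vector_derivative R (\<Phi> (T - t) ?q a) (T - t) a)
        (at (T - t) within (\<lambda>s. T - s) ` {0..T})"
      using t by (intro has_vector_derivative_within_subset[OF flow_ode[OF a]]) auto
  qed
  then show ?thesis by (simp add: comp_def \<Psi>_def)
qed

lemma continuous_on_reverse_time:
  assumes "continuous_on ({0..T} \<times> Z) (\<lambda>(t, z). g t z)"
  shows "continuous_on ({0..T} \<times> Z) (\<lambda>(t, z). g (T - t) z)"
proof -
  have "continuous_on ({0..T} \<times> Z) (\<lambda>p. (\<lambda>(t, z). g t z) (T - fst p, snd p))"
    by (rule continuous_on_compose2[OF assms]) (auto intro!: continuous_intros)
  then show ?thesis by (simp add: case_prod_unfold)
qed

sublocale backward: parametric_flow A T LR MR "\<lambda>t x a. - R x (T - t) a" "\<lambda>t z. - DF (T - t) z" \<Psi>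
proof unfold_locales
  fix t x a assume ta: "t \<in> {0..T}" "a \<in> A"
  then have t': "T - t \<in> {0..T}" by auto
  show "((\<lambda>(x, b). - R x (T - t) b) has_derivative blinfun_apply (- DF (T - t) (x, a))) (at (x, a))"
    using has_derivative_minus[OF field_deriv[OF t' ta(2), of x]]
    by (simp add: case_prod_unfold uminus_blinfun.rep_eq)
  show "norm ((- DF (T - t) (x, a)) (v, 0)) \<le> LR * norm v" for v
    using norm_DF_state[OF t' ta(2), of x v] by (simp add: blinfun.minus_left)
  show "norm ((- DF (T - t) (x, a)) (0, w)) \<le> MR * norm w" for w
    using norm_DF_param[OF t' ta(2), of x w] by (simp add: blinfun.minus_left)
next
  show "continuous_on ({0..T} \<times> UNIV \<times> A) (\<lambda>(t, x, a). - R x (T - t) a)"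
    using continuous_on_minus[OF continuous_on_reverse_time[of "UNIV \<times> A" "\<lambda>t z. R (fst z) t (snd z)"]] field_continuous
    by (simp add: case_prod_unfold)
  show "continuous_on ({0..T} \<times> UNIV \<times> A) (\<lambda>(t, z). - DF (T - t) z)"
    using continuous_on_minus[OF continuous_on_reverse_time[OF DF_cont]]
    by (simp add: case_prod_unfold)
qed (use horizon open_parameters LR_nonneg MR_nonneg backward_init backward_ode in auto)

lemma div_field_eq:
  assumes "t \<in> {0..T}" "a \<in> A"
  shows "div_field R q t a = (\<Sum>e\<in>Basis. DF t (q, a) (e, 0) \<bullet> e)"
  unfolding div_field_def divergence_def
    frechet_derivative_at[OF field_deriv_state[OF assms, of q], symmetric] ..

lemma div_field_continuous: "continuous_on ({0..T} \<times> UNIV \<times> A) (\<lambda>(t, x, a). div_field R x t a)"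
proof -
  have "continuous_on ({0..T} \<times> UNIV \<times> A) (\<lambda>p. \<Sum>e\<in>Basis. DF (fst p) (snd p) (e, 0) \<bullet> e)"
    using DF_cont by (intro continuous_intros) (simp add: case_prod_unfold)
  then show ?thesis
    by (subst continuous_on_cong[OF refl]) (auto simp: div_field_eq)
qed

text \<open>The derivative in state and parameter of the divergence \<open>h\<close> at time \<open>t\<close>.\<close>

definition Dh :: "real \<Rightarrow> ('x \<times> 'y) \<times> 'p \<Rightarrow> (('x \<times> 'y) \<times> 'p) \<Rightarrow>\<^sub>L real" where
  "Dh t = C1_derivative (\<lambda>(q, a). div_field R q t a) (UNIV \<times> A)"

lemma Dh_cont: "t \<in> {0..T} \<Longrightarrow> continuous_on (UNIV \<times> A) (Dh t)"
  unfolding Dh_def by (rule continuous_on_C1_derivative[OF divergence_C1])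

lemma Dh_deriv:
  assumes "t \<in> {0..T}" "a \<in> A"
  shows "((\<lambda>(q, a). div_field R q t a) has_derivative blinfun_apply (Dh t (q, a))) (at (q, a))"
  using C1_derivative[OF divergence_C1[OF assms(1)], of "(q, a)"] assms(2) at_within_parameters[OF assms(2), of q]
  by (simp add: Dh_def)

lemma abs_Dh_le:
  assumes "t \<in> {0..T}" "a \<in> A"
  shows "\<bar>Dh t (q, a) (v, w)\<bar> \<le> Lh * norm v + Mh * norm w"
proof -
  let ?D = "Dh t (q, a)"
  have "GDERIV (\<lambda>x. div_field R x t a) q :> riesz_vector (?D o\<^sub>L blinfun_inl)"
    using has_derivative_slice_fst[OF Dh_deriv[OF assms, of q]]
    by (intro GDERIV_riesz_vector) (simp add: blinfun_compose.rep_eq comp_def)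
  from gradient_eqI[OF this] have l: "norm (riesz_vector (?D o\<^sub>L blinfun_inl)) \<le> Lh"
    using sup_over_upper[OF finite_Lh assms, of q] by (simp add: norm_dq_h_def)
  have "GDERIV (\<lambda>b. div_field R q t b) a :> riesz_vector (?D o\<^sub>L blinfun_inr)"
    using has_derivative_slice_snd[OF Dh_deriv[OF assms, of q]]
    by (intro GDERIV_riesz_vector) (simp add: blinfun_compose.rep_eq comp_def)
  from gradient_eqI[OF this] have r: "norm (riesz_vector (?D o\<^sub>L blinfun_inr)) \<le> Mh"
    using sup_over_upper[OF finite_Mh assms, of q] by (simp add: norm_da_h_def)
  have "?D (v, w) = ?D (v, 0) + ?D (0, w)" by (simp add: blinfun.add_right[symmetric])
  also have "\<dots> = v \<bullet> riesz_vector (?D o\<^sub>L blinfun_inl) + w \<bullet> riesz_vector (?D o\<^sub>L blinfun_inr)"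
    by (simp add: inner_riesz_vector)
  also have "\<bar>\<dots>\<bar> \<le> norm v * norm (riesz_vector (?D o\<^sub>L blinfun_inl))
      + norm w * norm (riesz_vector (?D o\<^sub>L blinfun_inr))"
    using Cauchy_Schwarz_ineq2[of v "riesz_vector (?D o\<^sub>L blinfun_inl)"]
      Cauchy_Schwarz_ineq2[of w "riesz_vector (?D o\<^sub>L blinfun_inr)"] by linarith
  also have "\<dots> \<le> norm v * Lh + norm w * Mh"
    by (intro add_mono mult_left_mono l r) auto
  finally show ?thesis by (simp add: mult.commute)
qed

section \<open>The transported density and its sensitivity\<close>

lemma density_deriv_state:
  assumes a: "a \<in> A" and t: "t \<in> {0..T}"
  shows "((\<lambda>x. f x t a) has_derivative
    (\<lambda>v. C1_derivative (\<lambda>(q, t). f q t a) (UNIV \<times> {0..T}) (q, t) (v, 0))) (at q)"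
proof -
  have "((\<lambda>x. (\<lambda>(q, t). f q t a) (x, t)) has_derivative
    (\<lambda>v. C1_derivative (\<lambda>(q, t). f q t a) (UNIV \<times> {0..T}) (q, t) (v, 0))) (at q within UNIV)"
    by (rule has_derivative_in_compose2[OF C1_derivative[OF density_C1[OF a]]])
      (use t in \<open>auto intro!: derivative_eq_intros\<close>)
  then show ?thesis by simp
qed

text \<open>The Liouville equation in its characteristic form: \<open>f\<close> decays along trajectories at the rate \<open>h\<close>.\<close>

lemma density_transport:
  assumes a: "a \<in> A" and t: "t \<in> {0..T}"
  shows "C1_derivative (\<lambda>(q, t). f q t a) (UNIV \<times> {0..T}) (q, t) (R q t a, 1)
    = - (f q t a * div_field R q t a)"
proof -
  let ?D = "C1_derivative (\<lambda>(q, t). f q t a) (UNIV \<times> {0..T}) (q, t)"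
  have "((\<lambda>s. (\<lambda>(q, t). f q t a) (q, s)) has_derivative (\<lambda>w. ?D (0, w))) (at t within {0..T})"
    by (rule has_derivative_in_compose2[OF C1_derivative[OF density_C1[OF a]]])
      (use t in \<open>auto intro!: derivative_eq_intros\<close>)
  moreover have "(\<lambda>w. ?D (0, w)) = (\<lambda>w. w *\<^sub>R ?D (0, 1))"
  proof
    show "?D (0, w) = w *\<^sub>R ?D (0, 1)" for w
      using blinfun.scaleR_right[of ?D w "(0, 1)"] by simp
  qed
  ultimately have "((\<lambda>s. f q s a) has_vector_derivative ?D (0, 1)) (at t within {0..T})"
    unfolding has_vector_derivative_def by (simp only: prod.case)
  moreover have "((\<lambda>s. f q s a) has_vector_derivative - divergence (\<lambda>x. f x t a *\<^sub>R R x t a) q) (at t within {0..T})"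
    using liouville[OF a t] by (simp add: has_real_derivative_iff_has_vector_derivative)
  ultimately have time: "?D (0, 1) = - divergence (\<lambda>x. f x t a *\<^sub>R R x t a) q"
    using vector_derivative_unique_within_closed_interval[OF horizon, of t, unfolded cbox_interval, OF t] by blast
  have "((\<lambda>x. f x t a *\<^sub>R R x t a) has_derivative
      (\<lambda>v. f q t a *\<^sub>R DF t (q, a) (v, 0) + ?D (v, 0) *\<^sub>R R q t a)) (at q)"
    by (rule has_derivative_scaleR[OF density_deriv_state[OF a t] field_deriv_state[OF t a]])
  note fd = frechet_derivative_at[OF this]
  have "divergence (\<lambda>x. f x t a *\<^sub>R R x t a) q
      = (\<Sum>e\<in>Basis. (f q t a *\<^sub>R DF t (q, a) (e, 0) + ?D (e, 0) *\<^sub>R R q t a) \<bullet> e)"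
    unfolding divergence_def fd[symmetric] ..
  also have "\<dots> = f q t a * div_field R q t a + (\<Sum>e\<in>Basis. ?D (e, 0) * (R q t a \<bullet> e))"
    by (simp add: div_field_eq[OF t a] inner_add_left sum.distrib sum_distrib_left)
  also have "(\<Sum>e\<in>Basis. ?D (e, 0) * (R q t a \<bullet> e)) = ?D (R q t a, 0)"
  proof -
    have "?D (R q t a, 0) = (?D o\<^sub>L blinfun_inl) (\<Sum>e\<in>Basis. (R q t a \<bullet> e) *\<^sub>R e)"
      by (simp add: euclidean_representation)
    also have "\<dots> = (\<Sum>e\<in>Basis. (R q t a \<bullet> e) * ?D (e, 0))"
      unfolding blinfun.sum_right blinfun.scaleR_right by simp
    finally show ?thesis by (simp add: mult.commute)
  qed
  finally have "?D (0, 1) = - (f q t a * div_field R q t a) - ?D (R q t a, 0)" using time by simp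
  moreover have "?D (R q t a, 1) = ?D (R q t a, 0) + ?D (0, 1)"
    by (simp add: blinfun.add_right[symmetric])
  ultimately show ?thesis by simp
qed

lemma div_field_backward_continuous:
  assumes a: "a \<in> A"
  shows "continuous_on {0..T} (\<lambda>s. div_field R (\<Psi> s Q a) (T - s) a)"
  using continuous_on_compose2[OF div_field_continuous, of "{0..T}" "\<lambda>s. (T - s, \<Psi> s Q a, a)"] a
  by (simp add: image_subset_iff continuous_on_Pair continuous_on_const continuous_on_id
      continuous_on_diff backward.y_cont_time)

lemma density_along_backward_flow:
  assumes a: "a \<in> A"
  shows "f Q T a = f0 (\<Psi> T Q a) * exp (- integral {0..T} (\<lambda>s. div_field R (\<Psi> s Q a) (T - s) a))"
proof -
  define k where "k = (\<lambda>s. div_field R (\<Psi> s Q a) (T - s) a)"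
  define w where "w = (\<lambda>s. f (\<Psi> s Q a) (T - s) a)"
  let ?D = "C1_derivative (\<lambda>(q, t). f q t a) (UNIV \<times> {0..T})"
  have k_cont: "continuous_on {0..T} k"
    unfolding k_def by (rule div_field_backward_continuous[OF a])
  have dw: "(w has_real_derivative w t * k t) (at t within {0..T})" if t: "t \<in> {0..T}" for t
  proof -
    have t': "T - t \<in> {0..T}" using t by auto
    have "((\<lambda>s. (\<Psi> s Q a, T - s)) has_derivative (\<lambda>h. (h *\<^sub>R - R (\<Psi> t Q a) (T - t) a, - h))) (at t within {0..T})"
      using backward_ode[OF a t, of Q] unfolding has_vector_derivative_def
      by (auto intro!: derivative_eq_intros)
    then have "((\<lambda>s. (\<lambda>(q, t). f q t a) (\<Psi> s Q a, T - s)) has_derivative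
        (\<lambda>h. ?D (\<Psi> t Q a, T - t) (h *\<^sub>R - R (\<Psi> t Q a) (T - t) a, - h))) (at t within {0..T})"
      by (intro has_derivative_in_compose2[OF C1_derivative[OF density_C1[OF a]]]) (use t in auto)
    moreover have "?D (\<Psi> t Q a, T - t) (h *\<^sub>R - R (\<Psi> t Q a) (T - t) a, - h) = h * (w t * k t)" for h
    proof -
      have "?D (\<Psi> t Q a, T - t) (h *\<^sub>R - R (\<Psi> t Q a) (T - t) a, - h)
          = ?D (\<Psi> t Q a, T - t) ((- h) *\<^sub>R (R (\<Psi> t Q a) (T - t) a, 1))" by simp
      also have "\<dots> = h * (w t * k t)"
        unfolding blinfun.scaleR_right density_transport[OF a t'] by (simp add: w_def k_def)
      finally show ?thesis .
    qed
    ultimately show ?thesis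
      by (simp add: w_def has_field_derivative_def mult_commute_abs)
  qed
  define K where "K = (\<lambda>t. integral {0..t} k)"
  have dK: "(K has_real_derivative k t) (at t within {0..T})" if "t \<in> {0..T}" for t
    unfolding K_def by (rule integral_has_real_derivative[OF k_cont that])
  have "\<exists>c. \<forall>t\<in>{0..T}. w t * exp (- K t) = c"
  proof (rule has_field_derivative_zero_constant[OF convex_real_interval(5)])
    fix t assume t: "t \<in> {0..T}"
    show "((\<lambda>t. w t * exp (- K t)) has_real_derivative 0) (at t within {0..T})"
      by (rule derivative_eq_intros dw[OF t] dK[OF t] refl | simp)+
  qed
  then obtain c where c: "\<And>t. t \<in> {0..T} \<Longrightarrow> w t * exp (- K t) = c" by blast
  have "w 0 * exp (- K 0) = w T * exp (- K T)" using c[of 0] c[of T] horizon by simp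
  then show ?thesis
    using a by (simp add: w_def K_def k_def backward_init density_init)
qed

text \<open>At time 0 the transported density is \<open>f\<^sub>0\<close>, so \<open>f\<^sub>0\<close> inherits differentiability on the whole space.\<close>

lemma init_C1_global: "C1_on f0 UNIV"
  unfolding C1_on_def
proof (intro exI conjI ballI)
  let ?D = "C1_derivative (\<lambda>(q, t). f q t a_star) (UNIV \<times> {0..T})"
  show "(f0 has_derivative blinfun_apply (?D (x, 0) o\<^sub>L blinfun_inl)) (at x within UNIV)" for x
    using density_deriv_state[OF true_parameter, of 0 x] horizon true_parameter
    by (simp add: density_init blinfun_compose.rep_eq comp_def)
  show "continuous_on UNIV (\<lambda>x. ?D (x, 0) o\<^sub>L blinfun_inl)"
    by (intro continuous_intros continuous_on_compose2[OF continuous_on_C1_derivative[OF density_C1[OF true_parameter]]])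
      (use horizon in auto)
qed

lemma init_nonneg: "0 \<le> f0 q"
  using init_density unfolding probability_density_def by blast

lemma init_continuous: "continuous_on UNIV f0"
  by (rule has_derivative_continuous_on[OF C1_derivative[OF init_C1_global]]) auto

text \<open>By the global continuity of \<open>f\<^sub>0\<close>, the interior of the support is exactly the set where \<open>f\<^sub>0\<close> is positive.\<close>

lemma interior_supp: "interior (supp f0) = {q. 0 < f0 q}"
proof (rule antisym)
  show "interior (supp f0) \<subseteq> {q. 0 < f0 q}" using init_pos by auto
  show "{q. 0 < f0 q} \<subseteq> interior (supp f0)"
  proof (rule interior_maximal)
    show "{q. 0 < f0 q} \<subseteq> supp f0" using closure_subset by (fastforce simp: supp_def)
    show "open {q. 0 < f0 q}"
      by (intro open_Collect_less continuous_on_const init_continuous)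
  qed
qed

text \<open>The score of the initial density, used only where \<open>f\<^sub>0\<close> is positive.\<close>

definition score :: "'x \<times> 'y \<Rightarrow> 'x \<times> 'y" where
  "score q = gradient (\<lambda>x. ln (f0 x)) q"

lemma score_eq:
  assumes "0 < f0 q"
  shows "score q = (1 / f0 q) *\<^sub>R riesz_vector (C1_derivative f0 UNIV q)"
proof -
  have "GDERIV f0 q :> riesz_vector (C1_derivative f0 UNIV q)"
    using C1_derivative[OF init_C1_global, of q] by (intro GDERIV_riesz_vector) simp
  moreover have "DERIV ln (f0 q) :> 1 / f0 q"
    using assms by (auto intro!: derivative_eq_intros)
  ultimately show ?thesis
    unfolding score_def by (intro gradient_eqI GDERIV_DERIV_compose)
qed

abbreviation "\<Sigma> \<equiv> Sigma_const LR MR T"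
abbreviation "Cr \<equiv> Cr_const LR MR Lh Mh T"

lemma Sigma_nonneg: "0 \<le> \<Sigma>"
  using horizon MR_nonneg by (intro Sigma_const_nonneg) auto

lemma Cr_nonneg: "0 \<le> Cr"
  using horizon Sigma_nonneg Lh_nonneg Mh_nonneg by (auto simp: Cr_const_def)

text \<open>The gradient \<open>p Q a\<close> of \<open>a \<mapsto> f Q T a\<close> exists for all \<open>Q\<close>, also on the boundary of the transported
  support: where the nonnegative density vanishes it has a minimum, so \<open>p\<close> vanishes there as well. Hence
  \<open>p = f G\<close> holds everywhere with the extension of \<open>G\<close> by 0.\<close>

theorem transported_density_gradient:
  obtains p where
    "\<And>Q a. a \<in> A \<Longrightarrow> GDERIV (\<lambda>b. f Q T b) a :> p Q a"
    "continuous_on (UNIV \<times> A) (\<lambda>(Q, a). p Q a)"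
    "continuous_on (UNIV \<times> A) (\<lambda>(Q, a). f Q T a)"
    "\<And>Q a. a \<in> A \<Longrightarrow> 0 < f Q T a \<longleftrightarrow> 0 < f0 (\<Psi> T Q a)"
    "\<And>Q a. a \<in> A \<Longrightarrow> sensitivity f0 \<Phi> f Q T a = (1 / f Q T a) *\<^sub>R p Q a"
    "\<And>Q a. a \<in> A \<Longrightarrow> f Q T a = 0 \<Longrightarrow> p Q a = 0"
    "\<And>Q a. a \<in> A \<Longrightarrow> 0 < f0 (\<Psi> T Q a) \<Longrightarrow>
      norm (sensitivity f0 \<Phi> f Q T a) \<le> \<Sigma> * norm (score (\<Psi> T Q a)) + Cr"
proof -
  obtain Y where
    Y_cont: "continuous_on ({0..T} \<times> UNIV \<times> A) (\<lambda>(t, z). Y t z)"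
    and Y_deriv: "\<And>t x a. t \<in> {0..T} \<Longrightarrow> a \<in> A \<Longrightarrow> ((\<lambda>b. \<Psi> t x b) has_derivative blinfun_apply (Y t (x, a))) (at a)"
    and Y_bd: "\<And>t x a. t \<in> {0..T} \<Longrightarrow> a \<in> A \<Longrightarrow> norm (Y t (x, a)) \<le> Sigma_const LR MR t"
    by (rule backward.y_parameter_derivative) (rule that)
  have Y_bd': "norm (Y t (x, a) w) \<le> \<Sigma> * norm w" if "t \<in> {0..T}" "a \<in> A" for t x a w
  proof -
    have "norm (Y t (x, a) w) \<le> norm (Y t (x, a)) * norm w" by (rule norm_blinfun)
    also have "\<dots> \<le> \<Sigma> * norm w"
      using Y_bd[OF that, of x] Sigma_const_mono[of MR LR t T] that LR_nonneg MR_nonneg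
      by (intro mult_right_mono) auto
    finally show ?thesis .
  qed
  have Y_cont': "continuous_on (UNIV \<times> A) (Y t)" if "t \<in> {0..T}" for t
    using continuous_on_compose2[OF Y_cont, of "UNIV \<times> A" "\<lambda>z. (t, z)"] that
    by (simp add: image_subset_iff continuous_on_Pair continuous_on_const continuous_on_id)
  have \<Psi>_cont: "continuous_on (UNIV \<times> A) (\<lambda>z. \<Psi> t (fst z) (snd z))" if "t \<in> {0..T}" for t
    using continuous_on_compose2[OF backward.y_continuous, of "UNIV \<times> A" "\<lambda>z. (t, z)"] that
    by (simp add: image_subset_iff continuous_on_Pair continuous_on_const continuous_on_id case_prod_unfold)
  define k where "k = (\<lambda>t Q a. div_field R (\<Psi> t Q a) (T - t) a)"
  \<comment> \<open>\<open>g\<close> is the gradient of \<open>k t Q\<close> by the chain rule.\<close>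
  define g where "g = (\<lambda>t Q a. riesz_vector (Dh (T - t) (\<Psi> t Q a, a) o\<^sub>L
    ((blinfun_inl o\<^sub>L Y t (Q, a)) + blinfun_inr)))"
  have g_deriv: "GDERIV (k t Q) a :> g t Q a" if t: "t \<in> {0..T}" and a: "a \<in> A" for t Q a
    unfolding g_def
  proof (rule GDERIV_riesz_vector)
    have t': "T - t \<in> {0..T}" using t by auto
    have "((\<lambda>b. (\<lambda>(q, a). div_field R q (T - t) a) (\<Psi> t Q b, b)) has_derivative
        (\<lambda>w. Dh (T - t) (\<Psi> t Q a, a) (Y t (Q, a) w, w))) (at a)"
      by (rule has_derivative_compose[where g' = "blinfun_apply (Dh (T - t) (\<Psi> t Q a, a))"])
        (auto intro!: derivative_eq_intros Y_deriv[OF t a] Dh_deriv[OF t' a, simplified])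
    moreover have "blinfun_apply (Dh (T - t) (\<Psi> t Q a, a) o\<^sub>L ((blinfun_inl o\<^sub>L Y t (Q, a)) + blinfun_inr))
        = (\<lambda>w. Dh (T - t) (\<Psi> t Q a, a) (Y t (Q, a) w, w))"
      by (rule ext) (simp add: blinfun.add_left)
    ultimately show "(k t Q has_derivative
        blinfun_apply (Dh (T - t) (\<Psi> t Q a, a) o\<^sub>L ((blinfun_inl o\<^sub>L Y t (Q, a)) + blinfun_inr))) (at a)"
      by (simp add: k_def)
  qed
  have g_cont: "continuous_on (UNIV \<times> A) (\<lambda>(Q, a). g t Q a)" if t: "t \<in> {0..T}" for t
  proof -
    have t': "T - t \<in> {0..T}" using t by auto
    have "continuous_on (UNIV \<times> A) (\<lambda>z. Dh (T - t) (\<Psi> t (fst z) (snd z), snd z))"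
      by (rule continuous_on_compose2[OF Dh_cont[OF t']]) (auto intro!: continuous_intros \<Psi>_cont[OF t])
    then show ?thesis
      unfolding g_def case_prod_unfold using Y_cont'[OF t] by (intro continuous_intros) simp_all
  qed
  have g_bd: "norm (g t Q a) \<le> Mh + Lh * \<Sigma>" if t: "t \<in> {0..T}" and a: "a \<in> A" for t Q a
    unfolding g_def
  proof (rule norm_riesz_vector_le)
    fix w
    have t': "T - t \<in> {0..T}" using t by auto
    have "\<bar>Dh (T - t) (\<Psi> t Q a, a) (Y t (Q, a) w, w)\<bar> \<le> Lh * norm (Y t (Q, a) w) + Mh * norm w"
      by (rule abs_Dh_le[OF t' a])
    also have "\<dots> \<le> Lh * (\<Sigma> * norm w) + Mh * norm w"
      using Y_bd'[OF t a] Lh_nonneg Mh_nonneg by (intro add_mono mult_left_mono) auto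
    finally show "\<bar>(Dh (T - t) (\<Psi> t Q a, a) o\<^sub>L ((blinfun_inl o\<^sub>L Y t (Q, a)) + blinfun_inr)) w\<bar>
        \<le> (Mh + Lh * \<Sigma>) * norm w"
      by (simp add: blinfun.add_left algebra_simps)
  qed
  have k_int: "(\<lambda>t. k t Q a) integrable_on {0..T}" if "a \<in> A" for Q a
    unfolding k_def by (intro integrable_continuous_interval div_field_backward_continuous that)
  have T0: "0 \<le> T" using horizon by simp
  define H where "H = (\<lambda>Q a. integral {0..T} (\<lambda>t. k t Q a))"
  define gH where "gH = (\<lambda>Q a. integral {0..T} (\<lambda>t. g t Q a))"
  note diff_int = open_parameters T0 g_deriv g_cont g_bd k_int
  have gH: "GDERIV (H Q) a :> gH Q a" if "a \<in> A" for Q a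
    unfolding H_def gH_def by (rule GDERIV_integral[OF diff_int that])
  have gH_cont: "continuous_on (UNIV \<times> A) (\<lambda>z. gH (fst z) (snd z))"
    using continuous_on_gradient_integral[OF diff_int] by (simp add: gH_def case_prod_unfold)
  have gH_bd: "norm (gH Q a) \<le> Cr" if "a \<in> A" for Q a
    unfolding gH_def Cr_const_def by (rule norm_gradient_integral_le[OF diff_int that])
  have H_cont: "continuous_on (UNIV \<times> A) (\<lambda>z. H (fst z) (snd z))"
  proof -
    have "continuous_on ((UNIV \<times> A) \<times> cbox 0 T) (\<lambda>p. \<Psi> (snd p) (fst (fst p)) (snd (fst p)))"
      using continuous_on_compose2[OF backward.y_continuous, of "(UNIV \<times> A) \<times> cbox 0 T" "\<lambda>p. (snd p, fst p)"]
      by (simp add: image_subset_iff continuous_on_Pair continuous_on_fst continuous_on_snd continuous_on_id case_prod_unfold)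
    then have "continuous_on ((UNIV \<times> A) \<times> cbox 0 T)
        (\<lambda>p. (\<lambda>(t, x, a). div_field R x t a) (T - snd p, \<Psi> (snd p) (fst (fst p)) (snd (fst p)), snd (fst p)))"
      by (intro continuous_on_compose2[OF div_field_continuous] continuous_intros) auto
    then have "continuous_on ((UNIV \<times> A) \<times> cbox 0 T) (\<lambda>(z, t). k t (fst z) (snd z))"
      by (simp add: k_def case_prod_unfold)
    from integral_continuous_on_param[OF this] show ?thesis by (simp add: H_def)
  qed
  have f_eq: "f Q T a = f0 (\<Psi> T Q a) * exp (- H Q a)" if "a \<in> A" for Q a
    using density_along_backward_flow[OF that] by (simp add: H_def k_def)
  let ?D0 = "C1_derivative f0 UNIV"
  have TT: "T \<in> {0..T}" using horizon by simp
  define g0 where "g0 = (\<lambda>Q a. riesz_vector (?D0 (\<Psi> T Q a) o\<^sub>L Y T (Q, a)))"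
  have g0: "GDERIV (\<lambda>b. f0 (\<Psi> T Q b)) a :> g0 Q a" if a: "a \<in> A" for Q a
    unfolding g0_def
  proof (rule GDERIV_riesz_vector)
    have "(f0 has_derivative blinfun_apply (?D0 (\<Psi> T Q a))) (at (\<Psi> T Q a))"
      using C1_derivative[OF init_C1_global, of "\<Psi> T Q a"] by simp
    from has_derivative_compose[OF Y_deriv[OF TT a] this]
    show "((\<lambda>b. f0 (\<Psi> T Q b)) has_derivative blinfun_apply (?D0 (\<Psi> T Q a) o\<^sub>L Y T (Q, a))) (at a)"
      by (simp add: blinfun_compose.rep_eq comp_def)
  qed
  define p where "p = (\<lambda>Q a. exp (- H Q a) *\<^sub>R (g0 Q a - f0 (\<Psi> T Q a) *\<^sub>R gH Q a))"
  have p: "GDERIV (\<lambda>b. f Q T b) a :> p Q a" if a: "a \<in> A" for Q a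
  proof -
    have "DERIV exp (- H Q a) :> exp (- H Q a)" by (rule DERIV_exp)
    from GDERIV_DERIV_compose[OF GDERIV_minus[OF gH[OF a, of Q]] this]
    have "GDERIV (\<lambda>b. f0 (\<Psi> T Q b) * exp (- H Q b)) a :>
        f0 (\<Psi> T Q a) *\<^sub>R (exp (- H Q a) *\<^sub>R - gH Q a) + exp (- H Q a) *\<^sub>R g0 Q a"
      by (rule GDERIV_mult[OF g0[OF a]])
    then have "GDERIV (\<lambda>b. f0 (\<Psi> T Q b) * exp (- H Q b)) a :> p Q a"
      by (rule GDERIV_subst) (simp add: p_def algebra_simps)
    then show ?thesis
      unfolding gderiv_def
      by (rule has_derivative_transform_within_open[OF _ open_parameters a]) (simp add: f_eq)
  qed
  have p_cont: "continuous_on (UNIV \<times> A) (\<lambda>(Q, a). p Q a)"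
  proof -
    have "continuous_on (UNIV \<times> A) (\<lambda>z. ?D0 (\<Psi> T (fst z) (snd z)))"
      by (rule continuous_on_compose2[OF continuous_on_C1_derivative[OF init_C1_global] \<Psi>_cont[OF TT]]) simp
    moreover have "continuous_on (UNIV \<times> A) (\<lambda>z. f0 (\<Psi> T (fst z) (snd z)))"
      by (rule continuous_on_compose2[OF init_continuous \<Psi>_cont[OF TT]]) simp
    ultimately show ?thesis
      unfolding p_def g0_def case_prod_unfold using Y_cont'[OF TT]
      by (intro continuous_intros H_cont gH_cont) simp_all
  qed
  have f_cont: "continuous_on (UNIV \<times> A) (\<lambda>(Q, a). f Q T a)"
  proof -
    have "continuous_on (UNIV \<times> A) (\<lambda>z. f0 (\<Psi> T (fst z) (snd z)) * exp (- H (fst z) (snd z)))"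
      by (intro continuous_intros H_cont continuous_on_compose2[OF init_continuous \<Psi>_cont[OF TT]]) simp
    then show ?thesis
      by (subst continuous_on_cong[OF refl]) (auto simp: f_eq)
  qed
  have f_pos: "0 < f Q T a \<longleftrightarrow> 0 < f0 (\<Psi> T Q a)" if "a \<in> A" for Q a
    using f_eq[OF that, of Q] by (simp add: zero_less_mult_iff)
  have p0: "p Q a = 0" if a: "a \<in> A" and z: "f Q T a = 0" for Q a
  proof -
    have "(\<lambda>h. h \<bullet> p Q a) = (\<lambda>h. 0)"
      by (rule differential_zero_maxmin[OF a open_parameters])
        (use p[OF a, of Q] z density_nonneg[OF _ TT, of _ Q] in \<open>auto simp: gderiv_def\<close>)
    from fun_cong[OF this, of "p Q a"] show ?thesis by simp
  qed
  have sens: "sensitivity f0 \<Phi> f Q T a = (1 / f Q T a) *\<^sub>R p Q a" if a: "a \<in> A" for Q a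
  proof (cases "0 < f0 (\<Psi> T Q a)")
    case True
    then have pos: "0 < f Q T a" using f_pos[OF a] by simp
    then have "DERIV ln (f Q T a) :> 1 / f Q T a" by (auto intro!: derivative_eq_intros)
    then have "gradient (\<lambda>b. ln (f Q T b)) a = (1 / f Q T a) *\<^sub>R p Q a"
      by (intro gradient_eqI GDERIV_DERIV_compose p[OF a])
    then show ?thesis
      using True a by (simp add: sensitivity_def interior_supp backward_end)
  next
    case False
    then have "f Q T a = 0" using f_eq[OF a, of Q] init_nonneg[of "\<Psi> T Q a"] by simp
    then show ?thesis
      using False a by (simp add: sensitivity_def interior_supp backward_end)
  qed
  have sens_bd: "norm (sensitivity f0 \<Phi> f Q T a) \<le> \<Sigma> * norm (score (\<Psi> T Q a)) + Cr"
    if a: "a \<in> A" and pos: "0 < f0 (\<Psi> T Q a)" for Q a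
  proof -
    let ?q = "\<Psi> T Q a"
    have "sensitivity f0 \<Phi> f Q T a = (1 / f0 ?q) *\<^sub>R g0 Q a - gH Q a"
      using pos by (simp add: sens[OF a] f_eq[OF a] p_def scaleR_diff_right)
    moreover have "norm (g0 Q a) \<le> \<Sigma> * norm (riesz_vector (?D0 ?q))"
      unfolding g0_def
    proof (rule norm_riesz_vector_le)
      fix w
      have "\<bar>(?D0 ?q o\<^sub>L Y T (Q, a)) w\<bar> = \<bar>Y T (Q, a) w \<bullet> riesz_vector (?D0 ?q)\<bar>"
        by (simp add: inner_riesz_vector)
      also have "\<dots> \<le> norm (Y T (Q, a) w) * norm (riesz_vector (?D0 ?q))"
        by (rule Cauchy_Schwarz_ineq2)
      also have "\<dots> \<le> \<Sigma> * norm w * norm (riesz_vector (?D0 ?q))"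
        by (intro mult_right_mono Y_bd'[OF TT a]) simp
      finally show "\<bar>(?D0 ?q o\<^sub>L Y T (Q, a)) w\<bar> \<le> \<Sigma> * norm (riesz_vector (?D0 ?q)) * norm w"
        by (simp add: mult_ac)
    qed
    then have "norm ((1 / f0 ?q) *\<^sub>R g0 Q a) \<le> \<Sigma> * norm (score ?q)"
      using pos by (simp add: score_eq[OF pos] divide_right_mono)
    moreover have "norm ((1 / f0 ?q) *\<^sub>R g0 Q a - gH Q a) \<le> norm ((1 / f0 ?q) *\<^sub>R g0 Q a) + norm (gH Q a)"
      by (rule norm_triangle_ineq4)
    ultimately show ?thesis using gH_bd[OF a, of Q] by simp
  qed
  from that[OF p p_cont f_cont f_pos sens p0 sens_bd] show thesis .
qed

end

section \<open>The moment and its gradient\<close>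

lemma continuous_AE_lborel_le:
  fixes g :: "'a::euclidean_space \<Rightarrow> real"
  assumes cont: "continuous_on UNIV g" and ae: "AE x in lborel. g x \<le> c"
  shows "g x \<le> c"
proof (rule ccontr)
  assume "\<not> g x \<le> c"
  then have ne: "{x. c < g x} \<noteq> {}" by (auto simp: not_le)
  have op: "open {x. c < g x}" by (intro open_Collect_less cont continuous_on_const)
  have "{x. c < g x} \<in> null_sets lborel"
    using ae op by (subst AE_iff_null_sets) (auto simp: not_less)
  then have "negligible {x. c < g x}"
    by (simp add: negligible_iff_null_sets null_sets_completionI)
  then show False using open_not_negligible[OF op ne] by simp
qed

context liouville_setting
begin

lemmas transported_density_nonneg = density_nonneg

abbreviation "M\<phi> \<equiv> feature_bound K \<phi>"

lemma feature_measurable: "k \<in> {1..K} \<Longrightarrow> \<phi> k \<in> borel_measurable borel"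
  by (intro borel_measurable_continuous_onI test_continuous)

text \<open>The bound holds at every point and not only almost everywhere, because the test functions are continuous.\<close>

lemma abs_feature_le:
  assumes k: "k \<in> {1..K}"
  shows "\<bar>\<phi> k x\<bar> \<le> M\<phi>"
proof -
  note [measurable] = feature_measurable[OF k]
  obtain c where c: "\<And>x. \<bar>\<phi> k x\<bar> \<le> c"
    using test_bounded[OF k] by (auto simp: bounded_iff)
  define e where "e = esssup lborel (\<lambda>x. ereal \<bar>\<phi> k x\<bar>)"
  have "e \<le> ereal c" unfolding e_def by (rule esssup_I) (use c in auto)
  have ae: "AE x in lborel. ereal \<bar>\<phi> k x\<bar> \<le> e" unfolding e_def by (rule esssup_AE)
  have "\<exists>x. ereal \<bar>\<phi> k x\<bar> \<le> e"
  proof (rule ccontr)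
    assume "\<nexists>x. ereal \<bar>\<phi> k x\<bar> \<le> e"
    then have "AE x in (lborel :: 'x measure). False" using ae by auto
    then show False by (simp add: trivial_limit_def[symmetric] ae_filter_eq_bot_iff)
  qed
  then have "e \<noteq> - \<infinity>" "e \<noteq> \<infinity>" using \<open>e \<le> ereal c\<close> by auto
  then obtain r where r: "e = ereal r" by (cases e) auto
  have "\<bar>\<phi> k x\<bar> \<le> r"
    by (rule continuous_AE_lborel_le[where g = "\<lambda>x. \<bar>\<phi> k x\<bar>"])
      (use ae r in \<open>auto intro!: continuous_intros test_continuous[OF k]\<close>)
  also have "r \<le> M\<phi>"
    unfolding feature_bound_def using k r by (intro Max_ge) (auto simp: e_def image_iff intro!: bexI[of _ k])
  finally show ?thesis .
qed

lemma prob_space_law_init: "prob_space (law f0)"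
  using init_density unfolding probability_density_def by blast

lemma init_measurable [measurable]: "f0 \<in> borel_measurable borel"
  by (rule borel_measurable_continuous_onI[OF init_continuous])

lemma flow_continuous:
  assumes "t \<in> {0..T}"
  shows "continuous_on (UNIV \<times> A) (\<lambda>(q, a). \<Phi> t q a)"
  using continuous_on_compose2[OF forward.y_continuous, of "UNIV \<times> A" "\<lambda>z. (t, z)"] assms
  by (simp add: image_subset_iff continuous_on_Pair continuous_on_const continuous_on_id case_prod_unfold)

lemma continuous_on_state:
  assumes "continuous_on (UNIV \<times> A) (\<lambda>(q, a). g q a)" "a \<in> A"
  shows "continuous_on UNIV (\<lambda>q. g q a)"
  using continuous_on_compose2[OF assms(1), of UNIV "\<lambda>q. (q, a)"] assms(2)
  by (simp add: image_subset_iff continuous_on_Pair continuous_on_const continuous_on_id)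

lemma continuous_on_parameter:
  assumes "continuous_on (UNIV \<times> A) (\<lambda>(q, a). g q a)"
  shows "continuous_on A (\<lambda>a. g q a)"
  using continuous_on_compose2[OF assms(1), of A "\<lambda>a. (q, a)"]
  by (simp add: image_subset_iff continuous_on_Pair continuous_on_const continuous_on_id)

lemma end_time: "T \<in> {0..T}"
  using horizon by simp

lemma flow_measurable: "a \<in> A \<Longrightarrow> (\<lambda>q. \<Phi> T q a) \<in> borel_measurable borel"
  by (intro borel_measurable_continuous_onI continuous_on_state[OF flow_continuous[OF end_time]])

lemma density_measurable: "a \<in> A \<Longrightarrow> (\<lambda>q. f q T a) \<in> borel_measurable borel"
  using density_deriv_state[OF _ end_time]
  by (intro borel_measurable_continuous_onI has_derivative_continuous_on)
    (auto intro: has_derivative_at_withinI)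

lemma
  fixes g :: "'x \<times> 'y \<Rightarrow> 'b::{banach, second_countable_topology}"
  assumes a: "a \<in> A" and g: "g \<in> borel_measurable borel"
  shows integral_flow: "(LINT q|law f0. g (\<Phi> T q a)) = (LINT Q|lborel. f Q T a *\<^sub>R g Q)"
    and integrable_flow: "integrable (law f0) (\<lambda>q. g (\<Phi> T q a)) \<longleftrightarrow> integrable lborel (\<lambda>Q. f Q T a *\<^sub>R g Q)"
proof -
  have flow: "(\<lambda>q. \<Phi> T q a) \<in> measurable (law f0) borel"
    using flow_measurable[OF a] by simp
  have dens: "distr (law f0) borel (\<lambda>q. \<Phi> T q a) = law (\<lambda>Q. f Q T a)"
    by (rule density_pushforward[OF a end_time])
  show "(LINT q|law f0. g (\<Phi> T q a)) = (LINT Q|lborel. f Q T a *\<^sub>R g Q)"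
    unfolding integral_distr[OF flow g, symmetric] dens
    by (rule integral_density) (use g density_measurable[OF a] transported_density_nonneg[OF a end_time] in auto)
  show "integrable (law f0) (\<lambda>q. g (\<Phi> T q a)) \<longleftrightarrow> integrable lborel (\<lambda>Q. f Q T a *\<^sub>R g Q)"
    unfolding integrable_distr_eq[OF flow g, symmetric] dens
    by (rule integrable_density) (use g density_measurable[OF a] transported_density_nonneg[OF a end_time] in auto)
qed

text \<open>The norm of the score, extended by 0. Off the interior of the support the gradient of \<open>ln \<circ> f\<^sub>0\<close> may fail
  to exist and is then an unspecified value.\<close>

definition score_norm :: "'x \<times> 'y \<Rightarrow> real" where
  "score_norm q = indicator (interior (supp f0)) q * norm (score q)"

lemma score_norm_nonneg: "0 \<le> score_norm q"
  by (simp add: score_norm_def)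

lemma
  shows score_norm_measurable [measurable]: "score_norm \<in> borel_measurable borel"
    and score_norm_sq_integrable: "integrable (law f0) (\<lambda>q. (score_norm q)\<^sup>2)"
    and integral_score_norm_sq: "(LINT q|law f0. (score_norm q)\<^sup>2) = score_energy f0"
    and score_norm_integrable: "integrable (law f0) score_norm"
proof -
  interpret prob_space "law f0" by (rule prob_space_law_init)
  have eq: "(\<lambda>q. indicator (interior (supp f0)) q *\<^sub>R (norm (gradient (\<lambda>x. ln (f0 x)) q))\<^sup>2) = (\<lambda>q. (score_norm q)\<^sup>2)"
    by (auto simp: score_norm_def score_def fun_eq_iff indicator_def)
  show int2: "integrable (law f0) (\<lambda>q. (score_norm q)\<^sup>2)"
    using finite_energy unfolding set_integrable_def eq .
  show "(LINT q|law f0. (score_norm q)\<^sup>2) = score_energy f0"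
    unfolding score_energy_def set_lebesgue_integral_def eq ..
  have [measurable]: "(\<lambda>q. (score_norm q)\<^sup>2) \<in> borel_measurable (law f0)"
    by (rule borel_measurable_integrable[OF int2])
  have "(\<lambda>q. sqrt ((score_norm q)\<^sup>2)) \<in> borel_measurable (law f0)"
    by measurable
  then show meas: "score_norm \<in> borel_measurable borel"
    by (simp add: real_sqrt_abs abs_of_nonneg score_norm_nonneg)
  show "integrable (law f0) score_norm"
  proof (rule Bochner_Integration.integrable_bound)
    show "integrable (law f0) (\<lambda>q. 1 + (score_norm q)\<^sup>2)" using int2 by simp
    show "score_norm \<in> borel_measurable (law f0)" using meas by simp
    show "AE q in law f0. norm (score_norm q) \<le> norm (1 + (score_norm q)\<^sup>2)"
    proof (rule AE_I2)
      fix q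
      have "0 \<le> (score_norm q - 1)\<^sup>2" by simp
      then have "2 * score_norm q \<le> 1 + (score_norm q)\<^sup>2" by (simp add: power2_diff)
      then show "norm (score_norm q) \<le> norm (1 + (score_norm q)\<^sup>2)"
        using score_norm_nonneg[of q] by simp
    qed
  qed
qed

lemma
  assumes a: "a \<in> A"
  shows sensitivity_measurable: "(\<lambda>Q. sensitivity f0 \<Phi> f Q T a) \<in> borel_measurable borel"
    and norm_sensitivity_le: "norm (sensitivity f0 \<Phi> f (\<Phi> T q a) T a) \<le> \<Sigma> * score_norm q + Cr"
    and sensitivity_sq_integrable: "integrable (law f0) (\<lambda>q. (norm (sensitivity f0 \<Phi> f (\<Phi> T q a) T a))\<^sup>2)"
    and integral_sensitivity_sq_le: "(LINT q|law f0. (norm (sensitivity f0 \<Phi> f (\<Phi> T q a) T a))\<^sup>2)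
      \<le> Gamma_sq LR MR Lh Mh (score_energy f0) T"
proof -
  interpret prob_space "law f0" by (rule prob_space_law_init)
  obtain p where
    p_cont: "continuous_on (UNIV \<times> A) (\<lambda>(Q, a). p Q a)"
    and f_pos: "\<And>Q a. a \<in> A \<Longrightarrow> 0 < f Q T a \<longleftrightarrow> 0 < f0 (\<Psi> T Q a)"
    and sens: "\<And>Q a. a \<in> A \<Longrightarrow> sensitivity f0 \<Phi> f Q T a = (1 / f Q T a) *\<^sub>R p Q a"
    and bd: "\<And>Q a. a \<in> A \<Longrightarrow> 0 < f0 (\<Psi> T Q a) \<Longrightarrow>
      norm (sensitivity f0 \<Phi> f Q T a) \<le> \<Sigma> * norm (score (\<Psi> T Q a)) + Cr"
    by (rule transported_density_gradient) (rule that)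
  have "(\<lambda>Q. p Q a) \<in> borel_measurable borel"
    by (intro borel_measurable_continuous_onI continuous_on_state[OF p_cont a])
  then show meas: "(\<lambda>Q. sensitivity f0 \<Phi> f Q T a) \<in> borel_measurable borel"
    using density_measurable[OF a] by (simp add: sens[OF a])
  have bound: "norm (sensitivity f0 \<Phi> f (\<Phi> T q a) T a) \<le> \<Sigma> * score_norm q + Cr" for q
  proof (cases "0 < f0 q")
    case True
    then show ?thesis
      using bd[OF a, of "\<Phi> T q a"] by (simp add: backward_end_flow[OF a] score_norm_def interior_supp)
  next
    case False
    then have "\<not> 0 < f (\<Phi> T q a) T a" using f_pos[OF a, of "\<Phi> T q a"] by (simp add: backward_end_flow[OF a])
    then have "f (\<Phi> T q a) T a = 0" using transported_density_nonneg[OF a end_time, of "\<Phi> T q a"] by simp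
    then show ?thesis using False Cr_nonneg by (simp add: sens[OF a] score_norm_def interior_supp)
  qed
  then show "norm (sensitivity f0 \<Phi> f (\<Phi> T q a) T a) \<le> \<Sigma> * score_norm q + Cr" .
  have sq: "(norm (sensitivity f0 \<Phi> f (\<Phi> T q a) T a))\<^sup>2 \<le> 2 * Cr\<^sup>2 + 2 * \<Sigma>\<^sup>2 * (score_norm q)\<^sup>2" for q
  proof -
    have "(norm (sensitivity f0 \<Phi> f (\<Phi> T q a) T a))\<^sup>2 \<le> (\<Sigma> * score_norm q + Cr)\<^sup>2"
      using bound[of q] by (intro power_mono) auto
    also have "\<dots> \<le> 2 * Cr\<^sup>2 + 2 * \<Sigma>\<^sup>2 * (score_norm q)\<^sup>2"
      using sum_squares_bound[of "\<Sigma> * score_norm q" Cr] by (simp add: power2_sum power_mult_distrib mult_ac)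
    finally show ?thesis .
  qed
  have int: "integrable (law f0) (\<lambda>q. 2 * Cr\<^sup>2 + 2 * \<Sigma>\<^sup>2 * (score_norm q)\<^sup>2)"
    using score_norm_sq_integrable by simp
  have "(\<lambda>q. sensitivity f0 \<Phi> f (\<Phi> T q a) T a) \<in> borel_measurable borel"
    using measurable_compose[OF flow_measurable[OF a] meas] .
  then have "(\<lambda>q. (norm (sensitivity f0 \<Phi> f (\<Phi> T q a) T a))\<^sup>2) \<in> borel_measurable (law f0)"
    by simp
  then show int2: "integrable (law f0) (\<lambda>q. (norm (sensitivity f0 \<Phi> f (\<Phi> T q a) T a))\<^sup>2)"
  proof (rule Bochner_Integration.integrable_bound[OF int], intro AE_I2)
    show "norm ((norm (sensitivity f0 \<Phi> f (\<Phi> T q a) T a))\<^sup>2) \<le> norm (2 * Cr\<^sup>2 + 2 * \<Sigma>\<^sup>2 * (score_norm q)\<^sup>2)" for q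
      using sq[of q] by simp
  qed
  have "(LINT q|law f0. (norm (sensitivity f0 \<Phi> f (\<Phi> T q a) T a))\<^sup>2)
      \<le> (LINT q|law f0. 2 * Cr\<^sup>2 + 2 * \<Sigma>\<^sup>2 * (score_norm q)\<^sup>2)"
    by (rule integral_mono[OF int2 int sq])
  also have "\<dots> = Gamma_sq LR MR Lh Mh (score_energy f0) T"
    using score_norm_sq_integrable
    by (simp add: Gamma_sq_def integral_score_norm_sq prob_space[simplified] mult_ac)
  finally show "(LINT q|law f0. (norm (sensitivity f0 \<Phi> f (\<Phi> T q a) T a))\<^sup>2)
      \<le> Gamma_sq LR MR Lh Mh (score_energy f0) T" .
qed

text \<open>The derivative is computed in the coordinates \<open>Q = \<Phi> T q a\<close>, in which the test function does not depend on
  \<open>a\<close>; the majorant is formulated in the initial state \<open>q\<close>, in which it does not depend on \<open>a\<close>.\<close>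

theorem GDERIV_moment:
  assumes k: "k \<in> {1..K}" and a: "a \<in> A"
  shows "GDERIV (moment f0 \<Phi> T (\<phi> k)) a :>
    (LINT q|law f0. \<phi> k (fst (\<Phi> T q a)) *\<^sub>R sensitivity f0 \<Phi> f (\<Phi> T q a) T a)"
proof -
  interpret prob_space "law f0" by (rule prob_space_law_init)
  let ?G = "\<lambda>Q a. sensitivity f0 \<Phi> f Q T a"
  obtain p where
    p: "\<And>Q a. a \<in> A \<Longrightarrow> GDERIV (\<lambda>b. f Q T b) a :> p Q a"
    and p_cont: "continuous_on (UNIV \<times> A) (\<lambda>(Q, a). p Q a)"
    and f_cont: "continuous_on (UNIV \<times> A) (\<lambda>(Q, a). f Q T a)"
    and f_pos: "\<And>Q a. a \<in> A \<Longrightarrow> 0 < f Q T a \<longleftrightarrow> 0 < f0 (\<Psi> T Q a)"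
    and sens: "\<And>Q a. a \<in> A \<Longrightarrow> ?G Q a = (1 / f Q T a) *\<^sub>R p Q a"
    and p0: "\<And>Q a. a \<in> A \<Longrightarrow> f Q T a = 0 \<Longrightarrow> p Q a = 0"
    by (rule transported_density_gradient) (rule that)
  define w where "w = (\<lambda>Q :: 'x \<times> 'y. \<phi> k (fst Q))"
  have w_cont: "continuous_on UNIV w"
    unfolding w_def by (rule continuous_on_compose2[OF test_continuous[OF k] continuous_on_fst[OF continuous_on_id]]) auto
  then have w_meas [measurable]: "w \<in> borel_measurable borel" by (rule borel_measurable_continuous_onI)
  have w_bd: "\<bar>w Q\<bar> \<le> M\<phi>" for Q unfolding w_def by (rule abs_feature_le[OF k])
  have p_eq: "p Q a = f Q T a *\<^sub>R ?G Q a" if "a \<in> A" for Q a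
    using p0[OF that, of Q] sens[OF that, of Q] by (cases "f Q T a = 0") auto
  have bd_int: "integrable (law f0) (\<lambda>q. \<Sigma> * score_norm q + Cr)"
    using score_norm_integrable by simp
  have G_meas: "(\<lambda>q. ?G (\<Phi> T q a) a) \<in> borel_measurable (law f0)" if "a \<in> A" for a
    using measurable_compose[OF flow_measurable[OF that] sensitivity_measurable[OF that]] by simp
  have G_int: "integrable (law f0) (\<lambda>q. ?G (\<Phi> T q a) a)" if "a \<in> A" for a
  proof (rule Bochner_Integration.integrable_bound[OF bd_int G_meas[OF that]], rule AE_I2)
    show "norm (?G (\<Phi> T q a) a) \<le> norm (\<Sigma> * score_norm q + Cr)" for q
      using norm_sensitivity_le[OF that, of q] unfolding real_norm_def by linarith
  qed
  define m where "m = (\<lambda>a. LINT Q|lborel. w Q * f Q T a)"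
  define b where "b = (\<lambda>a. LINT Q|lborel. w Q *\<^sub>R p Q a)"
  have m_eq: "moment f0 \<Phi> T (\<phi> k) a = m a" if "a \<in> A" for a
    using integral_flow[OF that w_meas] by (simp add: moment_def m_def w_def mult.commute)
  have b_eq: "b a = (LINT q|law f0. w (\<Phi> T q a) *\<^sub>R ?G (\<Phi> T q a) a)" if "a \<in> A" for a
  proof -
    have "(\<lambda>Q. w Q *\<^sub>R ?G Q a) \<in> borel_measurable borel"
      using sensitivity_measurable[OF that] by simp
    from integral_flow[OF that this] show ?thesis
      by (simp add: b_def p_eq[OF that] mult.commute)
  qed
  have "GDERIV m a :> b a"
    unfolding m_def b_def
  proof (rule GDERIV_lborel_integral[OF open_parameters a p p_cont w_meas w_bd])
    fix a assume a: "a \<in> A"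
    have "integrable (law f0) (\<lambda>q. w (\<Phi> T q a))"
      using w_bd measurable_compose[OF flow_measurable[OF a] w_meas] by (intro integrable_const_bound[where B = "M\<phi>"]) auto
    then show "integrable lborel (\<lambda>Q. w Q * f Q T a)"
      using integrable_flow[OF a w_meas] by (simp add: mult.commute)
    show "integrable lborel (\<lambda>Q. p Q a)"
      using integrable_flow[OF a sensitivity_measurable[OF a]] G_int[OF a] by (simp add: p_eq[OF a])
    have "(LINT Q|lborel. norm (p Q a)) = (LINT q|law f0. norm (?G (\<Phi> T q a) a))"
      using integral_flow[OF a, of "\<lambda>Q. norm (?G Q a)"] sensitivity_measurable[OF a] transported_density_nonneg[OF a end_time]
      by (simp add: p_eq[OF a])
    also have "\<dots> \<le> (LINT q|law f0. \<Sigma> * score_norm q + Cr)"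
      by (intro integral_mono integrable_norm G_int[OF a] bd_int norm_sensitivity_le[OF a])
    finally show "(LINT Q|lborel. norm (p Q a)) \<le> (LINT q|law f0. \<Sigma> * score_norm q + Cr)" .
  next
    have "continuous_on A b"
    proof (subst continuous_on_sequentially, intro ballI allI impI, elim conjE)
      fix a0 and a :: "nat \<Rightarrow> 'p"
      assume a0: "a0 \<in> A" and a: "\<forall>n. a n \<in> A" and l: "a \<longlonglongrightarrow> a0"
      have conv: "(\<lambda>n. g q (a n)) \<longlonglongrightarrow> g q a0" if "continuous_on (UNIV \<times> A) (\<lambda>(q, a). g q a)"
        for g :: "'x \<times> 'y \<Rightarrow> 'p \<Rightarrow> 'c::topological_space" and q
        by (rule continuous_on_tendsto_compose[OF continuous_on_parameter[OF that] l a0]) (use a in simp)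
      have conv2: "(\<lambda>n. g (\<Phi> T q (a n)) (a n)) \<longlonglongrightarrow> g (\<Phi> T q a0) a0" if "continuous_on (UNIV \<times> A) (\<lambda>(q, a). g q a)"
        for g :: "'x \<times> 'y \<Rightarrow> 'p \<Rightarrow> 'c::topological_space" and q
      proof -
        have "(\<lambda>n. (\<Phi> T q (a n), a n)) \<longlonglongrightarrow> (\<Phi> T q a0, a0)"
          by (intro tendsto_Pair conv[OF flow_continuous[OF end_time]] l)
        from continuous_on_tendsto_compose[OF that this] a0 a show ?thesis by simp
      qed
      have "(\<lambda>n. LINT q|law f0. w (\<Phi> T q (a n)) *\<^sub>R ?G (\<Phi> T q (a n)) (a n))
          \<longlonglongrightarrow> (LINT q|law f0. w (\<Phi> T q a0) *\<^sub>R ?G (\<Phi> T q a0) a0)"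
      proof (rule integral_dominated_convergence[where w = "\<lambda>q. M\<phi> * (\<Sigma> * score_norm q + Cr)"])
        show "(\<lambda>q. w (\<Phi> T q a0) *\<^sub>R ?G (\<Phi> T q a0) a0) \<in> borel_measurable (law f0)"
          using G_meas[OF a0] measurable_compose[OF flow_measurable[OF a0] w_meas] by simp
        show "(\<lambda>q. w (\<Phi> T q (a n)) *\<^sub>R ?G (\<Phi> T q (a n)) (a n)) \<in> borel_measurable (law f0)" for n
          using G_meas[of "a n"] measurable_compose[OF flow_measurable[of "a n"] w_meas] a by simp
        show "integrable (law f0) (\<lambda>q. M\<phi> * (\<Sigma> * score_norm q + Cr))"
          using bd_int by (rule integrable_mult_right)
        show "AE q in law f0. norm (w (\<Phi> T q (a n)) *\<^sub>R ?G (\<Phi> T q (a n)) (a n)) \<le> M\<phi> * (\<Sigma> * score_norm q + Cr)" for n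
        proof (rule AE_I2)
          fix q
          have "0 \<le> M\<phi>" using w_bd[of 0] by linarith
          then show "norm (w (\<Phi> T q (a n)) *\<^sub>R ?G (\<Phi> T q (a n)) (a n)) \<le> M\<phi> * (\<Sigma> * score_norm q + Cr)"
            unfolding norm_scaleR using a w_bd by (intro mult_mono norm_sensitivity_le) auto
        qed
        show "AE q in law f0. (\<lambda>n. w (\<Phi> T q (a n)) *\<^sub>R ?G (\<Phi> T q (a n)) (a n))
            \<longlonglongrightarrow> w (\<Phi> T q a0) *\<^sub>R ?G (\<Phi> T q a0) a0"
          using init_full
        proof eventually_elim
          case (elim q)
          then have "0 < f (\<Phi> T q a0) T a0"
            using f_pos[OF a0, of "\<Phi> T q a0"] by (simp add: backward_end_flow[OF a0] interior_supp)
          then have "(\<lambda>n. (1 / f (\<Phi> T q (a n)) T (a n)) *\<^sub>R p (\<Phi> T q (a n)) (a n))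
              \<longlonglongrightarrow> (1 / f (\<Phi> T q a0) T a0) *\<^sub>R p (\<Phi> T q a0) a0"
            by (intro tendsto_intros conv2[OF f_cont] conv2[OF p_cont]) simp
          then have "(\<lambda>n. ?G (\<Phi> T q (a n)) (a n)) \<longlonglongrightarrow> ?G (\<Phi> T q a0) a0"
            using a by (simp add: sens a0)
          moreover have "(\<lambda>n. w (\<Phi> T q (a n))) \<longlonglongrightarrow> w (\<Phi> T q a0)"
            by (rule continuous_on_tendsto_compose[OF w_cont conv[OF flow_continuous[OF end_time]]]) auto
          ultimately show ?case by (intro tendsto_intros)
        qed
      qed
      then show "(b \<circ> a) \<longlonglongrightarrow> b a0"
        using a by (simp add: b_eq a0 comp_def)
    qed
    then show "continuous_on A (\<lambda>a. LINT Q|lborel. w Q *\<^sub>R p Q a)" by (simp add: b_def)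
  qed
  then have "GDERIV (moment f0 \<Phi> T (\<phi> k)) a :> b a"
    unfolding gderiv_def
    by (rule has_derivative_transform_within_open[OF _ open_parameters a]) (simp add: m_eq)
  then show ?thesis by (simp add: b_eq[OF a] w_def)
qed

lemma abs_observed_moment_le:
  assumes k: "k \<in> {1..K}"
  shows "\<bar>observed_moment ftilde (\<phi> k)\<bar> \<le> M\<phi>"
proof -
  interpret prob_space "law ftilde"
    using observed_density unfolding probability_density_def by blast
  have ft [measurable]: "ftilde \<in> borel_measurable borel" and ft0: "\<And>X. 0 \<le> ftilde X"
    using observed_density unfolding probability_density_def by blast+
  note [measurable] = feature_measurable[OF k]
  have "observed_moment ftilde (\<phi> k) = (LINT X|law ftilde. \<phi> k X)"
    using ft0 by (subst integral_density) (auto simp: observed_moment_def mult.commute)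
  also have "\<bar>\<dots>\<bar> \<le> M\<phi>"
  proof -
    have "integrable (law ftilde) (\<phi> k)"
      using abs_feature_le[OF k] by (intro integrable_const_bound[where B = "M\<phi>"]) auto
    then have "norm (LINT X|law ftilde. \<phi> k X) \<le> (LINT X|law ftilde. M\<phi>)"
      using abs_feature_le[OF k] by (intro order_trans[OF integral_norm_bound] integral_mono) auto
    then show ?thesis by (simp add: prob_space[simplified])
  qed
  finally show ?thesis .
qed

lemma moment_true_parameter:
  assumes k: "k \<in> {1..K}"
  shows "moment f0 \<Phi> T (\<phi> k) a_star = observed_moment ftilde (\<phi> k)"
proof -
  interpret prob_space "law f0" by (rule prob_space_law_init)
  note a = true_parameter
  note [measurable] = feature_measurable[OF k]
  have w: "(\<lambda>Q. \<phi> k (fst Q)) \<in> borel_measurable (borel :: ('x \<times> 'y) measure)"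
    by (rule measurable_compose[OF _ feature_measurable[OF k]]) (simp add: borel_prod[symmetric])
  have "integrable (law f0) (\<lambda>q. \<phi> k (fst (\<Phi> T q a_star)))"
    using abs_feature_le[OF k] measurable_compose[OF flow_measurable[OF a] w]
    by (intro integrable_const_bound[where B = "M\<phi>"]) auto
  then have int: "integrable (lborel \<Otimes>\<^sub>M lborel) (\<lambda>(X, Y). f (X, Y) T a_star * \<phi> k X)"
    using integrable_flow[OF a w] by (simp add: lborel_prod case_prod_unfold)
  have "moment f0 \<Phi> T (\<phi> k) a_star = (LINT Q|(lborel \<Otimes>\<^sub>M lborel). (\<lambda>(X, Y). f (X, Y) T a_star * \<phi> k X) Q)"
    using integral_flow[OF a w] by (simp add: moment_def lborel_prod case_prod_unfold)
  also have "\<dots> = (LINT X|lborel. LINT Y|lborel. f (X, Y) T a_star * \<phi> k X)"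
    using lborel_pair.integral_fst[OF int] by simp
  also have "\<dots> = (LINT X|lborel. \<phi> k X * marginal f X T a_star)"
    by (simp add: marginal_def mult.commute)
  also have "\<dots> = observed_moment ftilde (\<phi> k)"
    unfolding observed_moment_def
  proof (rule integral_cong_AE)
    have "(\<lambda>Q. f Q T a_star) \<in> borel_measurable (lborel \<Otimes>\<^sub>M lborel)"
      using density_measurable[OF a] by (simp add: lborel_prod)
    then have "(\<lambda>X. marginal f X T a_star) \<in> borel_measurable lborel"
      unfolding marginal_def by (intro lborel.borel_measurable_lebesgue_integral) (simp add: case_prod_unfold)
    then show "(\<lambda>X. \<phi> k X * marginal f X T a_star) \<in> borel_measurable lborel"
      using feature_measurable[OF k] by simp
    have "ftilde \<in> borel_measurable borel"
      using observed_density unfolding probability_density_def by blast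
    then show "(\<lambda>X. \<phi> k X * ftilde X) \<in> borel_measurable lborel"
      using feature_measurable[OF k] by simp
    show "AE X in lborel. \<phi> k X * marginal f X T a_star = \<phi> k X * ftilde X"
      using true_marginal by eventually_elim simp
  qed
  finally show ?thesis .
qed

text \<open>If the energy vanished, the derivative of \<open>f\<^sub>0\<close> would vanish where \<open>f\<^sub>0 > 0\<close>, and elsewhere it vanishes
  because \<open>f\<^sub>0\<close> is minimal there; a constant is not a probability density on the whole space.\<close>

lemma score_energy_pos: "0 < score_energy f0"
proof -
  interpret prob_space "law f0" by (rule prob_space_law_init)
  have "0 \<le> score_energy f0"
    using integral_score_norm_sq score_norm_sq_integrable by (metis integral_nonneg_AE AE_I2 zero_le_power2)
  moreover have "score_energy f0 \<noteq> 0"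
  proof
    assume "score_energy f0 = 0"
    then have "AE q in law f0. (score_norm q)\<^sup>2 = 0"
      using integral_nonneg_eq_0_iff_AE[OF score_norm_sq_integrable] integral_score_norm_sq by simp
    then have ae: "AE q in lborel. 0 < f0 q \<longrightarrow> score_norm q = 0"
      by (subst (asm) AE_density) auto
    let ?D = "C1_derivative f0 UNIV"
    have D: "(f0 has_derivative blinfun_apply (?D q)) (at q)" for q
      using C1_derivative[OF init_C1_global, of q] by simp
    have "AE q in lborel. norm (riesz_vector (?D q)) \<le> 0"
      using ae
    proof eventually_elim
      case (elim q)
      show ?case
      proof (cases "0 < f0 q")
        case True
        then show ?thesis using elim by (simp add: score_norm_def interior_supp score_eq)
      next
        case False
        then have "f0 q = 0" using init_nonneg[of q] by simp
        then have "blinfun_apply (?D q) = (\<lambda>v. 0)"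
          by (intro differential_zero_maxmin[OF UNIV_I open_UNIV D[of q]] disjI2 ballI) (simp add: init_nonneg)
        then show ?thesis by (simp add: riesz_vector_def)
      qed
    qed
    then have "norm (riesz_vector (?D q)) \<le> 0" for q
      by (intro continuous_AE_lborel_le[where g = "\<lambda>q. norm (riesz_vector (?D q))"])
        (auto intro!: continuous_intros continuous_on_C1_derivative[OF init_C1_global])
    then have zero: "?D q v = 0" for q v
      using inner_riesz_vector[of v "?D q"] by simp
    have "\<exists>c. \<forall>q\<in>UNIV. f0 q = c"
    proof (rule has_derivative_zero_constant[OF convex_UNIV])
      fix q
      have "blinfun_apply (?D q) = (\<lambda>h. 0)" using zero by (intro ext) simp
      then show "(f0 has_derivative (\<lambda>h. 0)) (at q within UNIV)" using D[of q] by simp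
    qed
    then obtain c where c: "\<And>q. f0 q = c" by blast
    have "emeasure (law f0) UNIV = ennreal c * emeasure lborel (UNIV :: ('x \<times> 'y) set)"
      by (subst emeasure_density) (auto simp: c nn_integral_cmult_indicator)
    then have "1 = ennreal c * \<infinity>"
      using emeasure_space_1 by simp
    then show False by (cases "c \<le> 0") (auto simp: ennreal_neg ennreal_mult_top)
  qed
  ultimately show ?thesis by simp
qed

end

section \<open>Bounds for a single sample and the theorem\<close>

context liouville_setting
begin

abbreviation (input) "\<Gamma>2 \<equiv> Gamma_sq LR MR Lh Mh (score_energy f0) T"

text \<open>The feature \<open>\<mu>\<^sub>k\<close> of the trajectory that starts at \<open>q\<close>, as a function of the initial state.\<close>

definition feature :: "nat \<Rightarrow> 'p \<Rightarrow> 'x \<times> 'y \<Rightarrow> real" where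
  "feature k a q = \<phi> k (fst (\<Phi> T q a))"

text \<open>The product \<open>\<mu>\<^sub>k G\<close>, its mean \<open>b\<^sub>k\<close>, and the spreads \<open>\<sigma>\<^sub>k\<close> and \<open>v\<^sub>k\<close> under the law of the initial state.\<close>

definition weighted_sensitivity :: "nat \<Rightarrow> 'p \<Rightarrow> 'x \<times> 'y \<Rightarrow> 'p" where
  "weighted_sensitivity k a q = feature k a q *\<^sub>R sensitivity f0 \<Phi> f (\<Phi> T q a) T a"

definition mean_gradient :: "nat \<Rightarrow> 'p \<Rightarrow> 'p" where
  "mean_gradient k a = (LINT q|law f0. weighted_sensitivity k a q)"

definition feature_spread :: "nat \<Rightarrow> 'p \<Rightarrow> real" where
  "feature_spread k a = L2_norm (law f0) (\<lambda>q. feature k a q - moment f0 \<Phi> T (\<phi> k) a)"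

definition gradient_spread :: "nat \<Rightarrow> 'p \<Rightarrow> real" where
  "gradient_spread k a = L2_norm (law f0) (\<lambda>q. weighted_sensitivity k a q - mean_gradient k a)"

lemma Gamma_sq_nonneg: "0 \<le> \<Gamma>2"
  using score_energy_pos by (simp add: Gamma_sq_def)

lemma feature_bound_nonneg: "k \<in> {1..K} \<Longrightarrow> 0 \<le> M\<phi>"
  using abs_feature_le[of k 0] abs_ge_zero order_trans by blast

lemma abs_feature_flow_le: "k \<in> {1..K} \<Longrightarrow> \<bar>feature k a q\<bar> \<le> M\<phi>"
  unfolding feature_def by (rule abs_feature_le)

lemma feature_flow_measurable:
  assumes k: "k \<in> {1..K}" and a: "a \<in> A"
  shows "feature k a \<in> borel_measurable borel"
proof -
  have "continuous_on UNIV (\<lambda>q. \<phi> k (fst (\<Phi> T q a)))"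
    by (intro continuous_on_compose2[OF test_continuous[OF k] continuous_on_fst[OF continuous_on_state[OF flow_continuous[OF end_time] a]]]) auto
  then show ?thesis unfolding feature_def[abs_def] by (rule borel_measurable_continuous_onI)
qed

lemma weighted_sensitivity_measurable:
  assumes k: "k \<in> {1..K}" and a: "a \<in> A"
  shows "weighted_sensitivity k a \<in> borel_measurable borel"
  unfolding weighted_sensitivity_def[abs_def]
  using feature_flow_measurable[OF k a] measurable_compose[OF flow_measurable[OF a] sensitivity_measurable[OF a]]
  by simp

lemma
  assumes k: "k \<in> {1..K}" and a: "a \<in> A"
  shows weighted_sensitivity_square: "square_integrable_fun (law f0) (weighted_sensitivity k a)"
    and weighted_sensitivity_second_moment:
      "(LINT q|law f0. (norm (weighted_sensitivity k a q))\<^sup>2) \<le> M\<phi>\<^sup>2 * \<Gamma>2"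
proof -
  let ?G = "\<lambda>q. sensitivity f0 \<Phi> f (\<Phi> T q a) T a"
  have maj: "integrable (law f0) (\<lambda>q. M\<phi>\<^sup>2 * (norm (?G q))\<^sup>2)"
    using sensitivity_sq_integrable[OF a] by simp
  have le: "(norm (weighted_sensitivity k a q))\<^sup>2 \<le> M\<phi>\<^sup>2 * (norm (?G q))\<^sup>2" for q
  proof -
    have "(feature k a q)\<^sup>2 \<le> M\<phi>\<^sup>2"
      using abs_feature_flow_le[OF k, of a q] by (rule abs_le_square_iff[THEN iffD1, OF order_trans[OF _ abs_ge_self]])
    then show ?thesis
      by (auto simp: weighted_sensitivity_def power_mult_distrib intro!: mult_right_mono)
  qed
  have meas: "weighted_sensitivity k a \<in> borel_measurable (law f0)"
    using weighted_sensitivity_measurable[OF k a] by simp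
  have int: "integrable (law f0) (\<lambda>q. (norm (weighted_sensitivity k a q))\<^sup>2)"
  proof (rule Bochner_Integration.integrable_bound[OF maj])
    show "(\<lambda>q. (norm (weighted_sensitivity k a q))\<^sup>2) \<in> borel_measurable (law f0)" using meas by simp
    show "AE q in law f0. norm ((norm (weighted_sensitivity k a q))\<^sup>2) \<le> norm (M\<phi>\<^sup>2 * (norm (?G q))\<^sup>2)"
      using le by (intro AE_I2) simp
  qed
  then show "square_integrable_fun (law f0) (weighted_sensitivity k a)"
    using meas by (simp add: square_integrable_fun_def)
  have "(LINT q|law f0. (norm (weighted_sensitivity k a q))\<^sup>2) \<le> (LINT q|law f0. M\<phi>\<^sup>2 * (norm (?G q))\<^sup>2)"
    by (rule integral_mono[OF int maj le])
  also have "\<dots> \<le> M\<phi>\<^sup>2 * \<Gamma>2"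
    using integral_sensitivity_sq_le[OF a] by (simp add: mult_left_mono)
  finally show "(LINT q|law f0. (norm (weighted_sensitivity k a q))\<^sup>2) \<le> M\<phi>\<^sup>2 * \<Gamma>2" .
qed

lemma
  assumes k: "k \<in> {1..K}" and a: "a \<in> A"
  shows norm_mean_gradient_le: "norm (mean_gradient k a) \<le> M\<phi> * sqrt \<Gamma>2"
    and gradient_spread_le: "gradient_spread k a \<le> M\<phi> * sqrt \<Gamma>2"
    and gradient_spread_nonneg: "0 \<le> gradient_spread k a"
    and feature_spread_le: "feature_spread k a \<le> M\<phi>"
    and feature_spread_nonneg: "0 \<le> feature_spread k a"
    and abs_moment_le: "\<bar>moment f0 \<Phi> T (\<phi> k) a\<bar> \<le> M\<phi>"
proof -
  interpret prob_space "law f0" by (rule prob_space_law_init)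
  note M0 = feature_bound_nonneg[OF k]
  have root: "sqrt (M\<phi>\<^sup>2 * \<Gamma>2) = M\<phi> * sqrt \<Gamma>2" using M0 by (simp add: real_sqrt_mult)
  have dec: "expectation (\<lambda>q. (norm (weighted_sensitivity k a q - mean_gradient k a))\<^sup>2)
      + (norm (mean_gradient k a))\<^sup>2 \<le> M\<phi>\<^sup>2 * \<Gamma>2"
    using expectation_centred_square[OF weighted_sensitivity_square[OF k a]]
      weighted_sensitivity_second_moment[OF k a] by (simp add: mean_gradient_def)
  have nn: "0 \<le> expectation (\<lambda>q. (norm (weighted_sensitivity k a q - mean_gradient k a))\<^sup>2)"
    by (rule integral_nonneg_AE) simp
  have "(norm (mean_gradient k a))\<^sup>2 \<le> M\<phi>\<^sup>2 * \<Gamma>2" using dec nn by linarith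
  then show "norm (mean_gradient k a) \<le> M\<phi> * sqrt \<Gamma>2"
    unfolding root[symmetric] by (rule real_le_rsqrt)
  have "expectation (\<lambda>q. (norm (weighted_sensitivity k a q - mean_gradient k a))\<^sup>2) \<le> M\<phi>\<^sup>2 * \<Gamma>2"
    using dec zero_le_power2[of "norm (mean_gradient k a)"] by linarith
  then show "gradient_spread k a \<le> M\<phi> * sqrt \<Gamma>2"
    unfolding root[symmetric] gradient_spread_def L2_norm_def by (rule real_sqrt_le_mono)
  show "0 \<le> gradient_spread k a" "0 \<le> feature_spread k a"
    using nn by (auto simp: gradient_spread_def feature_spread_def L2_norm_def)
  have mom: "moment f0 \<Phi> T (\<phi> k) a = expectation (feature k a)"
    by (simp add: moment_def feature_def[abs_def])
  have meas: "feature k a \<in> borel_measurable (law f0)" using feature_flow_measurable[OF k a] by simp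
  have sq_le: "(feature k a q)\<^sup>2 \<le> M\<phi>\<^sup>2" for q
    using abs_feature_flow_le[OF k, of a q] by (rule abs_le_square_iff[THEN iffD1, OF order_trans[OF _ abs_ge_self]])
  have int2: "integrable (law f0) (\<lambda>q. (feature k a q)\<^sup>2)"
    using sq_le meas by (intro integrable_const_bound[where B = "M\<phi>\<^sup>2"]) auto
  have F: "square_integrable_fun (law f0) (feature k a)"
    using meas int2 by (simp add: square_integrable_fun_def)
  have "expectation (\<lambda>q. (feature k a q)\<^sup>2) \<le> expectation (\<lambda>q. M\<phi>\<^sup>2)"
    by (rule integral_mono[OF int2 _ sq_le]) simp
  then have F2: "expectation (\<lambda>q. (feature k a q)\<^sup>2) \<le> M\<phi>\<^sup>2" by (simp add: prob_space[simplified])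
  have decF: "expectation (\<lambda>q. (norm (feature k a q - moment f0 \<Phi> T (\<phi> k) a))\<^sup>2)
      + (moment f0 \<Phi> T (\<phi> k) a)\<^sup>2 \<le> M\<phi>\<^sup>2"
    using expectation_centred_square[OF F] F2 by (simp add: mom)
  have "expectation (\<lambda>q. (norm (feature k a q - moment f0 \<Phi> T (\<phi> k) a))\<^sup>2) \<le> M\<phi>\<^sup>2"
    using decF zero_le_power2[of "moment f0 \<Phi> T (\<phi> k) a"] by linarith
  then show "feature_spread k a \<le> M\<phi>"
    unfolding feature_spread_def L2_norm_def using M0 by (intro real_le_lsqrt) auto
  have "0 \<le> expectation (\<lambda>q. (norm (feature k a q - moment f0 \<Phi> T (\<phi> k) a))\<^sup>2)"
    by (rule integral_nonneg_AE) simp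
  then have "(moment f0 \<Phi> T (\<phi> k) a)\<^sup>2 \<le> M\<phi>\<^sup>2" using decF by linarith
  then show "\<bar>moment f0 \<Phi> T (\<phi> k) a\<bar> \<le> M\<phi>" using M0 abs_le_square_iff[of "moment f0 \<Phi> T (\<phi> k) a" M\<phi>] by simp
qed

lemma GDERIV_moment_mean_gradient: "k \<in> {1..K} \<Longrightarrow> a \<in> A \<Longrightarrow> GDERIV (moment f0 \<Phi> T (\<phi> k)) a :> mean_gradient k a"
  using GDERIV_moment by (simp add: mean_gradient_def weighted_sensitivity_def[abs_def] feature_def)

text \<open>The misfit is continuous with value 0 at the true parameter, while the spread stays bounded.\<close>

lemma misfit_term_vanishes:
  assumes k: "k \<in> {1..K}"
  shows "((\<lambda>a. \<bar>moment f0 \<Phi> T (\<phi> k) a - observed_moment ftilde (\<phi> k)\<bar> * gradient_spread k a / c) \<longlongrightarrow> 0)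
    (at a_star within A)"
proof (rule Lim_null_comparison)
  let ?\<Delta> = "\<lambda>a. moment f0 \<Phi> T (\<phi> k) a - observed_moment ftilde (\<phi> k)"
  have "(moment f0 \<Phi> T (\<phi> k) \<longlongrightarrow> moment f0 \<Phi> T (\<phi> k) a_star) (at a_star within A)"
    using has_derivative_continuous[OF GDERIV_moment_mean_gradient[OF k true_parameter, unfolded gderiv_def]]
    unfolding continuous_within by (rule tendsto_within_subset) simp
  then have "(?\<Delta> \<longlongrightarrow> 0) (at a_star within A)"
    using moment_true_parameter[OF k] by (simp add: LIM_zero_iff)
  then have "((\<lambda>a. \<bar>?\<Delta> a\<bar>) \<longlongrightarrow> 0) (at a_star within A)" by (rule tendsto_rabs_zero)
  from tendsto_mult_left_zero[OF this, of "M\<phi> * sqrt \<Gamma>2 / \<bar>c\<bar>"]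
  show "((\<lambda>a. \<bar>?\<Delta> a\<bar> * (M\<phi> * sqrt \<Gamma>2 / \<bar>c\<bar>)) \<longlongrightarrow> 0) (at a_star within A)" .
  have "norm (\<bar>?\<Delta> a\<bar> * gradient_spread k a / c) \<le> \<bar>?\<Delta> a\<bar> * (M\<phi> * sqrt \<Gamma>2 / \<bar>c\<bar>)" if "a \<in> A" for a
    using gradient_spread_le[OF k that] gradient_spread_nonneg[OF k that]
    by (auto simp: abs_mult intro!: divide_right_mono mult_left_mono)
  then show "\<forall>\<^sub>F a in at a_star within A. norm (\<bar>?\<Delta> a\<bar> * gradient_spread k a / c)
      \<le> \<bar>?\<Delta> a\<bar> * (M\<phi> * sqrt \<Gamma>2 / \<bar>c\<bar>)"
    unfolding eventually_at_filter by (intro always_eventually allI impI)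
qed

end

lemma
  fixes g :: "'q::euclidean_space \<Rightarrow> 'b::{banach, second_countable_topology}"
  assumes "distributed M lborel Z f0" and "g \<in> borel_measurable borel"
  shows distributed_integral: "(LINT \<omega>|M. g (Z \<omega>)) = (LINT q|density lborel f0. g q)"
    and distributed_integrable: "integrable M (\<lambda>\<omega>. g (Z \<omega>)) \<longleftrightarrow> integrable (density lborel f0) g"
proof -
  have Z: "Z \<in> measurable M lborel" and law: "distr M lborel Z = density lborel f0"
    using assms(1) by (auto simp: distributed_def)
  have g: "g \<in> borel_measurable lborel" using assms(2) by simp
  show "(LINT \<omega>|M. g (Z \<omega>)) = (LINT q|density lborel f0. g q)"
    unfolding law[symmetric] by (rule integral_distr[OF Z g, symmetric])
  show "integrable M (\<lambda>\<omega>. g (Z \<omega>)) \<longleftrightarrow> integrable (density lborel f0) g"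
    unfolding law[symmetric] by (rule integrable_distr_eq[OF Z g, symmetric])
qed

theorem theorem4p2:
  fixes A :: "(real ^ 'p) set"
    and T :: real
    and R :: "(real ^ 'dx) \<times> (real ^ 'dy) \<Rightarrow> real \<Rightarrow> real ^ 'p \<Rightarrow> (real ^ 'dx) \<times> (real ^ 'dy)"
    and f0 :: "(real ^ 'dx) \<times> (real ^ 'dy) \<Rightarrow> real"
    and \<Phi> :: "real \<Rightarrow> (real ^ 'dx) \<times> (real ^ 'dy) \<Rightarrow> real ^ 'p \<Rightarrow> (real ^ 'dx) \<times> (real ^ 'dy)"
    and f :: "(real ^ 'dx) \<times> (real ^ 'dy) \<Rightarrow> real \<Rightarrow> real ^ 'p \<Rightarrow> real"
    and K k N :: nat
    and \<phi> :: "nat \<Rightarrow> real ^ 'dx \<Rightarrow> real"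
    and ftilde :: "real ^ 'dx \<Rightarrow> real"
    and a_star \<alpha> :: "real ^ 'p"
    and M :: "'w measure"
    and q0 :: "nat \<Rightarrow> 'w \<Rightarrow> (real ^ 'dx) \<times> (real ^ 'dy)"
  assumes setting: "liouville_setting A T R f0 \<Phi> f K \<phi> ftilde a_star"
    and parameter: "\<alpha> \<in> A"
    and feature: "k \<in> {1..K}"
    and sample_size: "2 \<le> N"
    and probability: "prob_space M"
    and independent: "prob_space.indep_vars M (\<lambda>_. borel) q0 {1..N}"
    and identically_distributed: "\<And>n. n \<in> {1..N} \<Longrightarrow> distributed M lborel (q0 n) f0"
  shows
    "let LR = sup_over T A (norm_dq_R R);
         MR = sup_over T A (norm_da_R R);
         Lh = sup_over T A (norm_dq_h R);
         Mh = sup_over T A (norm_da_h R);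
         C2 = score_energy f0;
         M\<phi> = feature_bound K \<phi>;
         \<mu>t = observed_moment ftilde (\<phi> k);
         \<Delta> = (\<lambda>a. moment f0 \<Phi> T (\<phi> k) a - \<mu>t);
         \<mu> = (\<lambda>a n \<omega>. \<phi> k (fst (\<Phi> T (q0 n \<omega>) a)));
         G = (\<lambda>a n \<omega>. sensitivity f0 \<Phi> f (\<Phi> T (q0 n \<omega>) a) T a);
         b = (\<lambda>a n. LINT \<omega>|M. \<mu> a n \<omega> *\<^sub>R G a n \<omega>);
         \<sigma> = (\<lambda>a n. sqrt (prob_space.variance M (\<mu> a n)));
         v = (\<lambda>a n. sqrt (LINT \<omega>|M. (norm (\<mu> a n \<omega> *\<^sub>R G a n \<omega> - b a n))\<^sup>2));
         g = (\<lambda>\<omega>. crossed_estimator N (\<lambda>n. \<mu> \<alpha> n \<omega>) \<mu>t (\<lambda>n. G \<alpha> n \<omega>));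
         Eg = (LINT \<omega>|M. g \<omega>);
         V = (LINT \<omega>|M. (norm (g \<omega> - Eg))\<^sup>2)
     in
       integrable M g \<and> integrable M (\<lambda>\<omega>. (norm (g \<omega> - Eg))\<^sup>2) \<and>
       (\<forall>n\<in>{1..N}.
          integrable M (\<lambda>\<omega>. \<mu> \<alpha> n \<omega> *\<^sub>R G \<alpha> n \<omega>) \<and>
          integrable M (\<lambda>\<omega>. (norm (\<mu> \<alpha> n \<omega> *\<^sub>R G \<alpha> n \<omega> - b \<alpha> n))\<^sup>2) \<and>
          (GDERIV (moment f0 \<Phi> T (\<phi> k)) \<alpha> :> b \<alpha> n) \<and>
          sqrt V \<le> (\<sigma> \<alpha> n * norm (b \<alpha> n) + \<bar>\<Delta> \<alpha>\<bar> * v \<alpha> n) / sqrt (real N)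
                     + 2 * M\<phi> * v \<alpha> n / (sqrt (real N) - 1) \<and>
          ((\<lambda>a. \<bar>\<Delta> a\<bar> * v a n / sqrt (real N)) \<longlongrightarrow> 0) (at a_star within A) \<and>
          (\<alpha> = a_star \<longrightarrow>
             sqrt V \<le> \<sigma> \<alpha> n * norm (b \<alpha> n) / sqrt (real N)
                        + 2 * M\<phi> * v \<alpha> n / (sqrt (real N) - 1))) \<and>
       (4 \<le> N \<longrightarrow> V \<le> 49 * M\<phi> ^ 4 * Gamma_sq LR MR Lh Mh C2 T / real N) \<and>
       (0 < LR \<longrightarrow>
          (0 < MR \<longrightarrow>
             (\<lambda>s. (Sigma_const LR MR s)\<^sup>2) \<in> \<Theta>(\<lambda>s. exp (2 * LR * s)) \<and>
             (0 < M\<phi> \<longrightarrow>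
                (\<lambda>s. 49 * M\<phi> ^ 4 * Gamma_sq LR MR Lh Mh C2 s) \<in> \<Omega>(\<lambda>s. exp (2 * LR * s)))) \<and>
          (\<lambda>s. 49 * M\<phi> ^ 4 * Gamma_sq LR MR Lh Mh C2 s) \<in> O(\<lambda>s. s\<^sup>2 * exp (2 * LR * s)))"
proof -
  interpret S: liouville_setting A T R f0 \<Phi> f K \<phi> ftilde a_star by (rule setting)
  interpret prob_space M by (rule probability)
  note k = feature
  define LR where "LR = sup_over T A (norm_dq_R R)"
  define MR where "MR = sup_over T A (norm_da_R R)"
  define Lh where "Lh = sup_over T A (norm_dq_h R)"
  define Mh where "Mh = sup_over T A (norm_da_h R)"
  define C2 where "C2 = score_energy f0"
  define M\<phi> where "M\<phi> = feature_bound K \<phi>"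
  define \<mu>t where "\<mu>t = observed_moment ftilde (\<phi> k)"
  define \<Delta> where "\<Delta> = (\<lambda>a. moment f0 \<Phi> T (\<phi> k) a - \<mu>t)"
  define \<mu> where "\<mu> = (\<lambda>a n \<omega>. \<phi> k (fst (\<Phi> T (q0 n \<omega>) a)))"
  define G where "G = (\<lambda>a n \<omega>. sensitivity f0 \<Phi> f (\<Phi> T (q0 n \<omega>) a) T a)"
  define b where "b = (\<lambda>a n. LINT \<omega>|M. \<mu> a n \<omega> *\<^sub>R G a n \<omega>)"
  define \<sigma> where "\<sigma> = (\<lambda>a n. sqrt (variance (\<mu> a n)))"
  define v where "v = (\<lambda>a n. sqrt (LINT \<omega>|M. (norm (\<mu> a n \<omega> *\<^sub>R G a n \<omega> - b a n))\<^sup>2))"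
  define g where "g = (\<lambda>\<omega>. crossed_estimator N (\<lambda>n. \<mu> \<alpha> n \<omega>) \<mu>t (\<lambda>n. G \<alpha> n \<omega>))"
  define Eg where "Eg = (LINT \<omega>|M. g \<omega>)"
  define V where "V = (LINT \<omega>|M. (norm (g \<omega> - Eg))\<^sup>2)"
  note defs = LR_def MR_def Lh_def Mh_def C2_def M\<phi>_def \<mu>t_def \<Delta>_def \<mu>_def G_def b_def \<sigma>_def v_def
    g_def Eg_def V_def
  let ?\<Gamma> = "Gamma_sq LR MR Lh Mh C2 T"
  have \<mu>_eq: "\<mu> a n \<omega> = S.feature k a (q0 n \<omega>)" for a n \<omega>
    by (simp add: \<mu>_def S.feature_def)
  have \<mu>G_eq: "\<mu> a n \<omega> *\<^sub>R G a n \<omega> = S.weighted_sensitivity k a (q0 n \<omega>)" for a n \<omega>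
    by (simp add: \<mu>_eq G_def S.weighted_sensitivity_def)
  have b_eq: "b a n = S.mean_gradient k a" if "a \<in> A" "n \<in> {1..N}" for a n
    unfolding b_def \<mu>G_eq S.mean_gradient_def
    by (rule distributed_integral[OF identically_distributed[OF that(2)] S.weighted_sensitivity_measurable[OF k that(1)]])
  have v_eq: "v a n = S.gradient_spread k a" if "a \<in> A" "n \<in> {1..N}" for a n
    unfolding v_def \<mu>G_eq b_eq[OF that] S.gradient_spread_def L2_norm_def
    using S.weighted_sensitivity_measurable[OF k that(1)]
    by (subst distributed_integral[OF identically_distributed[OF that(2)], symmetric]) auto
  have mean_\<mu>: "expectation (\<mu> a n) = moment f0 \<Phi> T (\<phi> k) a" if "a \<in> A" "n \<in> {1..N}" for a n
    unfolding moment_def S.feature_def[symmetric] \<mu>_eq[abs_def]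
    by (rule distributed_integral[OF identically_distributed[OF that(2)] S.feature_flow_measurable[OF k that(1)]])
  have \<sigma>_eq: "\<sigma> a n = S.feature_spread k a" if "a \<in> A" "n \<in> {1..N}" for a n
    unfolding \<sigma>_def mean_\<mu>[OF that] S.feature_spread_def L2_norm_def \<mu>_eq
    using S.feature_flow_measurable[OF k that(1)]
    by (subst distributed_integral[OF identically_distributed[OF that(2)], symmetric]) auto
  have W_sq: "integrable M (\<lambda>\<omega>. (norm (\<mu> \<alpha> n \<omega> *\<^sub>R G \<alpha> n \<omega>))\<^sup>2)" if "n \<in> {1..N}" for n
    unfolding \<mu>G_eq
    using S.weighted_sensitivity_measurable[OF k parameter] S.weighted_sensitivity_square[OF k parameter]
    by (subst distributed_integrable[OF identically_distributed[OF that]]) (auto simp: square_integrable_fun_def)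
  interpret U: crossed_sample M N "\<mu> \<alpha>" "\<lambda>n \<omega>. \<mu> \<alpha> n \<omega> *\<^sub>R G \<alpha> n \<omega>" "moment f0 \<Phi> T (\<phi> k) \<alpha>"
    "S.mean_gradient k \<alpha>" "S.feature_spread k \<alpha>" "S.gradient_spread k \<alpha>" M\<phi>
  proof unfold_locales
    show "indep_vars (\<lambda>_. borel) (\<lambda>i \<omega>. (\<mu> \<alpha> i \<omega>, \<mu> \<alpha> i \<omega> *\<^sub>R G \<alpha> i \<omega>)) {1..N}"
      unfolding \<mu>G_eq unfolding \<mu>_eq
      by (rule indep_vars_compose2[OF independent, where Y = "\<lambda>_ q. (S.feature k \<alpha> q, S.weighted_sensitivity k \<alpha> q)"])
        (intro borel_measurable_Pair S.feature_flow_measurable[OF k parameter] S.weighted_sensitivity_measurable[OF k parameter])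
    show "\<bar>\<mu> \<alpha> i \<omega>\<bar> \<le> M\<phi>" for i \<omega>
      unfolding \<mu>_eq M\<phi>_def by (rule S.abs_feature_flow_le[OF k])
    fix i assume i: "i \<in> {1..N}"
    show "expectation (\<lambda>\<omega>. \<mu> \<alpha> i \<omega> *\<^sub>R G \<alpha> i \<omega>) = S.mean_gradient k \<alpha>"
      using b_eq[OF parameter i] by (simp add: b_def)
    show "L2_norm M (\<lambda>\<omega>. \<mu> \<alpha> i \<omega> - moment f0 \<Phi> T (\<phi> k) \<alpha>) = S.feature_spread k \<alpha>"
      using \<sigma>_eq[OF parameter i] by (simp add: \<sigma>_def mean_\<mu>[OF parameter i] L2_norm_def)
    show "L2_norm M (\<lambda>\<omega>. \<mu> \<alpha> i \<omega> *\<^sub>R G \<alpha> i \<omega> - S.mean_gradient k \<alpha>) = S.gradient_spread k \<alpha>"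
      using v_eq[OF parameter i] by (simp add: v_def b_eq[OF parameter i] L2_norm_def)
  qed (use sample_size W_sq mean_\<mu>[OF parameter] in auto)
  have g_eq: "g = U.estimator \<mu>t"
    by (rule ext) (simp add: g_def U.estimator_def crossed_estimator_eq)
  have Eg_eq: "Eg = (moment f0 \<Phi> T (\<phi> k) \<alpha> - \<mu>t) *\<^sub>R S.mean_gradient k \<alpha>"
    unfolding Eg_def g_eq by (rule U.estimator_mean)
  have g_int: "integrable M g" unfolding g_eq by (rule U.estimator_integrable)
  have g_sq: "integrable M (\<lambda>\<omega>. (norm (g \<omega> - Eg))\<^sup>2)" unfolding Eg_eq g_eq by (rule U.estimator_square)
  let ?s = "S.feature_spread k \<alpha>" and ?v = "S.gradient_spread k \<alpha>" and ?b = "norm (S.mean_gradient k \<alpha>)"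
  have M0: "0 \<le> M\<phi>" unfolding M\<phi>_def by (rule S.feature_bound_nonneg[OF k])
  have s: "0 \<le> ?s" "?s \<le> M\<phi>" and v: "0 \<le> ?v" "?v \<le> M\<phi> * sqrt ?\<Gamma>" and b: "?b \<le> M\<phi> * sqrt ?\<Gamma>"
    using S.feature_spread_nonneg[OF k parameter] S.feature_spread_le[OF k parameter]
      S.gradient_spread_nonneg[OF k parameter] S.gradient_spread_le[OF k parameter]
      S.norm_mean_gradient_le[OF k parameter]
    by (simp_all add: M\<phi>_def LR_def MR_def Lh_def Mh_def C2_def)
  have n: "1 < sqrt (real N)" "0 < sqrt (real N) - 1" using sample_size by auto
  have V_bound: "sqrt V \<le> (?s * ?b + \<bar>\<Delta> \<alpha>\<bar> * ?v) / sqrt (real N) + 2 * M\<phi> * ?v / (sqrt (real N) - 1)"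
  proof -
    have "sqrt V \<le> (?s * ?b + \<bar>\<Delta> \<alpha>\<bar> * ?v) / sqrt (real N) + ?s * ?v / sqrt (real N - 1)"
      using U.estimator_spread[of \<mu>t] by (simp add: V_def g_eq Eg_eq L2_norm_def \<Delta>_def)
    also have "?s * ?v / sqrt (real N - 1) \<le> 2 * M\<phi> * ?v / (sqrt (real N) - 1)"
    proof (rule frac_le)
      have "real N \<le> (sqrt (real N - 1) + 1)\<^sup>2"
        using sample_size by (simp add: power2_sum)
      then have "sqrt (real N) \<le> sqrt (real N - 1) + 1"
        using sample_size by (intro real_le_lsqrt) auto
      then show "sqrt (real N) - 1 \<le> sqrt (real N - 1)" by simp
      show "?s * ?v \<le> 2 * M\<phi> * ?v" using s v M0 by (intro mult_right_mono) auto
    qed (use n v M0 in auto)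
    finally show ?thesis by simp
  qed
  \<comment> \<open>The factor 4 below comes from \<open>sqrt N - 1 \<ge> sqrt N / 2\<close>, which is where \<open>N \<ge> 4\<close> enters.\<close>
  have V_49: "V \<le> 49 * M\<phi> ^ 4 * ?\<Gamma> / real N" if N4: "4 \<le> N"
  proof -
    define r where "r = sqrt ?\<Gamma>"
    have \<Gamma>0: "0 \<le> ?\<Gamma>"
      using S.Gamma_sq_nonneg by (simp add: LR_def MR_def Lh_def Mh_def C2_def)
    have r0: "0 \<le> r" and r2: "r\<^sup>2 = ?\<Gamma>" using \<Gamma>0 by (simp_all add: r_def)
    have D: "\<bar>\<Delta> \<alpha>\<bar> \<le> 2 * M\<phi>"
      using S.abs_moment_le[OF k parameter] S.abs_observed_moment_le[OF k]
      by (simp add: \<Delta>_def \<mu>t_def M\<phi>_def)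
    have "sqrt 4 \<le> sqrt (real N)" using N4 by (intro real_sqrt_le_mono) simp
    then have half: "sqrt (real N) / 2 \<le> sqrt (real N) - 1" by simp
    have "?s * ?b \<le> M\<phi> * (M\<phi> * r)" using s b M0 by (intro mult_mono) (auto simp: r_def)
    moreover have "\<bar>\<Delta> \<alpha>\<bar> * ?v \<le> 2 * M\<phi> * (M\<phi> * r)" using D v M0 by (intro mult_mono) (auto simp: r_def)
    ultimately have "(?s * ?b + \<bar>\<Delta> \<alpha>\<bar> * ?v) / sqrt (real N) \<le> 3 * (M\<phi> * (M\<phi> * r)) / sqrt (real N)"
      using n by (intro divide_right_mono) auto
    moreover have "2 * M\<phi> * ?v / (sqrt (real N) - 1) \<le> 2 * M\<phi> * (M\<phi> * r) / (sqrt (real N) / 2)"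
      using v M0 n half r0 by (intro frac_le mult_left_mono) (auto simp: r_def)
    ultimately have "sqrt V \<le> 3 * (M\<phi> * (M\<phi> * r)) / sqrt (real N) + 2 * M\<phi> * (M\<phi> * r) / (sqrt (real N) / 2)"
      using V_bound by linarith
    also have "\<dots> = 7 * (M\<phi>\<^sup>2 * r) / sqrt (real N)"
      using n by (simp add: field_simps power2_eq_square)
    finally have root: "sqrt V \<le> 7 * (M\<phi>\<^sup>2 * r) / sqrt (real N)" .
    have V0: "0 \<le> V" unfolding V_def by (rule integral_nonneg_AE) simp
    have "V = (sqrt V)\<^sup>2" using V0 by simp
    also have "\<dots> \<le> (7 * (M\<phi>\<^sup>2 * r) / sqrt (real N))\<^sup>2" using root V0 by (intro power_mono) auto
    also have "\<dots> = 49 * M\<phi> ^ 4 * r\<^sup>2 / real N"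
      by (simp add: power_divide power_mult_distrib)
    finally show ?thesis unfolding r2 .
  qed
  have per_sample: "integrable M (\<lambda>\<omega>. \<mu> \<alpha> n \<omega> *\<^sub>R G \<alpha> n \<omega>) \<and>
      integrable M (\<lambda>\<omega>. (norm (\<mu> \<alpha> n \<omega> *\<^sub>R G \<alpha> n \<omega> - b \<alpha> n))\<^sup>2) \<and>
      (GDERIV (moment f0 \<Phi> T (\<phi> k)) \<alpha> :> b \<alpha> n) \<and>
      sqrt V \<le> (\<sigma> \<alpha> n * norm (b \<alpha> n) + \<bar>\<Delta> \<alpha>\<bar> * v \<alpha> n) / sqrt (real N)
                 + 2 * M\<phi> * v \<alpha> n / (sqrt (real N) - 1) \<and>
      ((\<lambda>a. \<bar>\<Delta> a\<bar> * v a n / sqrt (real N)) \<longlongrightarrow> 0) (at a_star within A) \<and>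
      (\<alpha> = a_star \<longrightarrow>
         sqrt V \<le> \<sigma> \<alpha> n * norm (b \<alpha> n) / sqrt (real N)
                    + 2 * M\<phi> * v \<alpha> n / (sqrt (real N) - 1))"
    if i: "n \<in> {1..N}" for n
  proof (intro conjI impI)
    note bn = b_eq[OF parameter i] and vn = v_eq[OF parameter i] and sn = \<sigma>_eq[OF parameter i]
    show "integrable M (\<lambda>\<omega>. \<mu> \<alpha> n \<omega> *\<^sub>R G \<alpha> n \<omega>)"
      by (rule square_integrable_fun_imp_integrable[OF U.W_square_integrable[OF i]])
    show "integrable M (\<lambda>\<omega>. (norm (\<mu> \<alpha> n \<omega> *\<^sub>R G \<alpha> n \<omega> - b \<alpha> n))\<^sup>2)"
      using U.\<eta>_square_integrable[OF i] by (simp add: square_integrable_fun_def U.\<eta>_def[abs_def] bn)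
    show "GDERIV (moment f0 \<Phi> T (\<phi> k)) \<alpha> :> b \<alpha> n"
      unfolding bn by (rule S.GDERIV_moment_mean_gradient[OF k parameter])
    show bound: "sqrt V \<le> (\<sigma> \<alpha> n * norm (b \<alpha> n) + \<bar>\<Delta> \<alpha>\<bar> * v \<alpha> n) / sqrt (real N)
        + 2 * M\<phi> * v \<alpha> n / (sqrt (real N) - 1)"
      unfolding bn vn sn by (rule V_bound)
    have "\<forall>\<^sub>F a in at a_star within A. \<bar>\<Delta> a\<bar> * S.gradient_spread k a / sqrt (real N) = \<bar>\<Delta> a\<bar> * v a n / sqrt (real N)"
      unfolding eventually_at_filter using v_eq[OF _ i] by (intro always_eventually allI impI) simp
    from Lim_transform_eventually[OF _ this]
    show "((\<lambda>a. \<bar>\<Delta> a\<bar> * v a n / sqrt (real N)) \<longlongrightarrow> 0) (at a_star within A)"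
      using S.misfit_term_vanishes[OF k] by (simp add: \<Delta>_def \<mu>t_def)
    assume "\<alpha> = a_star"
    then have "\<Delta> \<alpha> = 0" using S.moment_true_parameter[OF k] by (simp add: \<Delta>_def \<mu>t_def)
    then show "sqrt V \<le> \<sigma> \<alpha> n * norm (b \<alpha> n) / sqrt (real N) + 2 * M\<phi> * v \<alpha> n / (sqrt (real N) - 1)"
      using bound by simp
  qed
  have growth_theta: "(\<lambda>s. (Sigma_const LR MR s)\<^sup>2) \<in> \<Theta>(\<lambda>s. exp (2 * LR * s))" if "0 < LR" "0 < MR"
    by (rule Sigma_const_sq_bigtheta[OF that])
  have growth_omega: "(\<lambda>s. 49 * M\<phi> ^ 4 * Gamma_sq LR MR Lh Mh C2 s) \<in> \<Omega>(\<lambda>s. exp (2 * LR * s))"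
    if "0 < LR" "0 < MR" "0 < M\<phi>"
    by (rule Gamma_sq_bigomega[OF that(1,2)]) (use S.score_energy_pos that(3) in \<open>auto simp: C2_def\<close>)
  have growth_O: "(\<lambda>s. 49 * M\<phi> ^ 4 * Gamma_sq LR MR Lh Mh C2 s) \<in> O(\<lambda>s. s\<^sup>2 * exp (2 * LR * s))"
    if "0 < LR"
    by (rule Gamma_sq_bigo[OF that])
  have "
       integrable M g \<and> integrable M (\<lambda>\<omega>. (norm (g \<omega> - Eg))\<^sup>2) \<and>
       (\<forall>n\<in>{1..N}.
          integrable M (\<lambda>\<omega>. \<mu> \<alpha> n \<omega> *\<^sub>R G \<alpha> n \<omega>) \<and>
          integrable M (\<lambda>\<omega>. (norm (\<mu> \<alpha> n \<omega> *\<^sub>R G \<alpha> n \<omega> - b \<alpha> n))\<^sup>2) \<and>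
          (GDERIV (moment f0 \<Phi> T (\<phi> k)) \<alpha> :> b \<alpha> n) \<and>
          sqrt V \<le> (\<sigma> \<alpha> n * norm (b \<alpha> n) + \<bar>\<Delta> \<alpha>\<bar> * v \<alpha> n) / sqrt (real N)
                     + 2 * M\<phi> * v \<alpha> n / (sqrt (real N) - 1) \<and>
          ((\<lambda>a. \<bar>\<Delta> a\<bar> * v a n / sqrt (real N)) \<longlongrightarrow> 0) (at a_star within A) \<and>
          (\<alpha> = a_star \<longrightarrow>
             sqrt V \<le> \<sigma> \<alpha> n * norm (b \<alpha> n) / sqrt (real N)
                        + 2 * M\<phi> * v \<alpha> n / (sqrt (real N) - 1))) \<and>
       (4 \<le> N \<longrightarrow> V \<le> 49 * M\<phi> ^ 4 * Gamma_sq LR MR Lh Mh C2 T / real N) \<and>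
       (0 < LR \<longrightarrow>
          (0 < MR \<longrightarrow>
             (\<lambda>s. (Sigma_const LR MR s)\<^sup>2) \<in> \<Theta>(\<lambda>s. exp (2 * LR * s)) \<and>
             (0 < M\<phi> \<longrightarrow>
                (\<lambda>s. 49 * M\<phi> ^ 4 * Gamma_sq LR MR Lh Mh C2 s) \<in> \<Omega>(\<lambda>s. exp (2 * LR * s)))) \<and>
          (\<lambda>s. 49 * M\<phi> ^ 4 * Gamma_sq LR MR Lh Mh C2 s) \<in> O(\<lambda>s. s\<^sup>2 * exp (2 * LR * s)))"
    by (intro conjI ballI impI g_int g_sq per_sample V_49 growth_theta growth_omega growth_O)
  then show ?thesis unfolding Let_def defs .
qed

end
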